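(* Let $m\in\mathbb{Z}_{\ge 1}$. (1) If $\vec\mu=(\mu_0,\ldots,\mu_{m-1})\in(\mathcal D')^m$ is a normalized allowable $m$-tuple, then the operator $M_{\vec\mu}:\mathcal D_{\vec\mu}^2\to\mathcal D_{\vec\mu}^2$ is a bounded $m$-isometry, with (the class of the constant function) $1$ as a cyclic unit vector. (2) Conversely, let $\mathcal H$ be a complex separable Hilbert space and let $T$ be a bounded $m$-isometry on $\mathcal H$ with a cyclic unit vector $e$. Then $\vec\mu=(\mu_0,\ldots,\mu_{m-1})\in(\mathcal D')^m$ given by $$\hat\mu_n(k)=\overline{\hat\mu_n(-k)}=\langle\beta_n(T)e,T^ke\rangle_{\mathcal H},\quad k\in\mathbb Z_{\ge 0},\ 0\le n\le m-1,$$ is a normalized allowable $m$-tuple, and there exists a unitary map $U:\mathcal H\to\mathcal D_{\vec\mu}^2$ such that $T=U^*M_{\vec\mu}U$ and $Ue=1$. (3) If $T_j:\mathcal H_j\to\mathcal H_j$, $j\in\{1,2\}$, are bounded $m$-isometries on complex separable Hilbert spaces with cyclic vectors $e_j$, then the associated $m$-tuples $\vec\mu_1,\vec\mu_2$ (defined from $(T_j,e_j)$ by the formula in (2)) coincide if and only if there exists a unitary map $U:\mathcal H_1\to\mathcal H_2$ such that $T_1=U^*T_2U$ and $Ue_1=e_2$.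
   Context: $\mathbb D$ is the open unit disc, $\mathbb T$ the unit circle. $\mathcal D'$ is the space of distributions on $\mathbb T$; for $\mu\in\mathcal D'$, $\hat\mu(k)=\mu(\zeta^{-k})$, $k\in\mathbb Z$. Distributions correspond exactly to sequences $(\hat\mu(k))_{k\in\mathbb Z}$ with $|\hat\mu(k)|\le C(1+|k|)^N$ for some $C,N$. The Poisson extension is $P_\mu(z)=\sum_{k\ge0}\hat\mu(k)z^k+\sum_{k\ge1}\hat\mu(-k)\bar z^k$, $z\in\mathbb D$. $\mathcal D_a$ is the space of functions analytic on $\mathbb D$ and smooth on $\overline{\mathbb D}$ (equivalently $f(z)=\sum_{k\ge0}\hat f(k)z^k$ with rapidly decaying coefficients), and $(M_zf)(z)=zf(z)$. Dirichlet integrals: for $\mu\in\mathcal D'$, $f\in\mathcal D_a$, $n\ge1$, $$\mathcal D_{\mu,n}(f)=\lim_{r\to1^-}\frac1{n!(n-1)!\pi}\int_{r\mathbb D}|f^{(n)}(z)|^2P_\mu(z)(1-|z|^2)^{n-1}\,dA(z)$$ ($dA$ area measure), and $\mathcal D_{\mu,0}(f)=\lim_{r\to1^-}\frac1{2\pi r}\int_{r\mathbb T}|f|^2P_\mu\,d\lambda=\mu(|f|^2)$ ($d\lambda$ arc length). These limits exist. For $\vec\mu=(\mu_0,\ldots,\mu_{m-1})\in(\mathcal D')^m$ put $\|f\|_{\vec\mu}^2=\sum_{n=0}^{m-1}\mathcal D_{\mu_n,n}(f)$, $f\in\mathcal D_a$. The tuple is allowable if there is $C>0$ with $0\le\|M_zf\|_{\vec\mu}^2\le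 C^2\|f\|_{\vec\mu}^2$ for all $f\in\mathcal D_a$; an allowable tuple is normalized if $\hat\mu_0(0)=1$. For an allowable tuple, $\mathcal K_{\vec\mu}=\{f\in\mathcal D_a:\|f\|_{\vec\mu}=0\}$, $\mathcal D_{\vec\mu}^2$ is the Hilbert space completion of $\mathcal D_a/\mathcal K_{\vec\mu}$ with respect to $\|\cdot\|_{\vec\mu}$, and $M_{\vec\mu}$ is the unique bounded linear extension to $\mathcal D_{\vec\mu}^2$ of the operator induced by $M_z$ on $\mathcal D_a/\mathcal K_{\vec\mu}$. For a bounded operator $T$ on a Hilbert space, $\beta_n(T)=\sum_{j=0}^n(-1)^{n-j}\binom nj T^{*j}T^j$; $T$ is an $m$-isometry if $\beta_m(T)=0$. A vector $e$ is cyclic for $T$ if the closed linear span of $\{T^ke:k\ge0\}$ is the whole space. *)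

theory Defs
  imports
    "HOL-Analysis.Analysis"
    "HOL-Algebra.Algebraic_Closure_Type"
    "HOL-Library.Complex_Order"
begin

section \<open>Hilbert spaces with explicit carriers\<close>

text \<open>
  The space attached to a tuple of distributions depends on a term, so it cannot be a type.
  Complex inner product spaces are therefore modules (in the sense of HOL-Algebra) over the
  complex numbers with an additional inner product, linear in the first argument. The
  multiplicative fields \<open>mult\<close> and \<open>one\<close> inherited by the module record play no role.
\<close>

abbreviation complex_ring :: "complex ring" where
  "complex_ring \<equiv> ring_of_type_algebra"

record 'a hilb = "(complex, 'a) module" +
  cinner :: "'a \<Rightarrow> 'a \<Rightarrow> complex"

definition hnorm :: "'a hilb \<Rightarrow> 'a \<Rightarrow> real" where
  "hnorm H x = sqrt (Re (cinner H x x))"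

text \<open>The library's type of metrics asks for a distance that is symmetric and nonnegative
  also off the carrier, hence the value 0 there.\<close>

definition hmetric :: "'a hilb \<Rightarrow> 'a metric" where
  "hmetric H = metric (carrier H,
     \<lambda>x y. if x \<in> carrier H \<and> y \<in> carrier H then hnorm H (x \<ominus>\<^bsub>H\<^esub> y) else 0)"

definition complex_inner_space :: "'a hilb \<Rightarrow> bool" where
  "complex_inner_space H \<longleftrightarrow>
     module complex_ring H \<and>
     (\<forall>x\<in>carrier H. \<forall>y\<in>carrier H. cinner H y x = cnj (cinner H x y)) \<and>
     (\<forall>x\<in>carrier H. \<forall>y\<in>carrier H. \<forall>z\<in>carrier H.
        cinner H (x \<oplus>\<^bsub>H\<^esub> y) z = cinner H x z + cinner H y z) \<and>
     (\<forall>c. \<forall>x\<in>carrier H. \<forall>y\<in>carrier H. cinner H (c \<odot>\<^bsub>H\<^esub> x) y = c * cinner H x y) \<and>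
     (\<forall>x\<in>carrier H. 0 \<le> cinner H x x) \<and>
     (\<forall>x\<in>carrier H. cinner H x x = 0 \<longrightarrow> x = \<zero>\<^bsub>H\<^esub>)"

definition hilbert_space :: "'a hilb \<Rightarrow> bool" where
  "hilbert_space H \<longleftrightarrow> complex_inner_space H \<and> mcomplete_of (hmetric H)"

definition separable_hilbert_space :: "'a hilb \<Rightarrow> bool" where
  "separable_hilbert_space H \<longleftrightarrow> hilbert_space H \<and> separable_space (mtopology_of (hmetric H))"

definition linear_op :: "'a hilb \<Rightarrow> 'b hilb \<Rightarrow> ('a \<Rightarrow> 'b) \<Rightarrow> bool" where
  "linear_op H K T \<longleftrightarrow>
     T \<in> carrier H \<rightarrow> carrier K \<and>
     (\<forall>x\<in>carrier H. \<forall>y\<in>carrier H. T (x \<oplus>\<^bsub>H\<^esub> y) = T x \<oplus>\<^bsub>K\<^esub> T y) \<and>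
     (\<forall>c. \<forall>x\<in>carrier H. T (c \<odot>\<^bsub>H\<^esub> x) = c \<odot>\<^bsub>K\<^esub> T x)"

definition bounded_op :: "'a hilb \<Rightarrow> 'b hilb \<Rightarrow> ('a \<Rightarrow> 'b) \<Rightarrow> bool" where
  "bounded_op H K T \<longleftrightarrow>
     linear_op H K T \<and> (\<exists>B. \<forall>x\<in>carrier H. hnorm K (T x) \<le> B * hnorm H x)"

definition adj :: "'a hilb \<Rightarrow> 'b hilb \<Rightarrow> ('a \<Rightarrow> 'b) \<Rightarrow> 'b \<Rightarrow> 'a" where
  "adj H K T y =
     (THE x. x \<in> carrier H \<and> (\<forall>h\<in>carrier H. cinner K (T h) y = cinner H h x))"

definition unitary_map :: "'a hilb \<Rightarrow> 'b hilb \<Rightarrow> ('a \<Rightarrow> 'b) \<Rightarrow> bool" where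
  "unitary_map H K U \<longleftrightarrow>
     linear_op H K U \<and> bij_betw U (carrier H) (carrier K) \<and>
     (\<forall>x\<in>carrier H. \<forall>y\<in>carrier H. cinner K (U x) (U y) = cinner H x y)"

definition beta :: "'a hilb \<Rightarrow> ('a \<Rightarrow> 'a) \<Rightarrow> nat \<Rightarrow> 'a \<Rightarrow> 'a" where
  "beta H T n x =
     finsum H (\<lambda>j. ((-1) ^ (n - j) * of_nat (n choose j)) \<odot>\<^bsub>H\<^esub> (adj H H T ^^ j) ((T ^^ j) x)) {..n}"

definition m_isometry :: "'a hilb \<Rightarrow> nat \<Rightarrow> ('a \<Rightarrow> 'a) \<Rightarrow> bool" where
  "m_isometry H m T \<longleftrightarrow>
     hilbert_space H \<and> bounded_op H H T \<and> (\<forall>x\<in>carrier H. beta H T m x = \<zero>\<^bsub>H\<^esub>)"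

definition closed_span :: "'a hilb \<Rightarrow> 'a set \<Rightarrow> 'a set" where
  "closed_span H S =
     mtopology_of (hmetric H) closure_of (\<Inter>{W. submodule W complex_ring H \<and> S \<subseteq> W})"

definition cyclic_vector :: "'a hilb \<Rightarrow> ('a \<Rightarrow> 'a) \<Rightarrow> 'a \<Rightarrow> bool" where
  "cyclic_vector H T e \<longleftrightarrow>
     e \<in> carrier H \<and> closed_span H (range (\<lambda>k. (T ^^ k) e)) = carrier H"

text \<open>
  Hilbert space completion. The argument only needs to be a semi-inner product space \<open>P\<close>:
  Cauchy sequences in \<open>P\<close> are identified when their difference is a null sequence, which is the
  completion of the quotient of \<open>P\<close> by the vectors of seminorm 0.
\<close>

definition cauchy_seqs :: "'a hilb \<Rightarrow> (nat \<Rightarrow> 'a) set" where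
  "cauchy_seqs P = {F. range F \<subseteq> carrier P \<and>
     (\<forall>\<epsilon>>0. \<exists>N. \<forall>i\<ge>N. \<forall>j\<ge>N. hnorm P (F i \<ominus>\<^bsub>P\<^esub> F j) < \<epsilon>)}"

definition null_rel :: "'a hilb \<Rightarrow> ((nat \<Rightarrow> 'a) \<times> (nat \<Rightarrow> 'a)) set" where
  "null_rel P = {(F, G). F \<in> cauchy_seqs P \<and> G \<in> cauchy_seqs P \<and>
     (\<lambda>i. hnorm P (F i \<ominus>\<^bsub>P\<^esub> G i)) \<longlonglongrightarrow> 0}"

definition completion :: "'a hilb \<Rightarrow> (nat \<Rightarrow> 'a) set hilb" where
  "completion P = \<lparr>
     carrier = cauchy_seqs P // null_rel P,
     mult = undefined, one = undefined,
     zero = null_rel P `` {\<lambda>i. \<zero>\<^bsub>P\<^esub>},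
     add = (\<lambda>A B. \<Union>F\<in>A. \<Union>G\<in>B. null_rel P `` {\<lambda>i. F i \<oplus>\<^bsub>P\<^esub> G i}),
     smult = (\<lambda>c A. \<Union>F\<in>A. null_rel P `` {\<lambda>i. c \<odot>\<^bsub>P\<^esub> F i}),
     cinner = (\<lambda>A B. THE c. \<forall>F\<in>A. \<forall>G\<in>B. (\<lambda>i. cinner P (F i) (G i)) \<longlonglongrightarrow> c) \<rparr>"

definition to_completion :: "'a hilb \<Rightarrow> 'a \<Rightarrow> (nat \<Rightarrow> 'a) set" where
  "to_completion P x = null_rel P `` {\<lambda>i. x}"


section \<open>Distributions on the unit circle\<close>

text \<open>
  Functions on the circle are identified with \<open>2 * pi\<close>-periodic functions of the angle. A
  distribution is a functional on the smooth functions that is linear and continuous (bounded by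
  finitely many of the sup norms of the derivatives); it is given the value 0 off the test functions
  so that equality of distributions is equality of HOL functions.
\<close>

definition nth_vderiv :: "nat \<Rightarrow> (real \<Rightarrow> complex) \<Rightarrow> real \<Rightarrow> complex" where
  "nth_vderiv n = (\<lambda>g t. vector_derivative g (at t)) ^^ n"

definition test_functions :: "(real \<Rightarrow> complex) set" where
  "test_functions = {\<phi>. (\<forall>t. \<phi> (t + 2 * pi) = \<phi> t) \<and>
     (\<forall>n. nth_vderiv n \<phi> differentiable_on UNIV)}"

definition distributions :: "((real \<Rightarrow> complex) \<Rightarrow> complex) set" where
  "distributions = {\<mu>.
     (\<forall>\<phi>\<in>test_functions. \<forall>\<psi>\<in>test_functions. \<mu> (\<lambda>t. \<phi> t + \<psi> t) = \<mu> \<phi> + \<mu> \<psi>) \<and>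
     (\<forall>c. \<forall>\<phi>\<in>test_functions. \<mu> (\<lambda>t. c * \<phi> t) = c * \<mu> \<phi>) \<and>
     (\<exists>C N. \<forall>\<phi>\<in>test_functions. cmod (\<mu> \<phi>) \<le> C * (\<Sum>j\<le>N. SUP t. cmod (nth_vderiv j \<phi> t))) \<and>
     (\<forall>\<phi>. \<phi> \<notin> test_functions \<longrightarrow> \<mu> \<phi> = 0)}"

definition fourier_coeff :: "((real \<Rightarrow> complex) \<Rightarrow> complex) \<Rightarrow> int \<Rightarrow> complex" where
  "fourier_coeff \<mu> k = \<mu> (\<lambda>t. cis t powi (- k))"

definition poisson_ext :: "((real \<Rightarrow> complex) \<Rightarrow> complex) \<Rightarrow> complex \<Rightarrow> complex" where
  "poisson_ext \<mu> z =
     (\<Sum>k. fourier_coeff \<mu> (int k) * z ^ k) +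
     (\<Sum>k. fourier_coeff \<mu> (- int (Suc k)) * cnj z ^ Suc k)"


section \<open>Dirichlet integrals and the associated spaces\<close>

text \<open>
  Analytic functions on the open disc that are smooth on the closed disc: every derivative
  extends continuously to the closed disc (for analytic functions the complex derivatives give
  all partial derivatives). Values outside the closed disc are unconstrained. They do not affect
  the Dirichlet integrals, so functions that agree on the disc are identified in the
  completion formed below.
\<close>

definition Da :: "(complex \<Rightarrow> complex) set" where
  "Da = {f. f holomorphic_on ball 0 1 \<and> continuous_on (cball 0 1) f \<and>
     (\<forall>n. \<exists>g. continuous_on (cball 0 1) g \<and> (\<forall>z\<in>ball 0 1. g z = (deriv ^^ n) f z))}"

definition Mz :: "(complex \<Rightarrow> complex) \<Rightarrow> complex \<Rightarrow> complex" where
  "Mz f = (\<lambda>z. z * f z)"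

text \<open>For \<open>n = 0\<close> the arc length integral over the circle of radius \<open>r\<close> is written in the
  parametrization \<open>t \<mapsto> r * cis t\<close>, with \<open>d\<lambda> = r dt\<close>.\<close>

definition dirichlet_int ::
  "((real \<Rightarrow> complex) \<Rightarrow> complex) \<Rightarrow> nat \<Rightarrow> (complex \<Rightarrow> complex) \<Rightarrow> complex" where
  "dirichlet_int \<mu> n f =
     (if n = 0 then
        Lim (at_left 1) (\<lambda>r::real. complex_of_real (1 / (2 * pi * r)) *
          (LINT t:{0..2 * pi}|lborel.
             complex_of_real ((cmod (f (r * cis t)))\<^sup>2) * poisson_ext \<mu> (r * cis t) * r))
      else
        Lim (at_left 1) (\<lambda>r::real. complex_of_real (1 / (fact n * fact (n - 1) * pi)) *
          (LINT z:ball 0 r|lborel.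
             complex_of_real ((cmod ((deriv ^^ n) f z))\<^sup>2) * poisson_ext \<mu> z *
             complex_of_real ((1 - (cmod z)\<^sup>2) ^ (n - 1)))))"

text \<open>A tuple is a list \<open>[\<mu>\<^sub>0, \<dots>, \<mu>\<^sub>m\<^sub>-\<^sub>1]\<close>. Its quadratic form is complex-valued, as the
  distributions need not be real.\<close>

definition sqnorm :: "((real \<Rightarrow> complex) \<Rightarrow> complex) list \<Rightarrow> (complex \<Rightarrow> complex) \<Rightarrow> complex" where
  "sqnorm \<mu> f = (\<Sum>n<length \<mu>. dirichlet_int (\<mu> ! n) n f)"

text \<open>The inequalities are in the order of the complex numbers, where \<open>0 \<le> w\<close> includes that
  \<open>w\<close> is real.\<close>

definition allowable :: "nat \<Rightarrow> ((real \<Rightarrow> complex) \<Rightarrow> complex) list \<Rightarrow> bool" where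
  "allowable m \<mu> \<longleftrightarrow>
     length \<mu> = m \<and> set \<mu> \<subseteq> distributions \<and>
     (\<exists>C::real. C > 0 \<and> (\<forall>f\<in>Da.
        0 \<le> sqnorm \<mu> (Mz f) \<and> sqnorm \<mu> (Mz f) \<le> complex_of_real (C\<^sup>2) * sqnorm \<mu> f))"

definition normalized_allowable :: "nat \<Rightarrow> ((real \<Rightarrow> complex) \<Rightarrow> complex) list \<Rightarrow> bool" where
  "normalized_allowable m \<mu> \<longleftrightarrow> allowable m \<mu> \<and> fourier_coeff (\<mu> ! 0) 0 = 1"

text \<open>The semi-inner product is the one that polarization attaches to the quadratic form.\<close>

definition Da_space :: "((real \<Rightarrow> complex) \<Rightarrow> complex) list \<Rightarrow> (complex \<Rightarrow> complex) hilb" where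
  "Da_space \<mu> = \<lparr>
     carrier = Da,
     mult = undefined, one = undefined,
     zero = (\<lambda>z. 0),
     add = (\<lambda>f g z. f z + g z),
     smult = (\<lambda>c f z. c * f z),
     cinner = (\<lambda>f g. (\<Sum>k<4. \<i> ^ k * sqnorm \<mu> (\<lambda>z. f z + \<i> ^ k * g z)) / 4) \<rparr>"

definition D2 ::
  "((real \<Rightarrow> complex) \<Rightarrow> complex) list \<Rightarrow> (nat \<Rightarrow> complex \<Rightarrow> complex) set hilb" where
  "D2 \<mu> = completion (Da_space \<mu>)"

definition D2_class ::
  "((real \<Rightarrow> complex) \<Rightarrow> complex) list \<Rightarrow> (complex \<Rightarrow> complex) \<Rightarrow> (nat \<Rightarrow> complex \<Rightarrow> complex) set" where
  "D2_class \<mu> f = to_completion (Da_space \<mu>) f"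

definition M_op ::
  "((real \<Rightarrow> complex) \<Rightarrow> complex) list \<Rightarrow>
   (nat \<Rightarrow> complex \<Rightarrow> complex) set \<Rightarrow> (nat \<Rightarrow> complex \<Rightarrow> complex) set" where
  "M_op \<mu> = (THE M. M \<in> extensional (carrier (D2 \<mu>)) \<and> bounded_op (D2 \<mu>) (D2 \<mu>) M \<and>
     (\<forall>f\<in>Da. M (D2_class \<mu> f) = D2_class \<mu> (Mz f)))"

definition associated_tuple ::
  "nat \<Rightarrow> 'a hilb \<Rightarrow> ('a \<Rightarrow> 'a) \<Rightarrow> 'a \<Rightarrow> ((real \<Rightarrow> complex) \<Rightarrow> complex) list \<Rightarrow> bool" where
  "associated_tuple m H T e \<mu> \<longleftrightarrow>
     length \<mu> = m \<and> set \<mu> \<subseteq> distributions \<and>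
     (\<forall>n<m. \<forall>k::nat.
        fourier_coeff (\<mu> ! n) (int k) = cinner H (beta H T n e) ((T ^^ k) e) \<and>
        cnj (fourier_coeff (\<mu> ! n) (- int k)) = cinner H (beta H T n e) ((T ^^ k) e))"

end

theory Submission
  imports Defs "HOL-Complex_Analysis.Complex_Analysis" "HOL-Real_Asymp.Real_Asymp"
begin

text \<open>
  Tuples of distributions and \<open>m\<close>-isometries with a cyclic vector are two descriptions of the same
  infinite matrices.

  Let \<open>f\<close> have Taylor coefficients \<open>a\<^sub>k\<close>. In the Dirichlet integral of order \<open>n\<close>, rotation invariance
  leaves for each pair of monomials \<open>z\<^sup>k\<close> and \<open>z\<^sup>l\<close> only the frequency \<open>l - k\<close> of the distribution, and
  the radial factor is a Beta integral. The factorials cancel, and \<open>dirichlet_int_eq\<close> says that the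
  integral is the sesquilinear form in the \<open>a\<^sub>k\<close> with the entries
  \<open>(min k l choose n) \<cdot> fourier_coeff \<mu> (l - k)\<close>. Hence the Gram matrix of the monomials for a tuple
  has, along the diagonal of offset \<open>d\<close>, the values at \<open>k\<close> of a polynomial of degree less than \<open>m\<close>
  whose \<open>n\<close>-th Newton coefficient is the \<open>d\<close>-th Fourier coefficient of \<open>\<mu>\<^sub>n\<close>.

  On the operator side \<open>\<langle>\<beta>\<^sub>n(T) e, T\<^sup>d e\<rangle>\<close> is the \<open>n\<close>-th finite difference, at the start of the
  diagonal of offset \<open>d\<close>, of the Gram matrix \<open>\<langle>T\<^sup>k e, T\<^sup>l e\<rangle>\<close>, and \<open>T\<close> is an \<open>m\<close>-isometry as soon as
  all \<open>m\<close>-th differences along the diagonals vanish. By Newton's formula (\<open>gram_eq\<close>) the Gram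
  matrices of both sides have the same shape, and the formula for the tuple of \<open>(T, e)\<close> is the one that
  makes them equal (\<open>tuple_matrix_gram\<close>).

  A total sequence is determined up to a unitary map by its Gram matrix (\<open>unitary_from_gram\<close>), so
  equality of Gram matrices is all that is needed for the unitary equivalences. This uses that monomials
  are total in the space of a tuple (\<open>power_total\<close>), which holds because functions smooth up to the
  boundary have rapidly decreasing coefficients.

  Finally, the numbers attached to \<open>(T, e)\<close> must be Fourier coefficients of distributions. These are
  exactly the polynomially bounded sequences (\<open>distribution_coeff_bound\<close>, \<open>distribution_exists\<close>,
  \<open>distribution_eqI\<close>), and the orbit of an \<open>m\<close>-isometry grows polynomially since \<open>\<parallel>T\<^sup>k e\<parallel>\<^sup>2\<close> is a
  polynomial in \<open>k\<close> (\<open>x_growth\<close>).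
\<close>

section \<open>Semi-inner product spaces\<close>

lemma complex_ring_simps [simp]:
  "carrier complex_ring = UNIV" "a \<oplus>\<^bsub>complex_ring\<^esub> b = a + b" "a \<otimes>\<^bsub>complex_ring\<^esub> b = a * b"
  "\<one>\<^bsub>complex_ring\<^esub> = 1" "\<zero>\<^bsub>complex_ring\<^esub> = 0"
  by (auto simp: ring_of_type_algebra_def)

locale semi_inner_space = module complex_ring P for P :: "'a hilb" (structure) +
  assumes cinner_herm: "x \<in> carrier P \<Longrightarrow> y \<in> carrier P \<Longrightarrow> cinner P y x = cnj (cinner P x y)"
    and cinner_add_left: "\<lbrakk>x \<in> carrier P; y \<in> carrier P; z \<in> carrier P\<rbrakk> \<Longrightarrow>
          cinner P (x \<oplus> y) z = cinner P x z + cinner P y z"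
    and cinner_smult_left: "\<lbrakk>x \<in> carrier P; y \<in> carrier P\<rbrakk> \<Longrightarrow>
          cinner P (c \<odot> x) y = c * cinner P x y"
    and cinner_nonneg: "x \<in> carrier P \<Longrightarrow> 0 \<le> cinner P x x"
begin

lemma smult_in [simp, intro]: "x \<in> carrier P \<Longrightarrow> c \<odot> x \<in> carrier P"
  by (rule smult_closed) auto

lemma cinner_add_right: "\<lbrakk>x \<in> carrier P; y \<in> carrier P; z \<in> carrier P\<rbrakk> \<Longrightarrow>
    cinner P z (x \<oplus> y) = cinner P z x + cinner P z y"
  by (metis M.add.m_closed cinner_add_left cinner_herm complex_cnj_add)

lemma cinner_smult_right: "\<lbrakk>x \<in> carrier P; y \<in> carrier P\<rbrakk> \<Longrightarrow>
    cinner P y (c \<odot> x) = cnj c * cinner P y x"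
  by (metis smult_in cinner_smult_left cinner_herm complex_cnj_mult)

lemma cinner_zero_left [simp]: "y \<in> carrier P \<Longrightarrow> cinner P \<zero> y = 0"
  using cinner_add_left[of \<zero> \<zero> y] by simp

lemma cinner_zero_right [simp]: "y \<in> carrier P \<Longrightarrow> cinner P y \<zero> = 0"
  using cinner_add_right[of \<zero> \<zero> y] by simp

lemma cinner_uminus_left: "\<lbrakk>x \<in> carrier P; y \<in> carrier P\<rbrakk> \<Longrightarrow> cinner P (\<ominus> x) y = - cinner P x y"
  using cinner_add_left[of x "\<ominus> x" y] by (simp add: M.r_neg eq_neg_iff_add_eq_0 add.commute)

lemma cinner_diff_left: "\<lbrakk>x \<in> carrier P; y \<in> carrier P; z \<in> carrier P\<rbrakk> \<Longrightarrow>
    cinner P (x \<ominus> y) z = cinner P x z - cinner P y z"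
  by (simp add: a_minus_def cinner_add_left cinner_uminus_left)

lemma cinner_diff_right: "\<lbrakk>x \<in> carrier P; y \<in> carrier P; z \<in> carrier P\<rbrakk> \<Longrightarrow>
    cinner P z (x \<ominus> y) = cinner P z x - cinner P z y"
  by (metis M.minus_closed cinner_diff_left cinner_herm complex_cnj_diff)

lemma minus_eq_zero_iff: "\<lbrakk>x \<in> carrier P; y \<in> carrier P\<rbrakk> \<Longrightarrow> x \<ominus> y = \<zero> \<longleftrightarrow> x = y"
  unfolding a_minus_def by (metis M.add.inv_closed M.minus_equality M.minus_minus M.r_neg)

lemmas cinner_simps = cinner_add_left cinner_add_right cinner_smult_left cinner_smult_right
  cinner_diff_left cinner_diff_right cinner_uminus_left

lemma cinner_self: "x \<in> carrier P \<Longrightarrow> cinner P x x = complex_of_real ((hnorm P x)\<^sup>2)"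
  using cinner_nonneg[of x] by (auto simp: hnorm_def less_eq_complex_def complex_eq_iff)

lemma hnorm_sq: "x \<in> carrier P \<Longrightarrow> (hnorm P x)\<^sup>2 = Re (cinner P x x)"
  by (simp add: cinner_self)

lemma hnorm_nonneg [simp]: "x \<in> carrier P \<Longrightarrow> 0 \<le> hnorm P x"
  using cinner_nonneg[of x] by (auto simp: hnorm_def less_eq_complex_def)

lemma hnorm_zero [simp]: "hnorm P \<zero> = 0"
  by (simp add: hnorm_def)

lemma hnorm_smult: "x \<in> carrier P \<Longrightarrow> hnorm P (c \<odot> x) = cmod c * hnorm P x"
proof -
  assume x: "x \<in> carrier P"
  have "cinner P (c \<odot> x) (c \<odot> x) = (c * cnj c) * complex_of_real ((hnorm P x)\<^sup>2)"
    using cinner_self[OF x] x by (simp add: cinner_simps)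
  also have "\<dots> = complex_of_real ((cmod c)\<^sup>2 * (hnorm P x)\<^sup>2)"
    by (simp only: complex_norm_square[symmetric] of_real_mult)
  finally have "(hnorm P (c \<odot> x))\<^sup>2 = (cmod c * hnorm P x)\<^sup>2"
    using x by (simp add: hnorm_sq power_mult_distrib)
  then show ?thesis
    using x by (simp add: power2_eq_iff_nonneg)
qed

text \<open>Vector identities only matter up to seminorm 0, and those are visible to the inner product.\<close>

lemma hnorm_cong_cinner:
  assumes "x \<in> carrier P" "y \<in> carrier P" "\<And>z. z \<in> carrier P \<Longrightarrow> cinner P x z = cinner P y z"
  shows "hnorm P x = hnorm P y"
proof -
  have "cinner P x x = cinner P y y"
    using assms by (metis cinner_herm)
  then show ?thesis by (simp add: hnorm_def)
qed

text \<open>The usual discriminant argument: the squared seminorm of \<open>x - t \<langle>x, y\<rangle> y\<close> is a quadratic polynomial in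
  the real variable \<open>t\<close>. The form may be degenerate, so \<open>\<parallel>y\<parallel> = 0\<close> does not mean \<open>y = 0\<close>; in that
  case the polynomial is affine and can only stay nonnegative when its slope vanishes.\<close>

lemma cauchy_schwarz:
  assumes x: "x \<in> carrier P" and y: "y \<in> carrier P"
  shows "cmod (cinner P x y) \<le> hnorm P x * hnorm P y"
proof -
  define b where "b = cinner P x y"
  define A where "A = (hnorm P x)\<^sup>2"
  define C where "C = (hnorm P y)\<^sup>2"
  have yx: "cinner P y x = cnj b" using cinner_herm[OF x y] by (simp add: b_def)
  have xx: "cinner P x x = of_real A" and yy: "cinner P y y = of_real C"
    using x y by (simp_all add: A_def C_def cinner_self)
  have key: "0 \<le> A - 2 * t * (cmod b)\<^sup>2 + t\<^sup>2 * (cmod b)\<^sup>2 * C" for t :: real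
  proof -
    define c where "c = complex_of_real t * b"
    have "0 \<le> Re (cinner P (x \<ominus> c \<odot> y) (x \<ominus> c \<odot> y))"
      using cinner_nonneg[of "x \<ominus> c \<odot> y"] x y by (simp add: less_eq_complex_def)
    also have "cinner P (x \<ominus> c \<odot> y) (x \<ominus> c \<odot> y) =
        of_real A - cnj c * b - c * cnj b + c * cnj c * of_real C"
      using x y by (simp add: cinner_simps xx yy yx b_def[symmetric]) (simp add: algebra_simps)
    also have "\<dots> = of_real A - 2 * of_real t * (b * cnj b) + (of_real t)\<^sup>2 * (b * cnj b) * of_real C"
      unfolding c_def by (simp add: power2_eq_square)
    also have "\<dots> = complex_of_real (A - 2 * t * (cmod b)\<^sup>2 + t\<^sup>2 * (cmod b)\<^sup>2 * C)"
      unfolding complex_norm_square[symmetric] by simp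
    finally show ?thesis by simp
  qed
  have "(cmod b)\<^sup>2 \<le> A * C"
  proof (cases "C = 0")
    case True
    have "cmod b = 0"
    proof (rule ccontr)
      assume "cmod b \<noteq> 0"
      then have b: "(cmod b)\<^sup>2 > 0" by simp
      define t where "t = (A + 1) / (cmod b)\<^sup>2"
      have "t * (cmod b)\<^sup>2 = A + 1" using b by (simp add: t_def)
      moreover have "A \<ge> 0" by (simp add: A_def)
      ultimately show False using key[of t] True by simp
    qed
    then show ?thesis using True by simp
  next
    case False
    then have "C > 0" by (simp add: C_def)
    then show ?thesis using key[of "1 / C"] by (simp add: field_simps power2_eq_square)
  qed
  then have "(cmod b)\<^sup>2 \<le> (hnorm P x * hnorm P y)\<^sup>2"
    by (simp add: A_def C_def power_mult_distrib)
  then show ?thesis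
    using x y by (metis b_def hnorm_nonneg mult_nonneg_nonneg power2_le_imp_le)
qed

lemma hnorm_triangle:
  assumes x: "x \<in> carrier P" and y: "y \<in> carrier P"
  shows "hnorm P (x \<oplus> y) \<le> hnorm P x + hnorm P y"
proof (rule power2_le_imp_le)
  have "Re (cinner P x y) \<le> hnorm P x * hnorm P y"
    using cauchy_schwarz[OF x y] complex_Re_le_cmod order_trans by blast
  moreover have "Re (cinner P y x) = Re (cinner P x y)"
    using cinner_herm[OF x y] by simp
  ultimately show "(hnorm P (x \<oplus> y))\<^sup>2 \<le> (hnorm P x + hnorm P y)\<^sup>2"
    using x y by (simp add: hnorm_sq cinner_simps power2_sum)
qed (use x y in auto)

lemma hnorm_diff_commute:
  assumes x: "x \<in> carrier P" and y: "y \<in> carrier P"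
  shows "hnorm P (x \<ominus> y) = hnorm P (y \<ominus> x)"
  using x y by (simp add: hnorm_def cinner_simps algebra_simps)

lemma hnorm_diff_triangle:
  assumes x: "x \<in> carrier P" and y: "y \<in> carrier P" and z: "z \<in> carrier P"
  shows "hnorm P (x \<ominus> z) \<le> hnorm P (x \<ominus> y) + hnorm P (y \<ominus> z)"
proof -
  have "hnorm P (x \<ominus> z) = hnorm P ((x \<ominus> y) \<oplus> (y \<ominus> z))"
    using x y z by (intro hnorm_cong_cinner) (auto simp: cinner_simps)
  also have "\<dots> \<le> hnorm P (x \<ominus> y) + hnorm P (y \<ominus> z)"
    using x y z by (intro hnorm_triangle) auto
  finally show ?thesis .
qed

lemma hnorm_diff_triangle':
  assumes x: "x \<in> carrier P" and y: "y \<in> carrier P"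
  shows "\<bar>hnorm P x - hnorm P y\<bar> \<le> hnorm P (x \<ominus> y)"
proof -
  have a: "hnorm P (v \<ominus> \<zero>) = hnorm P v" if "v \<in> carrier P" for v
    using that by (intro hnorm_cong_cinner) (auto simp: cinner_simps)
  show ?thesis
    using hnorm_diff_triangle[OF x y M.zero_closed] hnorm_diff_triangle[OF y x M.zero_closed] a x y
      hnorm_diff_commute[OF x y] by auto
qed

lemma hnorm_self_diff [simp]: "x \<in> carrier P \<Longrightarrow> hnorm P (x \<ominus> x) = 0"
  by (simp add: hnorm_def cinner_simps)

lemma hnorm_diff_add_le:
  assumes "a \<in> carrier P" "b \<in> carrier P" "c \<in> carrier P" "d \<in> carrier P"
  shows "hnorm P ((a \<oplus> b) \<ominus> (c \<oplus> d)) \<le> hnorm P (a \<ominus> c) + hnorm P (b \<ominus> d)"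
proof -
  have "hnorm P ((a \<oplus> b) \<ominus> (c \<oplus> d)) = hnorm P ((a \<ominus> c) \<oplus> (b \<ominus> d))"
    using assms by (intro hnorm_cong_cinner) (auto simp: cinner_simps)
  also have "\<dots> \<le> hnorm P (a \<ominus> c) + hnorm P (b \<ominus> d)"
    using assms by (intro hnorm_triangle) auto
  finally show ?thesis .
qed

lemma hnorm_diff_smult:
  assumes "a \<in> carrier P" "b \<in> carrier P"
  shows "hnorm P ((c \<odot> a) \<ominus> (c \<odot> b)) = cmod c * hnorm P (a \<ominus> b)"
proof -
  have "hnorm P ((c \<odot> a) \<ominus> (c \<odot> b)) = hnorm P (c \<odot> (a \<ominus> b))"
    using assms by (intro hnorm_cong_cinner) (auto simp: cinner_simps algebra_simps)
  then show ?thesis using assms by (simp add: hnorm_smult)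
qed

lemma cinner_diff_le:
  assumes "a \<in> carrier P" "b \<in> carrier P" "c \<in> carrier P" "d \<in> carrier P"
  shows "cmod (cinner P a b - cinner P c d) \<le> hnorm P (a \<ominus> c) * hnorm P b + hnorm P c * hnorm P (b \<ominus> d)"
proof -
  have "cinner P a b - cinner P c d = cinner P (a \<ominus> c) b + cinner P c (b \<ominus> d)"
    using assms by (simp add: cinner_simps)
  also have "cmod \<dots> \<le> cmod (cinner P (a \<ominus> c) b) + cmod (cinner P c (b \<ominus> d))"
    by (rule norm_triangle_ineq)
  also have "\<dots> \<le> hnorm P (a \<ominus> c) * hnorm P b + hnorm P c * hnorm P (b \<ominus> d)"
    using assms by (intro add_mono cauchy_schwarz) auto
  finally show ?thesis .
qed

definition hconv :: "(nat \<Rightarrow> 'a) \<Rightarrow> 'a \<Rightarrow> bool" where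
  "hconv F x \<longleftrightarrow> range F \<subseteq> carrier P \<and> x \<in> carrier P \<and> (\<lambda>i. hnorm P (F i \<ominus> x)) \<longlonglongrightarrow> 0"

lemma hconv_carrier: "hconv F x \<Longrightarrow> F i \<in> carrier P" "hconv F x \<Longrightarrow> x \<in> carrier P"
  by (auto simp: hconv_def)

lemma hconvI: "\<lbrakk>\<And>i. F i \<in> carrier P; x \<in> carrier P; \<And>i. hnorm P (F i \<ominus> x) \<le> b i; b \<longlonglongrightarrow> 0\<rbrakk> \<Longrightarrow> hconv F x"
  unfolding hconv_def
  by (intro conjI) (auto intro: Lim_null_comparison[of _ b] always_eventually)

lemma hconv_hnorm:
  assumes "hconv F x" shows "(\<lambda>i. hnorm P (F i)) \<longlonglongrightarrow> hnorm P x"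
proof -
  have "(\<lambda>i. hnorm P (F i) - hnorm P x) \<longlonglongrightarrow> 0"
  proof (rule Lim_null_comparison[of _ "\<lambda>i. hnorm P (F i \<ominus> x)"])
    show "\<forall>\<^sub>F i in sequentially. norm (hnorm P (F i) - hnorm P x) \<le> hnorm P (F i \<ominus> x)"
      using hnorm_diff_triangle' hconv_carrier[OF assms] by simp
  qed (use assms in \<open>auto simp: hconv_def\<close>)
  then show ?thesis by (simp add: LIM_zero_iff)
qed

lemma hconv_cinner:
  assumes F: "hconv F x" and G: "hconv G y"
  shows "(\<lambda>i. cinner P (F i) (G i)) \<longlonglongrightarrow> cinner P x y"
proof -
  have "(\<lambda>i. hnorm P (F i \<ominus> x) * hnorm P (G i) + hnorm P x * hnorm P (G i \<ominus> y)) \<longlonglongrightarrow>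
          0 * hnorm P y + hnorm P x * 0"
    using F G hconv_hnorm[OF G] by (intro tendsto_intros) (auto simp: hconv_def)
  then have "(\<lambda>i. cinner P (F i) (G i) - cinner P x y) \<longlonglongrightarrow> 0"
    by (intro Lim_null_comparison[OF always_eventually[OF allI[OF
          cinner_diff_le[OF hconv_carrier(1)[OF F] hconv_carrier(1)[OF G] hconv_carrier(2)[OF F] hconv_carrier(2)[OF G]]]]])
       simp
  then show ?thesis by (simp add: LIM_zero_iff)
qed

lemma hconv_const [simp]: "x \<in> carrier P \<Longrightarrow> hconv (\<lambda>_. x) x"
  by (auto simp: hconv_def)

lemma hconv_cauchy:
  assumes F: "hconv F x" shows "F \<in> cauchy_seqs P"
  unfolding cauchy_seqs_def
proof safe
  fix e :: real assume "e > 0"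
  then obtain N where N: "\<And>i. i \<ge> N \<Longrightarrow> hnorm P (F i \<ominus> x) < e / 2"
    using F unfolding hconv_def LIMSEQ_iff by (metis abs_less_iff diff_zero half_gt_zero real_norm_def)
  have "hnorm P (F i \<ominus> F j) < e" if "i \<ge> N" "j \<ge> N" for i j
    using hnorm_diff_triangle[of "F i" x "F j"] N[OF that(1)] N[OF that(2)]
      hnorm_diff_commute[of x "F j"] hconv_carrier[OF F] by auto
  then show "\<exists>N. \<forall>i\<ge>N. \<forall>j\<ge>N. hnorm P (F i \<ominus> F j) < e" by blast
qed (use F in \<open>auto simp: hconv_def\<close>)

text \<open>Combinations always run over an initial segment of the sequence. Padding the coefficients by
  zeros brings two of them to the same length, so they form a submodule.\<close>

primrec lincomb :: "(nat \<Rightarrow> 'a) \<Rightarrow> (nat \<Rightarrow> complex) \<Rightarrow> nat \<Rightarrow> 'a" where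
  "lincomb x c 0 = \<zero>"
| "lincomb x c (Suc n) = lincomb x c n \<oplus> c n \<odot> x n"

lemma lincomb_closed [simp]: "(\<And>k. x k \<in> carrier P) \<Longrightarrow> lincomb x c n \<in> carrier P"
  by (induction n) auto

lemma cinner_lincomb_left:
  "\<lbrakk>\<And>k. x k \<in> carrier P; y \<in> carrier P\<rbrakk> \<Longrightarrow> cinner P (lincomb x c n) y = (\<Sum>k<n. c k * cinner P (x k) y)"
  by (induction n) (auto simp: cinner_simps)

lemma cinner_lincomb_right:
  "\<lbrakk>\<And>k. x k \<in> carrier P; y \<in> carrier P\<rbrakk> \<Longrightarrow> cinner P y (lincomb x c n) = (\<Sum>k<n. cnj (c k) * cinner P y (x k))"
  by (induction n) (auto simp: cinner_simps)

definition total_seq :: "(nat \<Rightarrow> 'a) \<Rightarrow> bool" where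
  "total_seq x \<longleftrightarrow> (\<forall>k. x k \<in> carrier P) \<and>
     (\<forall>h\<in>carrier P. \<forall>\<epsilon>>0. \<exists>c n. hnorm P (h \<ominus> lincomb x c n) < \<epsilon>)"

lemma total_carrier: "total_seq x \<Longrightarrow> x k \<in> carrier P"
  by (auto simp: total_seq_def)

lemma total_approx:
  assumes "total_seq x" "h \<in> carrier P"
  obtains c n where "hconv (\<lambda>i. lincomb x (c i) (n i)) h"
proof -
  have "\<forall>i. \<exists>c n. hnorm P (h \<ominus> lincomb x c n) < inverse (real (Suc i))"
    using assms unfolding total_seq_def by (metis inverse_positive_iff_positive of_nat_0_less_iff zero_less_Suc)
  then obtain c n where cn: "\<And>i. hnorm P (h \<ominus> lincomb x (c i) (n i)) < inverse (real (Suc i))" by metis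
  have "hconv (\<lambda>i. lincomb x (c i) (n i)) h"
  proof (rule hconvI)
    show "hnorm P (lincomb x (c i) (n i) \<ominus> h) \<le> inverse (real (Suc i))" for i
      using cn[of i] assms by (subst hnorm_diff_commute) (auto simp: total_seq_def)
    show "(\<lambda>i. inverse (real (Suc i))) \<longlonglongrightarrow> 0" by (rule LIMSEQ_inverse_real_of_nat)
  qed (use assms in \<open>auto simp: total_seq_def\<close>)
  then show ?thesis using that by blast
qed

lemma total_cinner_eqI:
  assumes x: "total_seq x" and h: "h \<in> carrier P" "h' \<in> carrier P"
    and eq: "\<And>k. cinner P h (x k) = cinner P h' (x k)" and z: "z \<in> carrier P"
  shows "cinner P h z = cinner P h' z"
proof -
  obtain c n where cn: "hconv (\<lambda>i. lincomb x (c i) (n i)) z"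
    using total_approx[OF x z] .
  have "cinner P h (lincomb x (c i) (n i)) = cinner P h' (lincomb x (c i) (n i))" for i
    using h x by (simp add: cinner_lincomb_right total_carrier eq)
  then show ?thesis
    using hconv_cinner[OF hconv_const[OF h(1)] cn] hconv_cinner[OF hconv_const[OF h(2)] cn]
    by (simp add: LIMSEQ_unique)
qed

end

section \<open>Inner product spaces and their metric\<close>

locale inner_space = semi_inner_space +
  assumes cinner_definite: "x \<in> carrier P \<Longrightarrow> cinner P x x = 0 \<Longrightarrow> x = \<zero>"
begin

lemma cinner_ext:
  assumes "x \<in> carrier P" "y \<in> carrier P" "\<And>z. z \<in> carrier P \<Longrightarrow> cinner P x z = cinner P y z"
  shows "x = y"
proof -
  have "x \<ominus> y = \<zero>"
    using assms by (intro cinner_definite) (simp_all add: cinner_simps)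
  then show ?thesis using assms(1,2) by (simp add: minus_eq_zero_iff)
qed

lemma hnorm_eq_0: "x \<in> carrier P \<Longrightarrow> hnorm P x = 0 \<longleftrightarrow> x = \<zero>"
  using cinner_definite[of x] cinner_self[of x] by (auto simp del: of_real_power)

lemma hconv_unique: "hconv F x \<Longrightarrow> hconv F y \<Longrightarrow> x = y"
  by (rule cinner_ext)
    (auto simp: hconv_carrier intro: LIMSEQ_unique[OF hconv_cinner[OF _ hconv_const] hconv_cinner[OF _ hconv_const]])

lemma total_ext:
  assumes "total_seq x" "h \<in> carrier P" "h' \<in> carrier P" "\<And>k. cinner P h (x k) = cinner P h' (x k)"
  shows "h = h'"
  using assms(2,3) total_cinner_eqI[OF assms] by (rule cinner_ext)

abbreviation "hdist \<equiv> (\<lambda>x y. if x \<in> carrier P \<and> y \<in> carrier P then hnorm P (x \<ominus> y) else 0)"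

lemma hmetric_space: "Metric_space (carrier P) hdist"
proof
  show "0 \<le> hdist x y" for x y by simp
  show "hdist x y = hdist y x" for x y by (simp add: hnorm_diff_commute)
  show "hdist x y = 0 \<longleftrightarrow> x = y" if "x \<in> carrier P" "y \<in> carrier P" for x y
    using that by (simp add: hnorm_eq_0 minus_eq_zero_iff)
  show "hdist x z \<le> hdist x y + hdist y z" if "x \<in> carrier P" "y \<in> carrier P" "z \<in> carrier P" for x y z
    using that by (simp add: hnorm_diff_triangle)
qed

lemma hilbert_iff_complete:
  "mcomplete_of (hmetric P) \<longleftrightarrow> (\<forall>F\<in>cauchy_seqs P. \<exists>x. hconv F x)"
proof -
  interpret MS: Metric_space "carrier P" hdist by (rule hmetric_space)
  have 1: "MS.MCauchy F \<longleftrightarrow> F \<in> cauchy_seqs P" for F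
  proof (cases "range F \<subseteq> carrier P")
    case True
    then have "F i \<in> carrier P" for i by blast
    then show ?thesis using True unfolding MS.MCauchy_def cauchy_seqs_def mem_Collect_eq by simp
  qed (simp add: MS.MCauchy_def cauchy_seqs_def)
  have 2: "limitin MS.mtopology F x sequentially \<longleftrightarrow> hconv F x" if "F \<in> cauchy_seqs P" for F x
  proof (cases "x \<in> carrier P")
    case True
    have c: "range F \<subseteq> carrier P" "\<And>i. F i \<in> carrier P"
      using that by (auto simp: cauchy_seqs_def)
    show ?thesis
      unfolding MS.limit_metric_sequentially hconv_def LIMSEQ_iff
      using c True by simp
  qed (simp add: MS.limit_metric_sequentially hconv_def)
  show ?thesis
    unfolding hmetric_def MS.mcomplete_of MS.mcomplete_def using 1 2 by auto
qed

lemma closure_iff: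
  assumes "S \<subseteq> carrier P"
  shows "h \<in> mtopology_of (hmetric P) closure_of S \<longleftrightarrow>
     h \<in> carrier P \<and> (\<forall>\<epsilon>>0. \<exists>y\<in>S. hnorm P (h \<ominus> y) < \<epsilon>)"
proof -
  interpret MS: Metric_space "carrier P" hdist by (rule hmetric_space)
  show ?thesis unfolding hmetric_def MS.mtopology_of MS.metric_closure_of
    using assms by (auto simp: MS.in_mball subset_iff)
qed

lemma lincomb_span:
  assumes x: "\<And>k. x k \<in> carrier P"
  shows "(\<Inter>{W. submodule W complex_ring P \<and> range x \<subseteq> W}) = {lincomb x c n |c n. True}"
proof -
  let ?L = "{lincomb x c n |c n. True}"
  \<comment> \<open>Longer segments give nothing new and cost nothing.\<close>
  have pad: "lincomb x (\<lambda>k. if k < n then c k else 0) (n + d) = lincomb x c n" for c n d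
  proof -
    have "lincomb x (\<lambda>k. if k < n then c k else 0) j = lincomb x c j" if "j \<le> n" for j
      using that by (induction j) auto
    moreover have "lincomb x (\<lambda>k. if k < n then c k else 0) (n + d) = lincomb x (\<lambda>k. if k < n then c k else 0) n"
    proof (induction d)
      case (Suc d)
      have "(0::complex) \<odot> x (n + d) = \<zero>" using smult_l_null[of "x (n+d)"] x by simp
      then show ?case using Suc x by simp
    qed simp
    ultimately show ?thesis by simp
  qed
  have add: "lincomb x c n \<oplus> lincomb x c' n = lincomb x (\<lambda>k. c k + c' k) n" for c c' n
    by (rule cinner_ext) (use x in \<open>auto simp: cinner_simps cinner_lincomb_left sum.distrib algebra_simps\<close>)
  have sm: "a \<odot> lincomb x c n = lincomb x (\<lambda>k. a * c k) n" for a c n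
    by (rule cinner_ext) (use x in \<open>auto simp: cinner_simps cinner_lincomb_left sum_distrib_left algebra_simps\<close>)
  have neg: "\<ominus> lincomb x c n = lincomb x (\<lambda>k. - c k) n" for c n
    by (rule cinner_ext) (use x in \<open>auto simp: cinner_simps cinner_lincomb_left sum_negf\<close>)
  have "submodule ?L complex_ring P"
  proof (rule submoduleI)
    show "?L \<subseteq> carrier P" using x by auto
    have "\<zero> = lincomb x (\<lambda>_. 0) 0" by simp
    then show "\<zero> \<in> ?L" by blast
    show "\<And>a. a \<in> ?L \<Longrightarrow> \<ominus> a \<in> ?L" using neg by blast
    show "\<And>a v. v \<in> ?L \<Longrightarrow> a \<odot> v \<in> ?L" using sm by blast
    fix a b assume "a \<in> ?L" "b \<in> ?L"
    then obtain c n c' n' where ab: "a = lincomb x c n" "b = lincomb x c' n'" by auto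
    have "a \<oplus> b = lincomb x (\<lambda>k. (if k < n then c k else 0) + (if k < n' then c' k else 0)) (n + n')"
      unfolding add[symmetric] pad pad[of n' c' n, unfolded add.commute[of n' n]] ab ..
    then show "a \<oplus> b \<in> ?L" by blast
  qed
  moreover have "range x \<subseteq> ?L"
  proof safe
    fix k
    have "x k = lincomb x (\<lambda>j. if j = k then 1 else 0) (Suc k)"
      by (rule cinner_ext) (use x in \<open>auto simp: cinner_lincomb_left cinner_simps if_distrib[where f="\<lambda>a. a * _"]\<close>)
    then show "\<exists>c n. x k = lincomb x c n \<and> True" by blast
  qed
  moreover have "lincomb x c n \<in> W" if W: "submodule W complex_ring P" "range x \<subseteq> W" for W c n
  proof -
    have "x k \<in> W" for k using W by auto
    then show ?thesis
    proof (induction n)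
      case 0
      show ?case using subgroup.one_closed[OF submodule.axioms(1)[OF W(1)]] by simp
    next
      case (Suc n)
      then show ?case
        using submoduleE(4)[OF W(1), of "c n" "x n"] submoduleE(5)[OF W(1)] \<open>x n \<in> W\<close> by simp
    qed
  qed
  ultimately show ?thesis by blast
qed

lemma cyclic_vector_iff:
  assumes T: "\<And>x. x \<in> carrier P \<Longrightarrow> T x \<in> carrier P"
  shows "cyclic_vector P T e \<longleftrightarrow> e \<in> carrier P \<and> total_seq (\<lambda>k. (T ^^ k) e)"
proof (cases "e \<in> carrier P")
  case True
  have c: "(T ^^ k) e \<in> carrier P" for k
    using True T by (induction k) auto
  have "closed_span P (range (\<lambda>k. (T ^^ k) e)) =
      mtopology_of (hmetric P) closure_of {lincomb (\<lambda>k. (T ^^ k) e) c n |c n. True}"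
    unfolding closed_span_def using lincomb_span[of "\<lambda>k. (T ^^ k) e"] c by simp
  moreover have "{lincomb (\<lambda>k. (T ^^ k) e) c n |c n. True} \<subseteq> carrier P"
    using c by auto
  ultimately have iff: "h \<in> closed_span P (range (\<lambda>k. (T ^^ k) e)) \<longleftrightarrow>
     h \<in> carrier P \<and> (\<forall>\<epsilon>>0. \<exists>c n. hnorm P (h \<ominus> lincomb (\<lambda>k. (T ^^ k) e) c n) < \<epsilon>)" for h
    using closure_iff[of "{lincomb (\<lambda>k. (T ^^ k) e) c n |c n. True}" h] by simp blast
  have "closed_span P (range (\<lambda>k. (T ^^ k) e)) = carrier P \<longleftrightarrow>
     (\<forall>h\<in>carrier P. \<forall>\<epsilon>>0. \<exists>c n. hnorm P (h \<ominus> lincomb (\<lambda>k. (T ^^ k) e) c n) < \<epsilon>)"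
    unfolding set_eq_iff iff by auto
  then show ?thesis
    unfolding cyclic_vector_def total_seq_def using c True by simp
next
  case False
  then show ?thesis by (auto simp: cyclic_vector_def)
qed

end

lemma complex_inner_space_iff: "complex_inner_space H \<longleftrightarrow> inner_space H"
  unfolding complex_inner_space_def inner_space_def semi_inner_space_def
    inner_space_axioms_def semi_inner_space_axioms_def by blast

section \<open>Hilbert spaces: Riesz representation and adjoints\<close>

locale hilbert = inner_space +
  assumes complete: "F \<in> cauchy_seqs P \<Longrightarrow> \<exists>x. hconv F x"

lemma hilbert_space_iff: "hilbert_space H \<longleftrightarrow> hilbert H"
proof (cases "inner_space H")
  case True
  then interpret inner_space H .
  show ?thesis
    unfolding hilbert_space_def complex_inner_space_iff hilbert_iff_complete hilbert_def hilbert_axioms_def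
    by blast
next
  case False
  then show ?thesis
    unfolding hilbert_space_def complex_inner_space_iff hilbert_def by blast
qed

context hilbert
begin

text \<open>The representing vector is the minimiser of \<open>J x = \<parallel>x\<parallel>\<^sup>2 - 2 Re (\<phi> x)\<close>. The parallelogram law turns
  closeness of two values of \<open>J\<close> to the infimum into closeness of the vectors, so a minimising
  sequence converges, and stationarity of \<open>J\<close> at the limit is the representation.\<close>

lemma riesz:
  fixes \<phi> :: "'a \<Rightarrow> complex"
  assumes add: "\<And>x y. x \<in> carrier P \<Longrightarrow> y \<in> carrier P \<Longrightarrow> \<phi> (x \<oplus> y) = \<phi> x + \<phi> y"
    and smult: "\<And>c x. x \<in> carrier P \<Longrightarrow> \<phi> (c \<odot> x) = c * \<phi> x"
    and bound: "\<And>x. x \<in> carrier P \<Longrightarrow> cmod (\<phi> x) \<le> B * hnorm P x"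
  obtains y where "y \<in> carrier P" "\<And>x. x \<in> carrier P \<Longrightarrow> \<phi> x = cinner P x y"
proof -
  define J where "J x = (hnorm P x)\<^sup>2 - 2 * Re (\<phi> x)" for x
  define d where "d = Inf (J ` carrier P)"
  have bdd: "- (B\<^sup>2) \<le> J x" if "x \<in> carrier P" for x
  proof -
    have "Re (\<phi> x) \<le> B * hnorm P x"
      using bound[OF that] complex_Re_le_cmod order_trans by blast
    moreover have "0 \<le> (hnorm P x - B)\<^sup>2" by simp
    ultimately show ?thesis by (simp add: J_def power2_diff algebra_simps)
  qed
  have dle: "d \<le> J x" if "x \<in> carrier P" for x
    unfolding d_def using that bdd by (intro cInf_lower bdd_belowI2) auto
  have "\<exists>x\<in>carrier P. J x < d + inverse (real (Suc i))" for i
  proof -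
    have "J ` carrier P \<noteq> {}" using M.zero_closed by blast
    then show ?thesis
      using cInf_lessD[of "J ` carrier P" "d + inverse (real (Suc i))"] by (auto simp: d_def)
  qed
  then obtain F where F: "\<And>i. F i \<in> carrier P" "\<And>i. J (F i) < d + inverse (real (Suc i))" by metis
  have par: "(hnorm P (x \<ominus> y))\<^sup>2 \<le> 2 * (J x + J y - 2 * d)" if "x \<in> carrier P" "y \<in> carrier P" for x y
  proof -
    define z where "z = (1/2) \<odot> (x \<oplus> y)"
    have z: "z \<in> carrier P" using that by (auto simp: z_def)
    have "Re (\<phi> z) = (Re (\<phi> x) + Re (\<phi> y)) / 2" using that by (simp add: z_def smult add)
    moreover have "(hnorm P z)\<^sup>2 = ((hnorm P x)\<^sup>2 + (hnorm P y)\<^sup>2) / 2 - (hnorm P (x \<ominus> y))\<^sup>2 / 4"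
      using that z by (simp add: hnorm_sq z_def cinner_simps) argo
    ultimately have "(hnorm P (x \<ominus> y))\<^sup>2 = 2 * (J x + J y - 2 * J z)"
      unfolding J_def by simp
    then show ?thesis using dle[OF z] by simp
  qed
  have "F \<in> cauchy_seqs P"
    unfolding cauchy_seqs_def mem_Collect_eq
  proof (intro conjI allI impI)
    fix e :: real assume e: "e > 0"
    obtain N where N: "inverse (real (Suc N)) < e\<^sup>2 / 4"
      using reals_Archimedean[of "e\<^sup>2 / 4"] e by auto
    have "hnorm P (F i \<ominus> F j) < e" if "i \<ge> N" "j \<ge> N" for i j
    proof -
      have "J (F k) < d + e\<^sup>2 / 4" if "k \<ge> N" for k
      proof -
        have "inverse (real (Suc k)) \<le> inverse (real (Suc N))"
          using that by (intro le_imp_inverse_le) auto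
        then show ?thesis using F(2)[of k] N by linarith
      qed
      from this[OF that(1)] this[OF that(2)] have "J (F i) + J (F j) - 2 * d < e\<^sup>2 / 2" by simp
      with par[OF F(1)[of i] F(1)[of j]] have "(hnorm P (F i \<ominus> F j))\<^sup>2 < e\<^sup>2" by argo
      then show ?thesis using e by (simp add: power_less_imp_less_base)
    qed
    then show "\<exists>N. \<forall>i\<ge>N. \<forall>j\<ge>N. hnorm P (F i \<ominus> F j) < e" by blast
  qed (use F in auto)
  then obtain y where y: "hconv F y" using complete by blast
  have yc: "y \<in> carrier P" using y by (rule hconv_carrier)
  have Jlim: "(\<lambda>i. J (F i)) \<longlonglongrightarrow> d"
  proof (rule tendsto_sandwich[of "\<lambda>_. d"])
    show "(\<lambda>i. d + inverse (real (Suc i))) \<longlonglongrightarrow> d"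
      using tendsto_add[OF tendsto_const LIMSEQ_inverse_real_of_nat] by simp
    show "\<forall>\<^sub>F i in sequentially. J (F i) \<le> d + inverse (real (Suc i))"
      using F(2) by (simp add: less_imp_le)
  qed (use dle F in auto)
  have var: "0 \<le> 2 * Re (cinner P h y) + (hnorm P h)\<^sup>2 - 2 * Re (\<phi> h)" if h: "h \<in> carrier P" for h
  proof -
    have "d \<le> J (F i) + (2 * Re (cinner P h (F i)) + (hnorm P h)\<^sup>2 - 2 * Re (\<phi> h))" for i
    proof -
      have "(hnorm P (F i \<oplus> h))\<^sup>2 = (hnorm P (F i))\<^sup>2 + 2 * Re (cinner P h (F i)) + (hnorm P h)\<^sup>2"
        using h F(1)[of i] cinner_herm[OF h F(1)[of i]] by (simp add: hnorm_sq cinner_simps)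
      then have "J (F i \<oplus> h) = J (F i) + (2 * Re (cinner P h (F i)) + (hnorm P h)\<^sup>2 - 2 * Re (\<phi> h))"
        using h F(1)[of i] by (simp add: J_def add)
      then show ?thesis using dle[of "F i \<oplus> h"] h F(1)[of i] by simp
    qed
    moreover have "(\<lambda>i. J (F i) + (2 * Re (cinner P h (F i)) + (hnorm P h)\<^sup>2 - 2 * Re (\<phi> h)))
        \<longlonglongrightarrow> d + (2 * Re (cinner P h y) + (hnorm P h)\<^sup>2 - 2 * Re (\<phi> h))"
      by (intro tendsto_intros Jlim hconv_cinner hconv_const h y)
    ultimately have "d \<le> d + (2 * Re (cinner P h y) + (hnorm P h)\<^sup>2 - 2 * Re (\<phi> h))"
      by (intro LIMSEQ_le_const) auto
    then show ?thesis by simp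
  qed
  have "\<phi> h = cinner P h y" if h: "h \<in> carrier P" for h
  proof -
    define w where "w = cinner P h y - \<phi> h"
    define n where "n = (hnorm P h)\<^sup>2"
    define s where "s = 1 / (n + 1)"
    have n: "n \<ge> 0" and s: "s > 0" "s * n < 1" by (auto simp: n_def s_def add_nonneg_pos)
    \<comment> \<open>The direction in which the first order term decreases, with a step so short that the quadratic term cannot compensate.\<close>
    define c where "c = - of_real s * cnj w"
    have "0 \<le> 2 * Re (c * w) + (cmod c)\<^sup>2 * n"
      using var[of "c \<odot> h"] h yc
      by (simp add: cinner_simps smult w_def n_def hnorm_smult power_mult_distrib algebra_simps)
    also have "c * w = - of_real s * of_real ((cmod w)\<^sup>2)"
      unfolding complex_norm_square by (simp add: c_def)
    also have "(cmod c)\<^sup>2 = s\<^sup>2 * (cmod w)\<^sup>2" using s by (simp add: c_def norm_mult power_mult_distrib)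
    finally have "2 * s * (cmod w)\<^sup>2 \<le> s * (s * n) * (cmod w)\<^sup>2" by (simp add: power2_eq_square mult_ac)
    moreover have "s * (s * n) * (cmod w)\<^sup>2 \<le> s * 1 * (cmod w)\<^sup>2"
      using s by (intro mult_right_mono mult_left_mono) auto
    ultimately have "s * (cmod w)\<^sup>2 \<le> 0" by simp
    then have "w = 0" using s by (simp add: mult_le_0_iff)
    then show ?thesis by (simp add: w_def)
  qed
  then show ?thesis using that yc by blast
qed

end

lemma linear_opD:
  assumes "linear_op H K T"
  shows "x \<in> carrier H \<Longrightarrow> T x \<in> carrier K"
    "\<lbrakk>x \<in> carrier H; y \<in> carrier H\<rbrakk> \<Longrightarrow> T (x \<oplus>\<^bsub>H\<^esub> y) = T x \<oplus>\<^bsub>K\<^esub> T y"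
    "x \<in> carrier H \<Longrightarrow> T (c \<odot>\<^bsub>H\<^esub> x) = c \<odot>\<^bsub>K\<^esub> T x"
  using assms by (auto simp: linear_op_def)

lemma bounded_op_linear: "bounded_op H K T \<Longrightarrow> linear_op H K T"
  by (simp add: bounded_op_def)

lemma bounded_op_bound:
  assumes "bounded_op H K T" "semi_inner_space H"
  obtains B where "B > 0" "\<And>x. x \<in> carrier H \<Longrightarrow> hnorm K (T x) \<le> B * hnorm H x"
proof -
  interpret semi_inner_space H by fact
  obtain B where B: "\<And>x. x \<in> carrier H \<Longrightarrow> hnorm K (T x) \<le> B * hnorm H x"
    using assms by (auto simp: bounded_op_def)
  have "hnorm K (T x) \<le> max B 1 * hnorm H x" if "x \<in> carrier H" for x
    using B[OF that] mult_right_mono[of B "max B 1" "hnorm H x"] that by auto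
  then show ?thesis using that[of "max B 1"] by auto
qed

lemma funpow_carrier: "(\<And>x. x \<in> C \<Longrightarrow> T x \<in> C) \<Longrightarrow> x \<in> C \<Longrightarrow> (T ^^ j) x \<in> C"
  by (induction j) auto

lemma linear_op_diff:
  assumes "linear_op H K T" "semi_inner_space H" "semi_inner_space K" "x \<in> carrier H" "y \<in> carrier H"
  shows "T (x \<ominus>\<^bsub>H\<^esub> y) = T x \<ominus>\<^bsub>K\<^esub> T y"
proof -
  interpret H: semi_inner_space H by fact
  interpret K: semi_inner_space K by fact
  note T = linear_opD[OF assms(1)]
  have "T (\<ominus>\<^bsub>H\<^esub> y) = \<ominus>\<^bsub>K\<^esub> T y"
  proof -
    have H1: "(\<ominus>\<^bsub>complex_ring\<^esub> 1) \<odot>\<^bsub>H\<^esub> y = \<ominus>\<^bsub>H\<^esub> y"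
      using H.smult_l_minus[of 1 y] H.smult_one[of y] assms(5) by simp
    have K1: "(\<ominus>\<^bsub>complex_ring\<^esub> 1) \<odot>\<^bsub>K\<^esub> T y = \<ominus>\<^bsub>K\<^esub> T y"
      using K.smult_l_minus[of 1 "T y"] K.smult_one[of "T y"] T(1)[OF assms(5)] by simp
    show ?thesis using T(3)[OF assms(5), of "\<ominus>\<^bsub>complex_ring\<^esub> 1"] unfolding H1 K1 .
  qed
  then show ?thesis
    using assms(4,5) T(2) by (simp add: a_minus_def)
qed

lemma hconv_image:
  assumes "bounded_op H K T" "semi_inner_space H" "semi_inner_space K" "semi_inner_space.hconv H F x"
  shows "semi_inner_space.hconv K (\<lambda>i. T (F i)) (T x)"
proof -
  interpret H: semi_inner_space H by fact
  interpret K: semi_inner_space K by fact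
  note lin = bounded_op_linear[OF assms(1)]
  note T = linear_opD[OF lin]
  obtain B where B: "B > 0" "\<And>x. x \<in> carrier H \<Longrightarrow> hnorm K (T x) \<le> B * hnorm H x"
    using bounded_op_bound[OF assms(1,2)] by blast
  note c = H.hconv_carrier[OF assms(4)]
  show ?thesis
  proof (rule K.hconvI)
    show "hnorm K (T (F i) \<ominus>\<^bsub>K\<^esub> T x) \<le> B * hnorm H (F i \<ominus>\<^bsub>H\<^esub> x)" for i
      using B(2)[of "F i \<ominus>\<^bsub>H\<^esub> x"] c by (simp add: linear_op_diff[OF lin assms(2,3)])
    show "(\<lambda>i. B * hnorm H (F i \<ominus>\<^bsub>H\<^esub> x)) \<longlonglongrightarrow> 0"
      using assms(4) by (auto simp: H.hconv_def intro!: tendsto_mult_right_zero)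
  qed (use c T in auto)
qed

lemma linear_op_lincomb:
  assumes "linear_op H K T" "semi_inner_space H" "semi_inner_space K" "\<And>k. x k \<in> carrier H"
  shows "T (semi_inner_space.lincomb H x c n) = semi_inner_space.lincomb K (\<lambda>k. T (x k)) c n"
proof -
  interpret H: semi_inner_space H by fact
  interpret K: semi_inner_space K by fact
  note T = linear_opD[OF assms(1)]
  have z: "T \<zero>\<^bsub>H\<^esub> = \<zero>\<^bsub>K\<^esub>"
    using T(3)[of "\<zero>\<^bsub>H\<^esub>" 0] T(1)[of "\<zero>\<^bsub>H\<^esub>"] K.smult_l_null[of "T \<zero>\<^bsub>H\<^esub>"] H.smult_l_null[of "\<zero>\<^bsub>H\<^esub>"] by simp
  show ?thesis
    by (induction n) (use assms(4) in \<open>auto simp: z T\<close>)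
qed

lemma bounded_op_eq_on_total:
  assumes "bounded_op H K S" "bounded_op H K T" "semi_inner_space H" "inner_space K"
    and "semi_inner_space.total_seq H x" "\<And>k. S (x k) = T (x k)" "h \<in> carrier H"
  shows "S h = T h"
proof -
  interpret H: semi_inner_space H by fact
  interpret K: inner_space K by fact
  note K' = K.semi_inner_space_axioms
  obtain c n where cn: "H.hconv (\<lambda>i. H.lincomb x (c i) (n i)) h"
    using H.total_approx[OF assms(5,7)] .
  have "S (H.lincomb x (c i) (n i)) = T (H.lincomb x (c i) (n i))" for i
    using linear_op_lincomb[OF bounded_op_linear[OF assms(1)] assms(3) K']
      linear_op_lincomb[OF bounded_op_linear[OF assms(2)] assms(3) K'] H.total_carrier[OF assms(5)] assms(6)
    by simp
  then show ?thesis
    using hconv_image[OF assms(1,3) K' cn] hconv_image[OF assms(2,3) K' cn] K.hconv_unique by simp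
qed

lemma adj_exists_unique:
  assumes "bounded_op H K T" "hilbert H" "inner_space K" "y \<in> carrier K"
  shows "\<exists>!x. x \<in> carrier H \<and> (\<forall>h\<in>carrier H. cinner K (T h) y = cinner H h x)"
proof -
  interpret H: hilbert H by fact
  interpret K: inner_space K by fact
  note T = linear_opD[OF bounded_op_linear[OF assms(1)]]
  obtain B where B: "B > 0" "\<And>x. x \<in> carrier H \<Longrightarrow> hnorm K (T x) \<le> B * hnorm H x"
    using bounded_op_bound[OF assms(1) H.semi_inner_space_axioms] by blast
  obtain x where x: "x \<in> carrier H" "\<And>h. h \<in> carrier H \<Longrightarrow> cinner K (T h) y = cinner H h x"
  proof (rule H.riesz[of "\<lambda>h. cinner K (T h) y" "B * hnorm K y"])
    fix h assume h: "h \<in> carrier H"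
    have "cmod (cinner K (T h) y) \<le> hnorm K (T h) * hnorm K y"
      using h assms(4) T(1) by (intro K.cauchy_schwarz) auto
    also have "\<dots> \<le> (B * hnorm H h) * hnorm K y"
      using B(2)[OF h] assms(4) by (intro mult_right_mono) auto
    finally show "cmod (cinner K (T h) y) \<le> B * hnorm K y * hnorm H h" by (simp add: mult_ac)
  qed (use assms(4) T in \<open>auto simp: K.cinner_simps\<close>)
  have "x' = x" if x': "x' \<in> carrier H" "\<forall>h\<in>carrier H. cinner K (T h) y = cinner H h x'" for x'
  proof (rule H.cinner_ext)
    fix z assume z: "z \<in> carrier H"
    then have "cinner H z x' = cinner H z x" using x x' by simp
    then show "cinner H x' z = cinner H x z"
      using H.cinner_herm[OF z x(1)] H.cinner_herm[OF z x'(1)] by simp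
  qed (use x x' in auto)
  then show ?thesis using x by blast
qed

lemma adj_props:
  assumes "bounded_op H K T" "hilbert H" "inner_space K" "y \<in> carrier K"
  shows "adj H K T y \<in> carrier H" "h \<in> carrier H \<Longrightarrow> cinner H h (adj H K T y) = cinner K (T h) y"
  using theI'[OF adj_exists_unique[OF assms]] unfolding adj_def by auto

lemma adj_pow:
  assumes "bounded_op H H T" "hilbert H" "y \<in> carrier H"
  shows "(adj H H T ^^ j) y \<in> carrier H \<and> (\<forall>h\<in>carrier H. cinner H h ((adj H H T ^^ j) y) = cinner H ((T ^^ j) h) y)"
proof (induction j)
  case (Suc j)
  interpret H: hilbert H by fact
  note T = linear_opD[OF bounded_op_linear[OF assms(1)]]
  note A = adj_props[OF assms(1,2) H.inner_space_axioms]
  have "cinner H h ((adj H H T ^^ Suc j) y) = cinner H ((T ^^ Suc j) h) y" if "h \<in> carrier H" for h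
  proof -
    have "(T ^^ Suc j) h = (T ^^ j) (T h)" by (simp add: funpow_swap1)
    then show ?thesis using Suc that T(1)[OF that] A by simp
  qed
  then show ?case using Suc A by simp
qed (use assms in simp)

lemma cinner_finsum_left:
  assumes "semi_inner_space H" "finite A" "\<And>j. j \<in> A \<Longrightarrow> f j \<in> carrier H" "y \<in> carrier H"
  shows "cinner H (finsum H f A) y = (\<Sum>j\<in>A. cinner H (f j) y)"
proof -
  interpret H: semi_inner_space H by fact
  show ?thesis
    using assms(2,3)
  proof (induction A rule: finite_induct)
    case (insert a A)
    then have "finsum H f (insert a A) = f a \<oplus>\<^bsub>H\<^esub> finsum H f A"
      by (intro H.M.finsum_insert) auto
    then show ?case using insert assms(4) by (simp add: H.cinner_simps H.M.finsum_closed)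
  qed (use assms(4) in simp)
qed

lemma beta_closed:
  assumes "bounded_op H H T" "hilbert H" "x \<in> carrier H"
  shows "beta H T n x \<in> carrier H"
proof -
  interpret H: hilbert H by fact
  note T = linear_opD[OF bounded_op_linear[OF assms(1)]]
  show ?thesis
    unfolding beta_def using funpow_carrier[of "carrier H" T x] T(1) assms(3) adj_pow[OF assms(1,2)]
    by (intro H.M.finsum_closed) auto
qed

text \<open>All statements about \<open>\<beta>\<^sub>n\<close> go through this formula, in which no adjoint occurs: being an
  \<open>m\<close>-isometry is a condition on the inner products \<open>\<langle>T\<^sup>j x, T\<^sup>j y\<rangle>\<close> alone.\<close>

lemma cinner_beta:
  assumes "bounded_op H H T" "hilbert H" "x \<in> carrier H" "y \<in> carrier H"
  shows "cinner H (beta H T n x) y =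
    (\<Sum>j\<le>n. (-1) ^ (n - j) * of_nat (n choose j) * cinner H ((T ^^ j) x) ((T ^^ j) y))"
proof -
  interpret H: hilbert H by fact
  note T = linear_opD[OF bounded_op_linear[OF assms(1)]]
  have Tx: "(T ^^ j) z \<in> carrier H" if "z \<in> carrier H" for j z
    using funpow_carrier[of "carrier H" T z] T(1) that by auto
  note A = adj_pow[OF assms(1,2)]
  have a: "cinner H ((adj H H T ^^ j) ((T ^^ j) x)) y = cinner H ((T ^^ j) x) ((T ^^ j) y)" for j
    using A[OF Tx[OF assms(3), of j], of j] Tx assms(3,4) H.cinner_herm by metis
  show ?thesis
    unfolding beta_def
    by (subst cinner_finsum_left[OF H.semi_inner_space_axioms])
       (use A Tx assms in \<open>auto simp: H.cinner_simps a\<close>)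
qed

lemma m_isometry_iff:
  "m_isometry H m T \<longleftrightarrow> hilbert H \<and> bounded_op H H T \<and>
    (\<forall>x\<in>carrier H. \<forall>y\<in>carrier H.
      (\<Sum>j\<le>m. (-1) ^ (m - j) * of_nat (m choose j) * cinner H ((T ^^ j) x) ((T ^^ j) y)) = 0)"
proof (cases "hilbert H \<and> bounded_op H H T")
  case True
  then interpret H: hilbert H by blast
  have "beta H T m x = \<zero>\<^bsub>H\<^esub> \<longleftrightarrow> (\<forall>y\<in>carrier H. cinner H (beta H T m x) y = 0)" if "x \<in> carrier H" for x
    using beta_closed[of H T x m] H.cinner_definite that True by auto
  then show ?thesis using True cinner_beta[of H T _ _ m] by (simp add: m_isometry_def hilbert_space_iff)
next
  case False
  then show ?thesis by (auto simp: m_isometry_def hilbert_space_iff)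
qed

section \<open>Unitary maps from equal Gram matrices\<close>

text \<open>Combinations with the same coefficients have the same distances in both spaces, so an approximating
  sequence of \<open>h\<close> is turned into a Cauchy sequence of \<open>K\<close>.\<close>

lemma gram_transfer:
  assumes "hilbert H" "hilbert K"
    and x: "semi_inner_space.total_seq H x" and y: "\<And>k. y k \<in> carrier K"
    and gram: "\<And>k l. cinner H (x k) (x l) = cinner K (y k) (y l)"
    and h: "h \<in> carrier H"
  obtains k c n where "semi_inner_space.hconv K (\<lambda>i. semi_inner_space.lincomb K y (c i) (n i)) k"
    "semi_inner_space.hconv H (\<lambda>i. semi_inner_space.lincomb H x (c i) (n i)) h"
proof -
  interpret H: hilbert H by fact
  interpret K: hilbert K by fact
  obtain c n where cn: "H.hconv (\<lambda>i. H.lincomb x (c i) (n i)) h"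
    using H.total_approx[OF x h] .
  have lc: "cinner H (H.lincomb x c n) (H.lincomb x c' n') = cinner K (K.lincomb y c n) (K.lincomb y c' n')" for c n c' n'
    using H.total_carrier[OF x] y
    by (simp add: H.cinner_lincomb_left H.cinner_lincomb_right K.cinner_lincomb_left K.cinner_lincomb_right gram)
  have "hnorm H (H.lincomb x c n \<ominus>\<^bsub>H\<^esub> H.lincomb x c' n') = hnorm K (K.lincomb y c n \<ominus>\<^bsub>K\<^esub> K.lincomb y c' n')" for c n c' n'
    unfolding hnorm_def using H.total_carrier[OF x] y by (simp add: H.cinner_simps K.cinner_simps lc)
  then have "(\<lambda>i. K.lincomb y (c i) (n i)) \<in> cauchy_seqs K"
    using H.hconv_cauchy[OF cn] y unfolding cauchy_seqs_def by auto
  then show ?thesis using K.complete that cn by blast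
qed

text \<open>The image of \<open>h\<close> is the vector whose inner products with the \<open>y\<^sub>j\<close> are those of \<open>h\<close> with the
  \<open>x\<^sub>j\<close>. Totality makes this relation one-to-one, and then linearity and bijectivity are instances of
  its uniqueness; no choice of approximating sequences has to be shown to be irrelevant.\<close>

lemma unitary_from_gram:
  assumes "hilbert H" "hilbert K"
    and x: "semi_inner_space.total_seq H x" and y: "semi_inner_space.total_seq K y"
    and gram: "\<And>k l. cinner H (x k) (x l) = cinner K (y k) (y l)"
  obtains U where "unitary_map H K U" "\<And>k. U (x k) = y k"
proof -
  interpret H: hilbert H by fact
  interpret K: hilbert K by fact
  note xc = H.total_carrier[OF x] and yc = K.total_carrier[OF y]
  define R where "R h k \<longleftrightarrow> h \<in> carrier H \<and> k \<in> carrier K \<and> (\<forall>j. cinner K k (y j) = cinner H h (x j))" for h k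
  have limR: "R h k" if "K.hconv (\<lambda>i. K.lincomb y (c i) (n i)) k" "H.hconv (\<lambda>i. H.lincomb x (c i) (n i)) h" for c n h k
  proof -
    have "cinner K (K.lincomb y (c i) (n i)) (y j) = cinner H (H.lincomb x (c i) (n i)) (x j)" for i j
      using xc yc by (simp add: H.cinner_lincomb_left K.cinner_lincomb_left gram)
    then have "cinner K k (y j) = cinner H h (x j)" for j
      using K.hconv_cinner[OF that(1) K.hconv_const[OF yc[of j]]] H.hconv_cinner[OF that(2) H.hconv_const[OF xc[of j]]]
      by (simp add: LIMSEQ_unique)
    then show ?thesis using H.hconv_carrier(2)[OF that(2)] K.hconv_carrier(2)[OF that(1)] by (simp add: R_def)
  qed
  have ex1: "\<exists>k. R h k" if h: "h \<in> carrier H" for h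
  proof -
    obtain k c n where "K.hconv (\<lambda>i. K.lincomb y (c i) (n i)) k" "H.hconv (\<lambda>i. H.lincomb x (c i) (n i)) h"
      by (rule gram_transfer[OF assms(1,2) x yc gram h])
    then show ?thesis using limR by blast
  qed
  have ex2: "\<exists>h. R h k" if k: "k \<in> carrier K" for k
  proof -
    obtain h c n where "H.hconv (\<lambda>i. H.lincomb x (c i) (n i)) h" "K.hconv (\<lambda>i. K.lincomb y (c i) (n i)) k"
      by (rule gram_transfer[OF assms(2,1) y xc gram[symmetric] k])
    then show ?thesis using limR by blast
  qed
  have uniqK: "k = k'" if "R h k" "R h k'" for h k k'
    using that by (intro K.total_ext[OF y]) (auto simp: R_def)
  have uniqH: "h = h'" if "R h k" "R h' k" for h h' k
    using that by (intro H.total_ext[OF x]) (auto simp: R_def)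
  define U where "U h = (THE k. R h k)" for h
  have RU: "R h (U h)" if h: "h \<in> carrier H" for h
  proof -
    obtain k where k: "R h k" using ex1[OF h] by blast
    show ?thesis unfolding U_def by (rule theI[of "R h" k, OF k]) (rule uniqK[OF _ k])
  qed
  have UR: "U h = k" if "R h k" for h k
  proof (rule uniqK[OF RU that])
    show "h \<in> carrier H" using that by (simp add: R_def)
  qed
  have iso: "cinner K (U h) (U h') = cinner H h h'" if h: "h \<in> carrier H" "h' \<in> carrier H" for h h'
  proof -
    obtain k c n where 1: "K.hconv (\<lambda>i. K.lincomb y (c i) (n i)) k" "H.hconv (\<lambda>i. H.lincomb x (c i) (n i)) h'"
      by (rule gram_transfer[OF assms(1,2) x yc gram h(2)])
    have k: "U h' = k" using UR limR[OF 1] by blast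
    have "cinner K (U h) (K.lincomb y (c i) (n i)) = cinner H h (H.lincomb x (c i) (n i))" for i
      using RU[OF h(1)] xc yc by (simp add: R_def H.cinner_lincomb_right K.cinner_lincomb_right)
    moreover have "U h \<in> carrier K" using RU[OF h(1)] by (simp add: R_def)
    ultimately show ?thesis
      using K.hconv_cinner[OF K.hconv_const 1(1), of "U h"] H.hconv_cinner[OF H.hconv_const 1(2), of h] h k
      by (simp add: LIMSEQ_unique)
  qed
  have "linear_op H K U"
    unfolding linear_op_def
  proof (intro conjI ballI allI)
    show "U \<in> carrier H \<rightarrow> carrier K" using RU by (auto simp: R_def)
    show "U (a \<oplus>\<^bsub>H\<^esub> b) = U a \<oplus>\<^bsub>K\<^esub> U b" if "a \<in> carrier H" "b \<in> carrier H" for a b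
      using RU[OF that(1)] RU[OF that(2)] xc yc by (intro UR) (auto simp: R_def H.cinner_simps K.cinner_simps)
    show "U (c \<odot>\<^bsub>H\<^esub> a) = c \<odot>\<^bsub>K\<^esub> U a" if "a \<in> carrier H" for a c
      using RU[OF that] xc yc by (intro UR) (auto simp: R_def H.cinner_simps K.cinner_simps)
  qed
  moreover have "bij_betw U (carrier H) (carrier K)"
    unfolding bij_betw_def
  proof
    show "inj_on U (carrier H)"
    proof (rule inj_onI)
      fix a b assume "a \<in> carrier H" "b \<in> carrier H" "U a = U b"
      then show "a = b" using RU[of a] RU[of b] uniqH by simp
    qed
    show "U ` carrier H = carrier K"
    proof
      show "U ` carrier H \<subseteq> carrier K" using RU by (auto simp: R_def)
      show "carrier K \<subseteq> U ` carrier H"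
      proof
        fix k assume "k \<in> carrier K"
        then obtain h where h: "R h k" using ex2 by blast
        then have "h \<in> carrier H" by (simp add: R_def)
        then show "k \<in> U ` carrier H" using UR[OF h] by blast
      qed
    qed
  qed
  ultimately have "unitary_map H K U" using iso by (simp add: unitary_map_def)
  moreover have "U (x k) = y k" for k
    using xc yc gram by (intro UR) (auto simp: R_def)
  ultimately show ?thesis using that by blast
qed

lemma unitary_map_bounded:
  assumes "unitary_map H K U" shows "bounded_op H K U"
  using assms unfolding unitary_map_def bounded_op_def hnorm_def by (auto intro: exI[of _ 1])

lemma adj_unitary:
  assumes "unitary_map H K U" "hilbert H" "w \<in> carrier H"
  shows "adj H K U (U w) = w"
proof -
  interpret H: hilbert H by fact
  have iso: "\<And>a b. a \<in> carrier H \<Longrightarrow> b \<in> carrier H \<Longrightarrow> cinner K (U a) (U b) = cinner H a b"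
    using assms by (auto simp: unitary_map_def)
  show ?thesis
    unfolding adj_def
  proof (rule the_equality)
    fix x assume x: "x \<in> carrier H \<and> (\<forall>h\<in>carrier H. cinner K (U h) (U w) = cinner H h x)"
    show "x = w"
    proof (rule H.cinner_ext)
      fix z assume z: "z \<in> carrier H"
      have "cinner H z x = cinner H z w" using x z iso[of z w] assms(3) by simp
      then show "cinner H x z = cinner H w z"
        using H.cinner_herm[OF z assms(3)] H.cinner_herm[OF z] x by simp
    qed (use x assms in auto)
  qed (use assms iso in auto)
qed

text \<open>For a unitary the adjoint is the inverse, which is why \<open>T = U\<^sup>* S U\<close> and \<open>U T = S U\<close> say the same.\<close>

lemma intertwine_iff:
  assumes U: "unitary_map H K U" and H: "hilbert H"
    and T: "\<And>x. x \<in> carrier H \<Longrightarrow> T x \<in> carrier H" and S: "\<And>x. x \<in> carrier K \<Longrightarrow> S x \<in> carrier K"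
  shows "(\<forall>x\<in>carrier H. T x = adj H K U (S (U x))) \<longleftrightarrow> (\<forall>x\<in>carrier H. U (T x) = S (U x))"
proof -
  have bij: "bij_betw U (carrier H) (carrier K)" using U by (simp add: unitary_map_def)
  have "T x = adj H K U (S (U x)) \<longleftrightarrow> U (T x) = S (U x)" if x: "x \<in> carrier H" for x
  proof -
    have "S (U x) \<in> carrier K" using S x bij by (auto simp: bij_betw_def)
    then obtain w where w: "w \<in> carrier H" "S (U x) = U w" using bij by (auto simp: bij_betw_def)
    then have "adj H K U (S (U x)) = w" using adj_unitary[OF U H] by simp
    then show ?thesis using w T[OF x] bij by (auto simp: bij_betw_def dest: inj_onD)
  qed
  then show ?thesis by blast
qed

section \<open>The completion of a semi-inner product space\<close>

context semi_inner_space
begin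

abbreviation "Pc \<equiv> completion P"

lemma cauchy_seq_carrier: "F \<in> cauchy_seqs P \<Longrightarrow> F i \<in> carrier P"
  by (auto simp: cauchy_seqs_def)

lemma cauchy_seqD: "F \<in> cauchy_seqs P \<Longrightarrow> e > 0 \<Longrightarrow> \<exists>N. \<forall>i\<ge>N. \<forall>j\<ge>N. hnorm P (F i \<ominus> F j) < e"
  unfolding cauchy_seqs_def by blast

lemma cauchy_seqI:
  "(\<And>i. F i \<in> carrier P) \<Longrightarrow> (\<And>e. e > 0 \<Longrightarrow> \<exists>N. \<forall>i\<ge>N. \<forall>j\<ge>N. hnorm P (F i \<ominus> F j) < e) \<Longrightarrow> F \<in> cauchy_seqs P"
  unfolding cauchy_seqs_def by blast

lemma cauchy_seq_const: "x \<in> carrier P \<Longrightarrow> (\<lambda>_. x) \<in> cauchy_seqs P"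
  by (rule cauchy_seqI) auto

lemma cauchy_seq_add:
  assumes F: "F \<in> cauchy_seqs P" and G: "G \<in> cauchy_seqs P"
  shows "(\<lambda>i. F i \<oplus> G i) \<in> cauchy_seqs P"
proof (rule cauchy_seqI)
  fix e :: real assume "e > 0"
  then obtain N M where N: "\<forall>i\<ge>N. \<forall>j\<ge>N. hnorm P (F i \<ominus> F j) < e/2"
    and M: "\<forall>i\<ge>M. \<forall>j\<ge>M. hnorm P (G i \<ominus> G j) < e/2"
    using cauchy_seqD[OF F, of "e/2"] cauchy_seqD[OF G, of "e/2"] by auto
  have "hnorm P ((F i \<oplus> G i) \<ominus> (F j \<oplus> G j)) < e" if "i \<ge> max N M" "j \<ge> max N M" for i j
  proof -
    have "hnorm P ((F i \<oplus> G i) \<ominus> (F j \<oplus> G j)) \<le> hnorm P (F i \<ominus> F j) + hnorm P (G i \<ominus> G j)"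
      using F G by (intro hnorm_diff_add_le cauchy_seq_carrier)
    also have "\<dots> < e/2 + e/2" using N M that by (intro add_strict_mono) auto
    finally show ?thesis by simp
  qed
  then show "\<exists>N. \<forall>i\<ge>N. \<forall>j\<ge>N. hnorm P ((F i \<oplus> G i) \<ominus> (F j \<oplus> G j)) < e" by blast
qed (use F G in \<open>auto intro: cauchy_seq_carrier\<close>)

lemma cauchy_seq_image:
  assumes F: "F \<in> cauchy_seqs P" and S: "\<And>x. x \<in> carrier P \<Longrightarrow> S x \<in> carrier P"
    and B: "\<And>x y. x \<in> carrier P \<Longrightarrow> y \<in> carrier P \<Longrightarrow> hnorm P (S x \<ominus> S y) \<le> B * hnorm P (x \<ominus> y)"
  shows "(\<lambda>i. S (F i)) \<in> cauchy_seqs P"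
proof (rule cauchy_seqI)
  fix e :: real assume e: "e > 0"
  have b: "max B 1 > 0" by simp
  obtain N where N: "\<forall>i\<ge>N. \<forall>j\<ge>N. hnorm P (F i \<ominus> F j) < e / max B 1"
    using cauchy_seqD[OF F, of "e / max B 1"] e b by (meson divide_pos_pos)
  have "hnorm P (S (F i) \<ominus> S (F j)) < e" if "i \<ge> N" "j \<ge> N" for i j
  proof -
    have c: "F i \<in> carrier P" "F j \<in> carrier P" using F by (auto intro: cauchy_seq_carrier)
    have "hnorm P (S (F i) \<ominus> S (F j)) \<le> B * hnorm P (F i \<ominus> F j)" using B c by blast
    also have "\<dots> \<le> max B 1 * hnorm P (F i \<ominus> F j)" using c by (intro mult_right_mono) auto
    also have "\<dots> < max B 1 * (e / max B 1)" using N that b by (intro mult_strict_left_mono) auto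
    also have "\<dots> = e" using b by (metis less_numeral_extra(3) nonzero_mult_div_cancel_left times_divide_eq_right)
    finally show ?thesis .
  qed
  then show "\<exists>N. \<forall>i\<ge>N. \<forall>j\<ge>N. hnorm P (S (F i) \<ominus> S (F j)) < e" by blast
qed (rule S[OF cauchy_seq_carrier[OF F]])

lemma cauchy_seq_smult: "F \<in> cauchy_seqs P \<Longrightarrow> (\<lambda>i. c \<odot> F i) \<in> cauchy_seqs P"
  by (rule cauchy_seq_image[where B = "cmod c"]) (auto simp: hnorm_diff_smult)

lemma cauchy_seq_diff:
  assumes "F \<in> cauchy_seqs P" "G \<in> cauchy_seqs P"
  shows "(\<lambda>i. F i \<ominus> G i) \<in> cauchy_seqs P"
proof -
  have "F i \<ominus> G i = F i \<oplus> (\<ominus>\<^bsub>complex_ring\<^esub> 1) \<odot> G i" for i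
    using smult_l_minus[of 1 "G i"] smult_one[of "G i"] assms
    by (simp add: a_minus_def cauchy_seq_carrier)
  then show ?thesis using cauchy_seq_add[OF assms(1) cauchy_seq_smult[OF assms(2)]] by simp
qed

lemma cauchy_seq_hnorm_convergent:
  assumes F: "F \<in> cauchy_seqs P" shows "convergent (\<lambda>i. hnorm P (F i))"
proof -
  have "Cauchy (\<lambda>i. hnorm P (F i))"
  proof (rule metric_CauchyI)
    fix e :: real assume "e > 0"
    then obtain N where N: "\<forall>i\<ge>N. \<forall>j\<ge>N. hnorm P (F i \<ominus> F j) < e" using cauchy_seqD[OF F] by blast
    have "dist (hnorm P (F i)) (hnorm P (F j)) < e" if "i \<ge> N" "j \<ge> N" for i j
      using N that hnorm_diff_triangle'[OF cauchy_seq_carrier[OF F, of i] cauchy_seq_carrier[OF F, of j]]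
      by (auto simp: dist_real_def intro: le_less_trans)
    then show "\<exists>N. \<forall>m\<ge>N. \<forall>n\<ge>N. dist (hnorm P (F m)) (hnorm P (F n)) < e" by blast
  qed
  then show ?thesis by (simp add: Cauchy_convergent_iff)
qed

lemma cauchy_seq_bounded:
  assumes F: "F \<in> cauchy_seqs P" obtains B where "B > 0" "\<And>i. hnorm P (F i) \<le> B"
proof -
  have "Bseq (\<lambda>i. hnorm P (F i))"
    using cauchy_seq_hnorm_convergent[OF F] by (rule convergent_imp_Bseq)
  then obtain B where B: "B > 0" "\<And>i. norm (hnorm P (F i)) \<le> B" by (auto elim: BseqE)
  have "hnorm P (F i) \<le> B" for i using B(2)[of i] by simp
  then show ?thesis by (rule that[OF B(1)])
qed

lemma null_rel_iff: "(F, G) \<in> null_rel P \<longleftrightarrow>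
    F \<in> cauchy_seqs P \<and> G \<in> cauchy_seqs P \<and> (\<lambda>i. hnorm P (F i \<ominus> G i)) \<longlonglongrightarrow> 0"
  by (simp add: null_rel_def)

lemma null_rel_equiv: "equiv (cauchy_seqs P) (null_rel P)"
proof (rule equivI)
  show "null_rel P \<subseteq> cauchy_seqs P \<times> cauchy_seqs P" by (auto simp: null_rel_def)
  show "refl_on (cauchy_seqs P) (null_rel P)"
    by (rule refl_onI) (auto simp: null_rel_def cauchy_seq_carrier)
  show "sym (null_rel P)"
  proof (rule symI)
    fix F G assume "(F, G) \<in> null_rel P"
    then show "(G, F) \<in> null_rel P"
      unfolding null_rel_iff using hnorm_diff_commute[OF cauchy_seq_carrier cauchy_seq_carrier, of F G] by simp
  qed
  show "trans (null_rel P)"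
  proof (rule transI)
    fix F G K assume a: "(F, G) \<in> null_rel P" "(G, K) \<in> null_rel P"
    have "(\<lambda>i. hnorm P (F i \<ominus> G i) + hnorm P (G i \<ominus> K i)) \<longlonglongrightarrow> 0 + 0"
      using a by (intro tendsto_add) (auto simp: null_rel_iff)
    then have "(\<lambda>i. hnorm P (F i \<ominus> K i)) \<longlonglongrightarrow> 0"
      by (rule metric_tendsto_imp_tendsto)
        (use a in \<open>auto simp: null_rel_iff cauchy_seq_carrier intro!: always_eventually hnorm_diff_triangle order.trans[OF hnorm_diff_triangle abs_ge_self]\<close>)
    then show "(F, K) \<in> null_rel P" using a by (auto simp: null_rel_iff)
  qed
qed

abbreviation cl :: "(nat \<Rightarrow> 'a) \<Rightarrow> (nat \<Rightarrow> 'a) set" where "cl F \<equiv> null_rel P `` {F}"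

lemma cl_eq_iff: "F \<in> cauchy_seqs P \<Longrightarrow> G \<in> cauchy_seqs P \<Longrightarrow> cl F = cl G \<longleftrightarrow> (F, G) \<in> null_rel P"
  using eq_equiv_class_iff[OF null_rel_equiv] by auto

lemma cl_self: "F \<in> cauchy_seqs P \<Longrightarrow> F \<in> cl F"
  using equiv_class_self[OF null_rel_equiv] .

lemma carrier_completion: "carrier Pc = cl ` cauchy_seqs P"
  by (auto simp: completion_def quotient_def)

lemma completion_cases:
  assumes "A \<in> carrier Pc" obtains F where "F \<in> cauchy_seqs P" "A = cl F"
  using assms unfolding carrier_completion by blast

lemma cl_in: "F \<in> cauchy_seqs P \<Longrightarrow> cl F \<in> carrier Pc"
  unfolding carrier_completion by blast

lemma cl_zero: "\<zero>\<^bsub>Pc\<^esub> = cl (\<lambda>_. \<zero>)"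
  by (simp add: completion_def)

lemma cl_congI:
  assumes "F \<in> cauchy_seqs P" "G \<in> cauchy_seqs P" "b \<longlonglongrightarrow> 0" "\<And>i. hnorm P (F i \<ominus> G i) \<le> b i"
  shows "cl F = cl G"
proof -
  have "(\<lambda>i. hnorm P (F i \<ominus> G i)) \<longlonglongrightarrow> 0"
    by (rule Lim_null_comparison[of _ b])
      (use assms in \<open>auto simp: cauchy_seq_carrier intro!: always_eventually\<close>)
  then show ?thesis using assms by (simp add: cl_eq_iff null_rel_iff)
qed

lemma cl_add:
  assumes F: "F \<in> cauchy_seqs P" and G: "G \<in> cauchy_seqs P"
  shows "cl F \<oplus>\<^bsub>Pc\<^esub> cl G = cl (\<lambda>i. F i \<oplus> G i)"
proof -
  have eq: "cl (\<lambda>i. F' i \<oplus> G' i) = cl (\<lambda>i. F i \<oplus> G i)" if "F' \<in> cl F" "G' \<in> cl G" for F' G'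
  proof (rule cl_congI)
    have a: "(F, F') \<in> null_rel P" "(G, G') \<in> null_rel P" using that by auto
    then show "(\<lambda>i. F' i \<oplus> G' i) \<in> cauchy_seqs P" by (auto simp: null_rel_iff intro: cauchy_seq_add)
    show "(\<lambda>i. F i \<oplus> G i) \<in> cauchy_seqs P" using F G by (rule cauchy_seq_add)
    show "(\<lambda>i. hnorm P (F i \<ominus> F' i) + hnorm P (G i \<ominus> G' i)) \<longlonglongrightarrow> 0"
      using a unfolding null_rel_iff by (intro tendsto_add_zero) blast+
    show "hnorm P (F' i \<oplus> G' i \<ominus> (F i \<oplus> G i)) \<le> hnorm P (F i \<ominus> F' i) + hnorm P (G i \<ominus> G' i)" for i
    proof -
      have "F' \<in> cauchy_seqs P" "G' \<in> cauchy_seqs P" using a by (auto simp: null_rel_iff)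
      then have c: "F i \<in> carrier P" "G i \<in> carrier P" "F' i \<in> carrier P" "G' i \<in> carrier P"
        using F G by (simp_all add: cauchy_seq_carrier)
      show ?thesis
        using hnorm_diff_add_le[OF c] c hnorm_diff_commute[of "F i \<oplus> G i" "F' i \<oplus> G' i"] by simp
    qed
  qed
  have "(\<Union>F'\<in>cl F. \<Union>G'\<in>cl G. cl (\<lambda>i. F' i \<oplus> G' i)) = cl (\<lambda>i. F i \<oplus> G i)"
  proof (rule UN_constant_eq[OF cl_self[OF F]], rule ballI)
    fix F' assume "F' \<in> cl F"
    then show "(\<Union>G'\<in>cl G. cl (\<lambda>i. F' i \<oplus> G' i)) = cl (\<lambda>i. F i \<oplus> G i)"
      by (intro UN_constant_eq[OF cl_self[OF G]] ballI eq)
  qed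
  then show ?thesis by (simp add: completion_def)
qed

text \<open>A Lipschitz map acts termwise on classes of Cauchy sequences. Both scalar multiplication and the
  extension of operators are of this kind.\<close>

lemma cl_image_eq:
  assumes F: "F \<in> cauchy_seqs P" and S: "\<And>x. x \<in> carrier P \<Longrightarrow> S x \<in> carrier P"
    and B: "\<And>x y. x \<in> carrier P \<Longrightarrow> y \<in> carrier P \<Longrightarrow> hnorm P (S x \<ominus> S y) \<le> B * hnorm P (x \<ominus> y)"
  shows "(\<Union>F'\<in>cl F. cl (\<lambda>i. S (F' i))) = cl (\<lambda>i. S (F i))"
proof (rule UN_constant_eq[OF cl_self[OF F]], rule ballI)
  fix F' assume "F' \<in> cl F"
  then have a: "(F, F') \<in> null_rel P" by auto
  show "cl (\<lambda>i. S (F' i)) = cl (\<lambda>i. S (F i))"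
  proof (rule cl_congI)
    show "(\<lambda>i. S (F' i)) \<in> cauchy_seqs P" "(\<lambda>i. S (F i)) \<in> cauchy_seqs P"
      using a cauchy_seq_image[OF _ S B] by (auto simp: null_rel_iff)
    show "(\<lambda>i. B * hnorm P (F i \<ominus> F' i)) \<longlonglongrightarrow> 0"
      using a by (auto simp: null_rel_iff intro: tendsto_mult_right_zero)
    show "hnorm P (S (F' i) \<ominus> S (F i)) \<le> B * hnorm P (F i \<ominus> F' i)" for i
      using a B[of "F' i" "F i"] hnorm_diff_commute[of "F i" "F' i"]
      by (auto simp: null_rel_iff cauchy_seq_carrier)
  qed
qed

lemma cl_smult:
  assumes F: "F \<in> cauchy_seqs P"
  shows "c \<odot>\<^bsub>Pc\<^esub> cl F = cl (\<lambda>i. c \<odot> F i)"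
  using cl_image_eq[OF F, of "\<lambda>x. c \<odot> x" "cmod c"] by (simp add: completion_def hnorm_diff_smult)

text \<open>Cauchy sequences are bounded, so by the Cauchy--Schwarz inequality the inner products of two of them
  form a Cauchy sequence of numbers, whose limit only depends on the classes.\<close>

lemma cinner_completion_tendsto:
  assumes F: "F \<in> cauchy_seqs P" and G: "G \<in> cauchy_seqs P"
  shows "(\<lambda>i. cinner P (F i) (G i)) \<longlonglongrightarrow> cinner Pc (cl F) (cl G)"
proof -
  have Cau: "convergent (\<lambda>i. cinner P (F i) (G i))" if F: "F \<in> cauchy_seqs P" and G: "G \<in> cauchy_seqs P" for F G
  proof -
    obtain B where B: "B > 0" "\<And>i. hnorm P (F i) \<le> B" using cauchy_seq_bounded[OF F] by blast
    obtain B' where B': "B' > 0" "\<And>i. hnorm P (G i) \<le> B'" using cauchy_seq_bounded[OF G] by blast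
    have "Cauchy (\<lambda>i. cinner P (F i) (G i))"
    proof (rule metric_CauchyI)
      fix e :: real assume e: "e > 0"
      have pos: "e / (2 * B') > 0" "e / (2 * B) > 0" using e B B' by auto
      obtain N where N: "\<forall>i\<ge>N. \<forall>j\<ge>N. hnorm P (F i \<ominus> F j) < e / (2 * B')"
        using cauchy_seqD[OF F pos(1)] by blast
      obtain M where M: "\<forall>i\<ge>M. \<forall>j\<ge>M. hnorm P (G i \<ominus> G j) < e / (2 * B)"
        using cauchy_seqD[OF G pos(2)] by blast
      have "dist (cinner P (F i) (G i)) (cinner P (F j) (G j)) < e" if ij: "i \<ge> max N M" "j \<ge> max N M" for i j
      proof -
        note c = cauchy_seq_carrier[OF F, of i] cauchy_seq_carrier[OF G, of i] cauchy_seq_carrier[OF F, of j] cauchy_seq_carrier[OF G, of j]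
        have "cmod (cinner P (F i) (G i) - cinner P (F j) (G j))
          \<le> hnorm P (F i \<ominus> F j) * hnorm P (G i) + hnorm P (F j) * hnorm P (G i \<ominus> G j)"
          by (rule cinner_diff_le[OF c])
        also have "\<dots> \<le> hnorm P (F i \<ominus> F j) * B' + B * hnorm P (G i \<ominus> G j)"
          using c B B' by (intro add_mono mult_left_mono mult_right_mono) auto
        also have "\<dots> < (e / (2 * B')) * B' + B * (e / (2 * B))"
          using N M ij B(1) B'(1) by (intro add_strict_mono mult_strict_right_mono mult_strict_left_mono) auto
        also have "\<dots> = e" using B(1) B'(1) by simp
        finally show ?thesis by (simp add: dist_norm)
      qed
      then show "\<exists>N. \<forall>m\<ge>N. \<forall>n\<ge>N. dist (cinner P (F m) (G m)) (cinner P (F n) (G n)) < e" by blast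
    qed
    then show ?thesis by (simp add: Cauchy_convergent_iff)
  qed
  obtain c where c: "(\<lambda>i. cinner P (F i) (G i)) \<longlonglongrightarrow> c" using Cau[OF F G] by (auto simp: convergent_def)
  have c': "(\<lambda>i. cinner P (F' i) (G' i)) \<longlonglongrightarrow> c" if "F' \<in> cl F" "G' \<in> cl G" for F' G'
  proof -
    have a: "(F, F') \<in> null_rel P" "(G, G') \<in> null_rel P" using that by auto
    have Gc: "G \<in> cauchy_seqs P" "F' \<in> cauchy_seqs P" using a by (auto simp: null_rel_iff)
    obtain B where B: "B > 0" "\<And>i. hnorm P (G i) \<le> B" using cauchy_seq_bounded[OF Gc(1)] by blast
    obtain B' where B': "B' > 0" "\<And>i. hnorm P (F' i) \<le> B'" using cauchy_seq_bounded[OF Gc(2)] by blast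
    have "(\<lambda>i. cinner P (F i) (G i) - cinner P (F' i) (G' i)) \<longlonglongrightarrow> 0"
    proof (rule Lim_null_comparison)
      show "(\<lambda>i. hnorm P (F i \<ominus> F' i) * B + B' * hnorm P (G i \<ominus> G' i)) \<longlonglongrightarrow> 0"
        using a by (auto simp: null_rel_iff intro!: tendsto_add_zero tendsto_mult_left_zero tendsto_mult_right_zero)
      show "\<forall>\<^sub>F i in sequentially. norm (cinner P (F i) (G i) - cinner P (F' i) (G' i))
          \<le> hnorm P (F i \<ominus> F' i) * B + B' * hnorm P (G i \<ominus> G' i)"
      proof (intro always_eventually allI)
        fix i
        have "G' \<in> cauchy_seqs P" using a by (auto simp: null_rel_iff)
        then have c: "F i \<in> carrier P" "G i \<in> carrier P" "F' i \<in> carrier P" "G' i \<in> carrier P"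
          using F Gc by (simp_all add: cauchy_seq_carrier)
        show "norm (cinner P (F i) (G i) - cinner P (F' i) (G' i))
          \<le> hnorm P (F i \<ominus> F' i) * B + B' * hnorm P (G i \<ominus> G' i)"
          by (rule order.trans[OF cinner_diff_le[OF c]])
            (use c B B' in \<open>intro add_mono mult_left_mono mult_right_mono; simp\<close>)
      qed
    qed
    from tendsto_diff[OF c this] show ?thesis by simp
  qed
  have "cinner Pc (cl F) (cl G) = c"
    unfolding completion_def hilb.simps
  proof (rule the_equality)
    show "\<forall>F'\<in>cl F. \<forall>G'\<in>cl G. (\<lambda>i. cinner P (F' i) (G' i)) \<longlonglongrightarrow> c" using c' by blast
    fix d assume "\<forall>F'\<in>cl F. \<forall>G'\<in>cl G. (\<lambda>i. cinner P (F' i) (G' i)) \<longlonglongrightarrow> d"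
    then have "(\<lambda>i. cinner P (F i) (G i)) \<longlonglongrightarrow> d" using cl_self[OF F] cl_self[OF G] by blast
    then show "d = c" using c by (rule LIMSEQ_unique)
  qed
  then show ?thesis using c by simp
qed

lemma cinner_completionI:
  assumes "F \<in> cauchy_seqs P" "G \<in> cauchy_seqs P" "(\<lambda>i. cinner P (F i) (G i)) \<longlonglongrightarrow> c"
  shows "cinner Pc (cl F) (cl G) = c"
  using cinner_completion_tendsto[OF assms(1,2)] assms(3) by (rule LIMSEQ_unique)

lemma completion_abelian_group: "abelian_group Pc"
proof (rule abelian_groupI)
  fix x y z assume "x \<in> carrier Pc" "y \<in> carrier Pc" "z \<in> carrier Pc"
  then show "(x \<oplus>\<^bsub>Pc\<^esub> y) \<oplus>\<^bsub>Pc\<^esub> z = x \<oplus>\<^bsub>Pc\<^esub> (y \<oplus>\<^bsub>Pc\<^esub> z)"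
    by (elim completion_cases) (simp add: cl_add cauchy_seq_add cauchy_seq_carrier M.a_assoc)
next
  fix x y assume "x \<in> carrier Pc" "y \<in> carrier Pc"
  then show "x \<oplus>\<^bsub>Pc\<^esub> y \<in> carrier Pc"
    by (elim completion_cases) (simp add: cl_add cl_in cauchy_seq_add)
next
  fix x y assume "x \<in> carrier Pc" "y \<in> carrier Pc"
  then show "x \<oplus>\<^bsub>Pc\<^esub> y = y \<oplus>\<^bsub>Pc\<^esub> x"
    by (elim completion_cases) (simp add: cl_add cauchy_seq_carrier M.a_comm)
next
  show "\<zero>\<^bsub>Pc\<^esub> \<in> carrier Pc"
    by (simp add: cl_zero cl_in cauchy_seq_const)
next
  fix x assume "x \<in> carrier Pc"
  then show "\<zero>\<^bsub>Pc\<^esub> \<oplus>\<^bsub>Pc\<^esub> x = x"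
    by (elim completion_cases) (simp add: cl_zero cl_add cauchy_seq_const cauchy_seq_carrier)
next
  fix x assume "x \<in> carrier Pc"
  then obtain F where F: "F \<in> cauchy_seqs P" "x = cl F" by (rule completion_cases)
  have z: "(\<lambda>_. \<zero>) \<in> cauchy_seqs P" by (simp add: cauchy_seq_const)
  have "(\<zero> \<ominus> F i) \<oplus> F i = \<zero>" for i
    using cauchy_seq_carrier[OF F(1), of i] by (simp add: a_minus_def M.l_neg)
  then have "cl (\<lambda>i. \<zero> \<ominus> F i) \<oplus>\<^bsub>Pc\<^esub> x = \<zero>\<^bsub>Pc\<^esub>"
    unfolding F(2) cl_zero by (subst cl_add[OF cauchy_seq_diff[OF z F(1)] F(1)]) simp
  then show "\<exists>y\<in>carrier Pc. y \<oplus>\<^bsub>Pc\<^esub> x = \<zero>\<^bsub>Pc\<^esub>"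
    using cl_in[OF cauchy_seq_diff[OF z F(1)]] by blast
qed

lemma completion_module: "module complex_ring Pc"
proof (rule moduleI)
  show "cring complex_ring" by (rule cring_from_type_algebra)
  show "abelian_group Pc" by (rule completion_abelian_group)
next
  fix a :: complex and x assume "x \<in> carrier Pc"
  then show "a \<odot>\<^bsub>Pc\<^esub> x \<in> carrier Pc"
    by (elim completion_cases) (simp add: cl_smult cl_in cauchy_seq_smult)
next
  fix a b :: complex and x assume "x \<in> carrier Pc"
  then show "(a \<oplus>\<^bsub>complex_ring\<^esub> b) \<odot>\<^bsub>Pc\<^esub> x = a \<odot>\<^bsub>Pc\<^esub> x \<oplus>\<^bsub>Pc\<^esub> b \<odot>\<^bsub>Pc\<^esub> x"
    using smult_l_distr[of a b]
    by (elim completion_cases) (simp add: cl_smult cl_add cauchy_seq_smult cauchy_seq_carrier)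
next
  fix a :: complex and x y assume "x \<in> carrier Pc" "y \<in> carrier Pc"
  then show "a \<odot>\<^bsub>Pc\<^esub> (x \<oplus>\<^bsub>Pc\<^esub> y) = a \<odot>\<^bsub>Pc\<^esub> x \<oplus>\<^bsub>Pc\<^esub> a \<odot>\<^bsub>Pc\<^esub> y"
    using smult_r_distr[of a]
    by (elim completion_cases) (simp add: cl_smult cl_add cauchy_seq_smult cauchy_seq_add cauchy_seq_carrier)
next
  fix a b :: complex and x assume "x \<in> carrier Pc"
  then show "(a \<otimes>\<^bsub>complex_ring\<^esub> b) \<odot>\<^bsub>Pc\<^esub> x = a \<odot>\<^bsub>Pc\<^esub> (b \<odot>\<^bsub>Pc\<^esub> x)"
    using smult_assoc1[of a b]
    by (elim completion_cases) (simp add: cl_smult cauchy_seq_smult cauchy_seq_carrier)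
next
  fix x assume "x \<in> carrier Pc"
  then show "\<one>\<^bsub>complex_ring\<^esub> \<odot>\<^bsub>Pc\<^esub> x = x"
    using smult_one by (elim completion_cases) (simp add: cl_smult cauchy_seq_carrier)
qed

lemma completion_inner_space: "inner_space Pc"
proof (intro inner_space.intro semi_inner_space.intro completion_module
    semi_inner_space_axioms.intro inner_space_axioms.intro)
  fix x y assume "x \<in> carrier Pc" "y \<in> carrier Pc"
  then obtain F G where *: "F \<in> cauchy_seqs P" "x = cl F" "G \<in> cauchy_seqs P" "y = cl G"
    by (elim completion_cases) blast
  have "(\<lambda>i. cinner P (G i) (F i)) \<longlonglongrightarrow> cnj (cinner Pc (cl F) (cl G))"
    using tendsto_cnj[OF cinner_completion_tendsto[OF *(1,3)]]
    by (simp add: cinner_herm[OF cauchy_seq_carrier[OF *(1)] cauchy_seq_carrier[OF *(3)]])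
  then show "cinner Pc y x = cnj (cinner Pc x y)"
    using * by (simp add: cinner_completionI)
next
  fix x y z assume "x \<in> carrier Pc" "y \<in> carrier Pc" "z \<in> carrier Pc"
  then obtain F G K where *: "F \<in> cauchy_seqs P" "x = cl F" "G \<in> cauchy_seqs P" "y = cl G" "K \<in> cauchy_seqs P" "z = cl K"
    by (elim completion_cases) blast
  show "cinner Pc (x \<oplus>\<^bsub>Pc\<^esub> y) z = cinner Pc x z + cinner Pc y z"
    unfolding * cl_add[OF *(1,3)]
    using tendsto_add[OF cinner_completion_tendsto[OF *(1,5)] cinner_completion_tendsto[OF *(3,5)]] *
    by (intro cinner_completionI) (simp_all add: cauchy_seq_add cinner_add_left cauchy_seq_carrier)
next
  fix x y c assume "x \<in> carrier Pc" "y \<in> carrier Pc"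
  then obtain F G where *: "F \<in> cauchy_seqs P" "x = cl F" "G \<in> cauchy_seqs P" "y = cl G"
    by (elim completion_cases) blast
  show "cinner Pc (c \<odot>\<^bsub>Pc\<^esub> x) y = c * cinner Pc x y"
    unfolding * cl_smult[OF *(1)]
    using tendsto_mult_left[OF cinner_completion_tendsto[OF *(1,3)], of c] *
    by (intro cinner_completionI) (simp_all add: cauchy_seq_smult cinner_smult_left cauchy_seq_carrier)
next
  fix x assume "x \<in> carrier Pc"
  then obtain F where F: "F \<in> cauchy_seqs P" "x = cl F" by (elim completion_cases)
  note lim = cinner_completion_tendsto[OF F(1) F(1)]
  have nn: "0 \<le> Re (cinner P (F i) (F i))" "Im (cinner P (F i) (F i)) = 0" for i
    using cinner_nonneg[OF cauchy_seq_carrier[OF F(1), of i]] by (auto simp: less_eq_complex_def)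
  show "0 \<le> cinner Pc x x"
    using LIMSEQ_le_const[OF tendsto_Re[OF lim], of 0] nn tendsto_Im[OF lim] F(2)
    by (auto simp: less_eq_complex_def LIMSEQ_const_iff)
  assume "cinner Pc x x = 0"
  then have "(\<lambda>i. sqrt (Re (cinner P (F i) (F i)))) \<longlonglongrightarrow> sqrt (Re 0)"
    using lim F(2) by (intro tendsto_intros) auto
  moreover have "hnorm P (F i \<ominus> \<zero>) = sqrt (Re (cinner P (F i) (F i)))" for i
    using cauchy_seq_carrier[OF F(1), of i] by (simp add: hnorm_def cinner_simps)
  ultimately show "x = \<zero>\<^bsub>Pc\<^esub>"
    using F by (simp add: cl_zero cl_eq_iff cauchy_seq_const null_rel_iff)
qed

lemma hnorm_completion_tendsto:
  assumes F: "F \<in> cauchy_seqs P"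
  shows "(\<lambda>i. hnorm P (F i)) \<longlonglongrightarrow> hnorm Pc (cl F)"
  unfolding hnorm_def by (intro tendsto_intros cinner_completion_tendsto F)

lemma cl_diff:
  assumes F: "F \<in> cauchy_seqs P" and G: "G \<in> cauchy_seqs P"
  shows "cl F \<ominus>\<^bsub>Pc\<^esub> cl G = cl (\<lambda>i. F i \<ominus> G i)"
proof -
  interpret C: inner_space Pc by (rule completion_inner_space)
  show ?thesis
  proof (rule C.cinner_ext)
    fix z assume "z \<in> carrier Pc"
    then obtain K where K: "K \<in> cauchy_seqs P" "z = cl K" by (elim completion_cases)
    have "cinner Pc (cl (\<lambda>i. F i \<ominus> G i)) z = cinner Pc (cl F) z - cinner Pc (cl G) z"
      unfolding K
      using tendsto_diff[OF cinner_completion_tendsto[OF F K(1)] cinner_completion_tendsto[OF G K(1)]] F G K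
      by (intro cinner_completionI) (simp_all add: cauchy_seq_diff cinner_diff_left cauchy_seq_carrier)
    then show "cinner Pc (cl F \<ominus>\<^bsub>Pc\<^esub> cl G) z = cinner Pc (cl (\<lambda>i. F i \<ominus> G i)) z"
      using F G K by (simp add: C.cinner_diff_left cl_in)
  qed (use F G in \<open>auto simp: cl_in cauchy_seq_diff\<close>)
qed

lemma to_completion_eq: "to_completion P x = cl (\<lambda>_. x)"
  by (simp add: to_completion_def)

lemma to_completion_in: "x \<in> carrier P \<Longrightarrow> to_completion P x \<in> carrier Pc"
  by (simp add: to_completion_eq cl_in cauchy_seq_const)

lemma to_completion_linear: "linear_op P Pc (to_completion P)"
  unfolding linear_op_def
  by (auto simp: to_completion_in) (auto simp: to_completion_eq cl_add cl_smult cauchy_seq_const)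

lemma cinner_to_completion:
  "x \<in> carrier P \<Longrightarrow> y \<in> carrier P \<Longrightarrow>
     cinner Pc (to_completion P x) (to_completion P y) = cinner P x y"
  unfolding to_completion_eq by (intro cinner_completionI) (auto simp: cauchy_seq_const)

lemma hnorm_to_completion_diff:
  assumes F: "F \<in> cauchy_seqs P" and N: "\<And>i. i \<ge> N \<Longrightarrow> hnorm P (F i \<ominus> x) \<le> e" and x: "x \<in> carrier P"
  shows "hnorm Pc (cl F \<ominus>\<^bsub>Pc\<^esub> to_completion P x) \<le> e"
proof -
  have "(\<lambda>i. hnorm P (F i \<ominus> x)) \<longlonglongrightarrow> hnorm Pc (cl F \<ominus>\<^bsub>Pc\<^esub> to_completion P x)"
    unfolding to_completion_eq cl_diff[OF F cauchy_seq_const[OF x]]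
    by (rule hnorm_completion_tendsto[OF cauchy_seq_diff[OF F cauchy_seq_const[OF x]]])
  then show ?thesis by (rule LIMSEQ_le_const2) (use N in auto)
qed

lemma to_completion_dense:
  assumes "A \<in> carrier Pc" "e > 0"
  obtains x where "x \<in> carrier P" "hnorm Pc (A \<ominus>\<^bsub>Pc\<^esub> to_completion P x) < e"
proof -
  obtain F where F: "F \<in> cauchy_seqs P" "A = cl F" using assms by (elim completion_cases)
  obtain N where N: "\<forall>i\<ge>N. \<forall>j\<ge>N. hnorm P (F i \<ominus> F j) < e / 2"
    using cauchy_seqD[OF F(1), of "e/2"] assms by auto
  have "hnorm Pc (A \<ominus>\<^bsub>Pc\<^esub> to_completion P (F N)) \<le> e / 2"
    unfolding F(2) using N by (intro hnorm_to_completion_diff[OF F(1), of N] less_imp_le cauchy_seq_carrier F) auto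
  then show ?thesis using that[of "F N"] cauchy_seq_carrier[OF F(1)] assms by auto
qed

text \<open>A Cauchy sequence of classes \<open>A n\<close> is shadowed by elements \<open>x n\<close> of the original space at distance
  less than \<open>1 / (n + 1)\<close>; the sequence \<open>x\<close> is Cauchy, and its own class is the limit.\<close>

theorem completion_hilbert: "hilbert Pc"
proof (intro hilbert.intro completion_inner_space hilbert_axioms.intro)
  interpret C: inner_space Pc by (rule completion_inner_space)
  let ?j = "to_completion P"
  fix A assume A: "A \<in> cauchy_seqs Pc"
  note Ac = C.cauchy_seq_carrier[OF A]
  have "\<exists>x. x \<in> carrier P \<and> hnorm Pc (A n \<ominus>\<^bsub>Pc\<^esub> ?j x) < inverse (real (Suc n))" for n
    by (rule to_completion_dense[OF Ac, of "inverse (real (Suc n))" n]) auto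
  then obtain x where x: "\<And>n. x n \<in> carrier P"
      "\<And>n. hnorm Pc (A n \<ominus>\<^bsub>Pc\<^esub> ?j (x n)) < inverse (real (Suc n))" by metis
  note jx = to_completion_in[OF x(1)]
  have jd: "hnorm P (x i \<ominus> x j) = hnorm Pc (?j (x i) \<ominus>\<^bsub>Pc\<^esub> ?j (x j))" for i j
    using x(1)[of i] x(1)[of j] jx[of i] jx[of j]
    by (simp add: hnorm_def cinner_simps C.cinner_simps cinner_to_completion)
  have xC: "x \<in> cauchy_seqs P"
  proof (rule cauchy_seqI)
    fix e :: real assume e: "e > 0"
    obtain N where N: "\<forall>i\<ge>N. \<forall>j\<ge>N. hnorm Pc (A i \<ominus>\<^bsub>Pc\<^esub> A j) < e / 3"
      using C.cauchy_seqD[OF A, of "e/3"] e by auto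
    obtain K where K: "inverse (real (Suc K)) < e / 3"
      using reals_Archimedean[of "e/3"] e by auto
    have "hnorm P (x i \<ominus> x j) < e" if ij: "i \<ge> max N K" "j \<ge> max N K" for i j
    proof -
      have k: "hnorm Pc (A l \<ominus>\<^bsub>Pc\<^esub> ?j (x l)) < e / 3" if "l \<ge> max N K" for l
      proof -
        have "inverse (real (Suc l)) \<le> inverse (real (Suc K))"
          using that by (intro le_imp_inverse_le) auto
        then show ?thesis using x(2)[of l] K by linarith
      qed
      have "hnorm P (x i \<ominus> x j) \<le> hnorm Pc (?j (x i) \<ominus>\<^bsub>Pc\<^esub> A i) + hnorm Pc (A i \<ominus>\<^bsub>Pc\<^esub> ?j (x j))"
        unfolding jd by (rule C.hnorm_diff_triangle[OF jx Ac jx])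
      also have "\<dots> \<le> hnorm Pc (?j (x i) \<ominus>\<^bsub>Pc\<^esub> A i) +
          (hnorm Pc (A i \<ominus>\<^bsub>Pc\<^esub> A j) + hnorm Pc (A j \<ominus>\<^bsub>Pc\<^esub> ?j (x j)))"
        by (intro add_left_mono C.hnorm_diff_triangle[OF Ac Ac jx])
      also have "\<dots> < e/3 + (e/3 + e/3)"
        using k[OF ij(1)] k[OF ij(2)] N ij C.hnorm_diff_commute[OF jx Ac, of i i]
        by (intro add_strict_mono) auto
      finally show ?thesis by simp
    qed
    then show "\<exists>N. \<forall>i\<ge>N. \<forall>j\<ge>N. hnorm P (x i \<ominus> x j) < e" by blast
  qed (rule x)
  have jlim: "C.hconv (\<lambda>n. ?j (x n)) (cl x)"
    unfolding C.hconv_def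
  proof (intro conjI)
    show "(\<lambda>n. hnorm Pc (?j (x n) \<ominus>\<^bsub>Pc\<^esub> cl x)) \<longlonglongrightarrow> 0"
    proof (rule LIMSEQ_I)
      fix e :: real assume e: "e > 0"
      obtain N where N: "\<forall>i\<ge>N. \<forall>j\<ge>N. hnorm P (x i \<ominus> x j) < e / 2"
        using cauchy_seqD[OF xC, of "e/2"] e by auto
      have "norm (hnorm Pc (?j (x n) \<ominus>\<^bsub>Pc\<^esub> cl x) - 0) < e" if n: "n \<ge> N" for n
      proof -
        have "hnorm Pc (cl x \<ominus>\<^bsub>Pc\<^esub> ?j (x n)) \<le> e / 2"
          using N n by (intro hnorm_to_completion_diff[OF xC, of N] x) (auto intro: less_imp_le)
        then show ?thesis using e C.hnorm_diff_commute[OF jx cl_in[OF xC], of n] jx[of n] cl_in[OF xC] by simp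
      qed
      then show "\<exists>no. \<forall>n\<ge>no. norm (hnorm Pc (?j (x n) \<ominus>\<^bsub>Pc\<^esub> cl x) - 0) < e" by blast
    qed
  qed (use jx cl_in[OF xC] in auto)
  have "C.hconv A (cl x)"
  proof (rule C.hconvI)
    show "hnorm Pc (A n \<ominus>\<^bsub>Pc\<^esub> cl x) \<le>
       inverse (real (Suc n)) + hnorm Pc (?j (x n) \<ominus>\<^bsub>Pc\<^esub> cl x)" for n
      using C.hnorm_diff_triangle[OF Ac jx cl_in[OF xC], of n n] x(2)[of n] by linarith
    show "(\<lambda>n. inverse (real (Suc n)) + hnorm Pc (?j (x n) \<ominus>\<^bsub>Pc\<^esub> cl x)) \<longlonglongrightarrow> 0"
      using jlim by (intro tendsto_add_zero LIMSEQ_inverse_real_of_nat) (auto simp: C.hconv_def)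
  qed (use Ac cl_in[OF xC] in auto)
  then show "\<exists>x. C.hconv A x" by blast
qed

lemma completion_total:
  assumes "total_seq x"
  shows "semi_inner_space.total_seq Pc (\<lambda>k. to_completion P (x k))"
proof -
  interpret C: hilbert Pc by (rule completion_hilbert)
  let ?j = "to_completion P"
  note xc = total_carrier[OF assms]
  show ?thesis
    unfolding C.total_seq_def
  proof (intro conjI allI ballI impI)
    fix A and e :: real assume A: "A \<in> carrier Pc" and e: "e > 0"
    obtain h where h: "h \<in> carrier P" "hnorm Pc (A \<ominus>\<^bsub>Pc\<^esub> ?j h) < e/2"
      using to_completion_dense[OF A, of "e/2"] e by auto
    obtain c n where cn: "hnorm P (h \<ominus> lincomb x c n) < e/2"
      using assms h e unfolding total_seq_def by (metis half_gt_zero)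
    let ?l = "lincomb x c n"
    have l: "?l \<in> carrier P" using xc by simp
    have jl: "?j ?l = C.lincomb (\<lambda>k. ?j (x k)) c n"
      using linear_op_lincomb[OF to_completion_linear semi_inner_space_axioms C.semi_inner_space_axioms xc] .
    have "hnorm Pc (?j h \<ominus>\<^bsub>Pc\<^esub> ?j ?l) = hnorm P (h \<ominus> ?l)"
      using h(1) l to_completion_in[OF h(1)] to_completion_in[OF l]
      by (simp add: hnorm_def cinner_simps C.cinner_simps cinner_to_completion)
    then have "hnorm Pc (A \<ominus>\<^bsub>Pc\<^esub> ?j ?l) < e/2 + e/2"
      using C.hnorm_diff_triangle[OF A to_completion_in[OF h(1)] to_completion_in[OF l]] h(2) cn by linarith
    then show "\<exists>c n. hnorm Pc (A \<ominus>\<^bsub>Pc\<^esub> C.lincomb (\<lambda>k. ?j (x k)) c n) < e"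
      unfolding jl by auto
  qed (use xc to_completion_in in auto)
qed

lemma completion_extend_op:
  assumes S: "linear_op P P S" and B: "\<And>x. x \<in> carrier P \<Longrightarrow> hnorm P (S x) \<le> B * hnorm P x"
  obtains M where "M \<in> extensional (carrier Pc)" "bounded_op Pc Pc M"
    "\<And>x. x \<in> carrier P \<Longrightarrow> M (to_completion P x) = to_completion P (S x)"
proof -
  note SD = linear_opD[OF S]
  have B': "hnorm P (S x \<ominus> S y) \<le> B * hnorm P (x \<ominus> y)" if "x \<in> carrier P" "y \<in> carrier P" for x y
    using B[of "x \<ominus> y"] that linear_op_diff[OF S semi_inner_space_axioms semi_inner_space_axioms] by simp
  define M where "M = restrict (\<lambda>A. \<Union>F\<in>A. cl (\<lambda>i. S (F i))) (carrier Pc)"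
  have M: "M (cl F) = cl (\<lambda>i. S (F i))" if "F \<in> cauchy_seqs P" for F
    using cl_image_eq[OF that SD(1) B'] cl_in[OF that] by (simp add: M_def)
  have SC: "(\<lambda>i. S (F i)) \<in> cauchy_seqs P" if "F \<in> cauchy_seqs P" for F
    using cauchy_seq_image[OF that SD(1) B'] by blast
  have "linear_op Pc Pc M"
    unfolding linear_op_def
  proof (intro conjI ballI allI)
    show "M \<in> carrier Pc \<rightarrow> carrier Pc"
      by (auto elim!: completion_cases simp: M SC cl_in)
    fix x y c assume x: "x \<in> carrier Pc"
    show "M (c \<odot>\<^bsub>Pc\<^esub> x) = c \<odot>\<^bsub>Pc\<^esub> M x"
      using x by (elim completion_cases) (simp add: M SC cl_smult cauchy_seq_smult SD cauchy_seq_carrier)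
    assume "y \<in> carrier Pc"
    then show "M (x \<oplus>\<^bsub>Pc\<^esub> y) = M x \<oplus>\<^bsub>Pc\<^esub> M y"
      using x by (elim completion_cases) (simp add: M SC cl_add cauchy_seq_add SD cauchy_seq_carrier)
  qed
  moreover have "hnorm Pc (M x) \<le> B * hnorm Pc x" if x: "x \<in> carrier Pc" for x
  proof -
    obtain F where F: "F \<in> cauchy_seqs P" "x = cl F" using x by (elim completion_cases)
    show ?thesis
      unfolding F(2) M[OF F(1)]
      by (rule LIMSEQ_le[OF hnorm_completion_tendsto[OF SC[OF F(1)]] tendsto_mult_left[OF hnorm_completion_tendsto[OF F(1)]]])
        (use B cauchy_seq_carrier[OF F(1)] in auto)
  qed
  ultimately have "bounded_op Pc Pc M" by (auto simp: bounded_op_def)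
  moreover have "M \<in> extensional (carrier Pc)" by (simp add: M_def)
  moreover have "M (to_completion P x) = to_completion P (S x)" if "x \<in> carrier P" for x
    using that by (simp add: to_completion_eq M cauchy_seq_const)
  ultimately show ?thesis using that by blast
qed

end

section \<open>Distributions on the circle and their Fourier coefficients\<close>

definition expo :: "int \<Rightarrow> real \<Rightarrow> complex" where
  "expo k t = cis (of_int k * t)"

lemma expo_0 [simp]: "expo 0 t = 1" by (simp add: expo_def)

lemma expo_mult: "expo k t * expo l t = expo (k + l) t"
  by (simp add: expo_def cis_mult algebra_simps)

lemma norm_expo [simp]: "cmod (expo k t) = 1" by (simp add: expo_def)

lemma expo_periodic: "expo k (t + 2 * pi) = expo k t"
proof -
  have "expo k (t + 2 * pi) = cis (of_int k * t) * cis (2 * pi * of_int k)"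
    unfolding expo_def cis_mult by (simp add: algebra_simps)
  then show ?thesis by (simp add: expo_def)
qed

lemma expo_has_derivative: "(expo k has_vector_derivative \<i> * of_int k * expo k t) (at t within S)"
  unfolding expo_def has_vector_derivative_def
  by (auto intro!: derivative_eq_intros simp: scaleR_conv_of_real)

lemma continuous_expo [continuous_intros]: "continuous_on S (expo k)"
  unfolding expo_def by (intro continuous_intros)

lemma fourier_coeff_expo: "fourier_coeff \<mu> k = \<mu> (expo (- k))"
  by (simp add: fourier_coeff_def expo_def[abs_def] cis_power_int)

lemma nth_vderiv_0 [simp]: "nth_vderiv 0 g = g"
  by (simp add: nth_vderiv_def)

lemma nth_vderiv_Suc: "nth_vderiv (Suc n) g t = vector_derivative (nth_vderiv n g) (at t)"
  by (simp add: nth_vderiv_def)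

lemma test_function_derivative:
  assumes "\<phi> \<in> test_functions"
  shows "(nth_vderiv n \<phi> has_vector_derivative nth_vderiv (Suc n) \<phi> t) (at t)"
proof -
  have "nth_vderiv n \<phi> differentiable (at t)"
    using assms by (auto simp: test_functions_def differentiable_on_def)
  then show ?thesis by (simp add: nth_vderiv_Suc vector_derivative_works)
qed

lemma test_functionI:
  assumes "\<And>t. \<phi> (t + 2 * pi) = \<phi> t" "D 0 = \<phi>"
    and D: "\<And>n t. (D n has_vector_derivative D (Suc n) t) (at t)"
  shows "\<phi> \<in> test_functions" "nth_vderiv n \<phi> = D n"
proof -
  have eq: "nth_vderiv n \<phi> = D n" for n
  proof (induction n)
    case (Suc n)
    show ?case
      by (rule ext) (use Suc D in \<open>simp add: nth_vderiv_Suc vector_derivative_at\<close>)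
  qed (use assms in simp)
  then show "nth_vderiv n \<phi> = D n" .
  have "D n differentiable_on UNIV" for n
    using D by (auto simp: differentiable_on_def intro: differentiableI_vector)
  then show "\<phi> \<in> test_functions" using assms(1) eq by (simp add: test_functions_def)
qed

lemma test_function_continuous: "\<phi> \<in> test_functions \<Longrightarrow> continuous_on S (nth_vderiv n \<phi>)"
  by (rule continuous_at_imp_continuous_on)
     (auto intro: has_vector_derivative_continuous test_function_derivative)

lemma test_function_periodic:
  assumes "\<phi> \<in> test_functions" shows "nth_vderiv n \<phi> (t + 2 * pi) = nth_vderiv n \<phi> t"
proof (induction n arbitrary: t)
  case (Suc n)
  have "((\<lambda>s. s + 2 * pi) has_vector_derivative 1) (at t)"
    by (auto intro!: derivative_eq_intros simp: has_vector_derivative_def)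
  then have "((\<lambda>s. nth_vderiv n \<phi> (s + 2 * pi)) has_vector_derivative nth_vderiv (Suc n) \<phi> (t + 2 * pi)) (at t)"
    using test_function_derivative[OF assms, of n "t + 2 * pi"]
      vector_diff_chain_at[of "\<lambda>s. s + 2 * pi" 1 t "nth_vderiv n \<phi>" "nth_vderiv (Suc n) \<phi> (t + 2 * pi)"]
    by (auto simp: o_def intro!: derivative_eq_intros)
  then have "(nth_vderiv n \<phi> has_vector_derivative nth_vderiv (Suc n) \<phi> (t + 2 * pi)) (at t)"
    by (simp add: Suc)
  then show ?case
    using test_function_derivative[OF assms, of n t] vector_derivative_unique_at by blast
qed (use assms in \<open>simp add: test_functions_def\<close>)

lemma periodic_reduce:
  fixes g :: "real \<Rightarrow> complex"
  assumes "\<And>t. g (t + 2 * pi) = g t"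
  obtains s where "s \<in> {0..2 * pi}" "g t = g s"
proof -
  interpret periodic_fun_simple g "2 * pi" by unfold_locales (rule assms)
  define n where "n = \<lfloor>t / (2 * pi)\<rfloor>"
  define s where "s = t - of_int n * (2 * pi)"
  have p: "2 * pi > 0" by simp
  have "of_int n \<le> t / (2 * pi)" "t / (2 * pi) < of_int n + 1"
    unfolding n_def by linarith+
  then have "of_int n * (2 * pi) \<le> t" "t < (of_int n + 1) * (2 * pi)"
    unfolding pos_le_divide_eq[OF p] pos_divide_less_eq[OF p] .
  then have "s \<in> {0..2 * pi}" by (simp add: s_def algebra_simps)
  moreover have "g t = g s" using plus_of_int[of s n] by (simp add: s_def)
  ultimately show ?thesis by (rule that)
qed

lemma periodic_bounded:
  fixes g :: "real \<Rightarrow> complex"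
  assumes c: "continuous_on UNIV g" and p: "\<And>t. g (t + 2 * pi) = g t"
  shows "bdd_above (range (\<lambda>t. cmod (g t)))"
proof -
  have "compact ((\<lambda>t. cmod (g t)) ` {0..2 * pi})"
    by (intro compact_continuous_image continuous_intros continuous_on_subset[OF c]) auto
  then have "bdd_above ((\<lambda>t. cmod (g t)) ` {0..2 * pi})"
    by (intro bounded_imp_bdd_above compact_imp_bounded)
  moreover have "range (\<lambda>t. cmod (g t)) \<subseteq> (\<lambda>t. cmod (g t)) ` {0..2 * pi}"
  proof safe
    fix t :: real
    obtain s where "s \<in> {0..2 * pi}" "g t = g s" by (rule periodic_reduce[of g t, OF p])
    then show "cmod (g t) \<in> (\<lambda>t. cmod (g t)) ` {0..2 * pi}" by (metis imageI)
  qed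
  ultimately show ?thesis by (rule bdd_above_mono)
qed

definition supnorm :: "nat \<Rightarrow> (real \<Rightarrow> complex) \<Rightarrow> real" where
  "supnorm n \<phi> = (SUP t. cmod (nth_vderiv n \<phi> t))"

lemma supnorm_upper: "\<phi> \<in> test_functions \<Longrightarrow> cmod (nth_vderiv n \<phi> t) \<le> supnorm n \<phi>"
  unfolding supnorm_def
  by (intro cSUP_upper periodic_bounded test_function_continuous test_function_periodic) auto

lemma supnorm_nonneg: "\<phi> \<in> test_functions \<Longrightarrow> 0 \<le> supnorm n \<phi>"
  using supnorm_upper[of \<phi> n 0] norm_ge_zero order_trans by blast

lemma supnorm_least: "(\<And>t. cmod (nth_vderiv n \<phi> t) \<le> c) \<Longrightarrow> supnorm n \<phi> \<le> c"
  unfolding supnorm_def by (intro cSUP_least) auto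

lemma test_add:
  assumes "\<phi> \<in> test_functions" "\<psi> \<in> test_functions"
  shows "(\<lambda>t. \<phi> t + \<psi> t) \<in> test_functions"
    "nth_vderiv n (\<lambda>t. \<phi> t + \<psi> t) = (\<lambda>t. nth_vderiv n \<phi> t + nth_vderiv n \<psi> t)"
proof -
  have a: "\<And>t. \<phi> (t + 2 * pi) + \<psi> (t + 2 * pi) = \<phi> t + \<psi> t"
    using assms by (simp add: test_functions_def)
  have b: "(\<lambda>t. nth_vderiv 0 \<phi> t + nth_vderiv 0 \<psi> t) = (\<lambda>t. \<phi> t + \<psi> t)" by simp
  have c: "((\<lambda>t. nth_vderiv n \<phi> t + nth_vderiv n \<psi> t) has_vector_derivative
      nth_vderiv (Suc n) \<phi> t + nth_vderiv (Suc n) \<psi> t) (at t)" for n t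
    by (intro has_vector_derivative_add test_function_derivative assms)
  show "(\<lambda>t. \<phi> t + \<psi> t) \<in> test_functions"
    "nth_vderiv n (\<lambda>t. \<phi> t + \<psi> t) = (\<lambda>t. nth_vderiv n \<phi> t + nth_vderiv n \<psi> t)"
    using test_functionI[of "\<lambda>t. \<phi> t + \<psi> t" "\<lambda>n t. nth_vderiv n \<phi> t + nth_vderiv n \<psi> t", OF a b c] by auto
qed

lemma test_cmult:
  assumes "\<phi> \<in> test_functions"
  shows "(\<lambda>t. c * \<phi> t) \<in> test_functions"
    "nth_vderiv n (\<lambda>t. c * \<phi> t) = (\<lambda>t. c * nth_vderiv n \<phi> t)"
proof -
  have a: "\<And>t. c * \<phi> (t + 2 * pi) = c * \<phi> t"
    using assms by (simp add: test_functions_def)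
  have b: "(\<lambda>t. c * nth_vderiv 0 \<phi> t) = (\<lambda>t. c * \<phi> t)" by simp
  have d: "((\<lambda>t. c * nth_vderiv n \<phi> t) has_vector_derivative c * nth_vderiv (Suc n) \<phi> t) (at t)" for n t
    by (intro has_vector_derivative_mult_right test_function_derivative assms)
  show "(\<lambda>t. c * \<phi> t) \<in> test_functions"
    "nth_vderiv n (\<lambda>t. c * \<phi> t) = (\<lambda>t. c * nth_vderiv n \<phi> t)"
    using test_functionI[of "\<lambda>t. c * \<phi> t" "\<lambda>n t. c * nth_vderiv n \<phi> t", OF a b d] by auto
qed

lemma test_expo:
  shows "expo k \<in> test_functions" "nth_vderiv n (expo k) = (\<lambda>t. (\<i> * of_int k) ^ n * expo k t)"
proof -
  have b: "(\<lambda>t. (\<i> * of_int k) ^ 0 * expo k t) = expo k" by simp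
  have d: "((\<lambda>t. (\<i> * of_int k) ^ n * expo k t) has_vector_derivative (\<i> * of_int k) ^ Suc n * expo k t) (at t)" for n t
    using has_vector_derivative_mult_right[OF expo_has_derivative[of k t UNIV], of "(\<i> * of_int k) ^ n"]
    by (simp add: mult_ac)
  show "expo k \<in> test_functions" "nth_vderiv n (expo k) = (\<lambda>t. (\<i> * of_int k) ^ n * expo k t)"
    using test_functionI[of "expo k" "\<lambda>n t. (\<i> * of_int k) ^ n * expo k t", OF expo_periodic b d] by auto
qed

text \<open>Continuity is tested on the exponential of frequency \<open>k\<close>, whose \<open>j\<close>-th derivative has modulus
  \<open>\<bar>k\<bar>\<^sup>j\<close>.\<close>

lemma distribution_coeff_bound:
  assumes "\<mu> \<in> distributions"
  obtains C N where "C > 0" "\<And>k. cmod (fourier_coeff \<mu> k) \<le> C * (1 + \<bar>of_int k\<bar>) ^ N"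
proof -
  obtain C N where CN: "\<And>\<phi>. \<phi> \<in> test_functions \<Longrightarrow> cmod (\<mu> \<phi>) \<le> C * (\<Sum>j\<le>N. supnorm j \<phi>)"
    using assms unfolding distributions_def supnorm_def by blast
  have "cmod (fourier_coeff \<mu> k) \<le> ((\<bar>C\<bar> + 1) * (real N + 1)) * (1 + \<bar>of_int k\<bar>) ^ N" for k
  proof -
    have s: "supnorm j (expo (- k)) \<le> (1 + \<bar>of_int k\<bar>) ^ N" if "j \<le> N" for j
    proof (rule supnorm_least)
      fix t
      have "cmod (nth_vderiv j (expo (- k)) t) = \<bar>of_int k\<bar> ^ j"
        by (simp add: test_expo(2) norm_mult norm_power)
      also have "\<dots> \<le> (1 + \<bar>of_int k\<bar>) ^ j" by (intro power_mono) auto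
      also have "\<dots> \<le> (1 + \<bar>of_int k\<bar>) ^ N" using that by (intro power_increasing) auto
      finally show "cmod (nth_vderiv j (expo (- k)) t) \<le> (1 + \<bar>of_int k\<bar>) ^ N" .
    qed
    have s0: "0 \<le> (\<Sum>j\<le>N. supnorm j (expo (- k)))"
      by (intro sum_nonneg supnorm_nonneg test_expo)
    have "cmod (fourier_coeff \<mu> k) \<le> C * (\<Sum>j\<le>N. supnorm j (expo (- k)))"
      unfolding fourier_coeff_expo by (rule CN[OF test_expo(1)])
    also have "\<dots> \<le> (\<bar>C\<bar> + 1) * (\<Sum>j\<le>N. supnorm j (expo (- k)))"
      using s0 by (intro mult_right_mono) auto
    also have "\<dots> \<le> (\<bar>C\<bar> + 1) * (\<Sum>j\<le>N. (1 + \<bar>of_int k\<bar>) ^ N)"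
      by (intro mult_left_mono sum_mono s) auto
    finally show ?thesis by (simp add: algebra_simps)
  qed
  then show ?thesis by (intro that[of "(\<bar>C\<bar> + 1) * (real N + 1)"]) (auto simp: add_nonneg_pos)
qed

section \<open>Fourier series of test functions\<close>

definition fcoef :: "(real \<Rightarrow> complex) \<Rightarrow> int \<Rightarrow> complex" where
  "fcoef \<phi> k = integral {0..2 * pi} (\<lambda>t. \<phi> t * expo (- k) t) / (2 * pi)"

lemma integral_periodic_derivative:
  fixes g :: "real \<Rightarrow> complex"
  assumes "\<And>t. (g has_vector_derivative g' t) (at t)" "g (2 * pi) = g 0"
  shows "integral {0..2 * pi} g' = 0"
proof -
  have "(g' has_integral g (2 * pi) - g 0) {0..2 * pi}"
    by (intro fundamental_theorem_of_calculus) (auto intro: has_vector_derivative_at_within assms)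
  then show ?thesis using assms(2) by (simp add: integral_unique)
qed

lemma integral_expo: "integral {0..2 * pi} (expo k) = (if k = 0 then 2 * pi else 0)"
proof (cases "k = 0")
  case False
  have "((\<lambda>t. expo k t / (\<i> * of_int k)) has_vector_derivative expo k t) (at t)" for t
    using has_vector_derivative_mult_right[OF expo_has_derivative[of k t UNIV], of "1 / (\<i> * of_int k)"] False
    by simp
  then have "integral {0..2 * pi} (expo k) = 0"
    by (rule integral_periodic_derivative) (use expo_periodic[of k 0] in simp)
  then show ?thesis using False by simp
qed (simp add: expo_def[abs_def] scaleR_conv_of_real)

lemma fcoef_expo: "fcoef (expo k) l = (if k = l then 1 else 0)"
  by (simp add: fcoef_def expo_mult integral_expo)

lemma fcoef_integrable:
  "continuous_on {0..2*pi} \<phi> \<Longrightarrow> (\<lambda>t. \<phi> t * expo k t) integrable_on {0..2 * pi}"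
  by (intro integrable_continuous_interval continuous_intros)

lemma fcoef_add:
  assumes "continuous_on {0..2*pi} \<phi>" "continuous_on {0..2*pi} \<psi>"
  shows "fcoef (\<lambda>t. \<phi> t + \<psi> t) k = fcoef \<phi> k + fcoef \<psi> k"
  using assms by (simp add: fcoef_def distrib_right integral_add fcoef_integrable add_divide_distrib)

lemma fcoef_cmult: "fcoef (\<lambda>t. c * \<phi> t) k = c * fcoef \<phi> k"
  by (simp add: fcoef_def mult.assoc)

lemma fcoef_bound:
  assumes "continuous_on {0..2*pi} \<phi>" "\<And>t. t \<in> {0..2 * pi} \<Longrightarrow> cmod (\<phi> t) \<le> B"
  shows "cmod (fcoef \<phi> k) \<le> B"
proof -
  have "norm (integral {0..2 * pi} (\<lambda>t. \<phi> t * expo (- k) t)) \<le> B * (2 * pi - 0)"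
    by (rule integral_bound) (use assms in \<open>auto simp: norm_mult intro!: continuous_intros\<close>)
  then show ?thesis by (simp add: fcoef_def norm_divide pos_divide_le_eq)
qed

lemma fcoef_deriv:
  assumes "\<phi> \<in> test_functions"
  shows "fcoef (nth_vderiv n \<phi>) k = (\<i> * of_int k) ^ n * fcoef \<phi> k"
proof (induction n)
  case (Suc n)
  define g where "g = nth_vderiv n \<phi>"
  define g' where "g' = nth_vderiv (Suc n) \<phi>"
  have c: "continuous_on {0..2 * pi} g" "continuous_on {0..2 * pi} g'"
    unfolding g_def g'_def by (intro test_function_continuous assms)+
  have "((\<lambda>t. g t * expo (- k) t) has_vector_derivative
      g' t * expo (- k) t + (- \<i> * of_int k) * (g t * expo (- k) t)) (at t)" for t
    using has_vector_derivative_mult[OF test_function_derivative[OF assms, of n t] expo_has_derivative[of "- k" t UNIV]]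
    by (simp add: g_def g'_def algebra_simps)
  then have "integral {0..2 * pi} (\<lambda>t. g' t * expo (- k) t + (- \<i> * of_int k) * (g t * expo (- k) t)) = 0"
    by (rule integral_periodic_derivative)
      (use expo_periodic[of "-k" 0] test_function_periodic[OF assms, of n 0] in \<open>simp add: g_def\<close>)
  then have "integral {0..2 * pi} (\<lambda>t. g' t * expo (- k) t) + (- \<i> * of_int k) * integral {0..2 * pi} (\<lambda>t. g t * expo (- k) t) = 0"
    by (subst (asm) integral_add)
      (use c in \<open>auto intro!: fcoef_integrable integrable_continuous_interval continuous_intros\<close>)
  then have "fcoef g' k = (\<i> * of_int k) * fcoef g k"
    by (simp add: fcoef_def)
  then show ?case using Suc by (simp add: g_def g'_def)
qed simp

text \<open>This is \<open>n\<close>-fold integration by parts; the boundary terms cancel by periodicity.\<close>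

lemma fcoef_decay:
  assumes "\<phi> \<in> test_functions"
  shows "\<bar>of_int k\<bar> ^ n * cmod (fcoef \<phi> k) \<le> supnorm n \<phi>"
proof -
  have "cmod (fcoef (nth_vderiv n \<phi>) k) \<le> supnorm n \<phi>"
    by (intro fcoef_bound test_function_continuous supnorm_upper assms)
  then show ?thesis by (simp add: fcoef_deriv[OF assms] norm_mult norm_power)
qed

text \<open>Orthogonality to all exponentials is stable under multiplication by trigonometric polynomials, and
  these approximate the conjugate of a continuous periodic function by the Stone--Weierstrass theorem.
  Such a function is therefore orthogonal to itself, which is how \<open>orth_zero\<close> follows.\<close>

definition orth :: "(real \<Rightarrow> complex) \<Rightarrow> bool" where
  "orth u \<longleftrightarrow> continuous_on {0..2 * pi} u \<and> (\<forall>k. integral {0..2 * pi} (\<lambda>t. u t * expo k t) = 0)"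

lemma orth_expo: "orth u \<Longrightarrow> orth (\<lambda>t. u t * expo k t)"
  by (auto simp: orth_def mult.assoc expo_mult intro!: continuous_intros)

lemma orth_add: "orth u \<Longrightarrow> orth v \<Longrightarrow> orth (\<lambda>t. u t + v t)"
  by (auto simp: orth_def distrib_right integral_add fcoef_integrable intro!: continuous_intros)

lemma orth_cmult: "orth u \<Longrightarrow> orth (\<lambda>t. c * u t)"
  by (auto simp: orth_def mult.assoc intro!: continuous_intros)

lemma orth_real_polynomial:
  assumes "real_polynomial_function p" "orth u"
  shows "orth (\<lambda>t. u t * of_real (p (cis t)))"
  using assms
proof (induction arbitrary: u rule: real_polynomial_function.induct)
  case (linear f)
  note ou = linear(2)
  interpret bounded_linear f by fact
  have f: "f (cis t) = cos t * f 1 + sin t * f \<i>" for t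
  proof -
    have "cis t = cos t *\<^sub>R 1 + sin t *\<^sub>R \<i>" by (simp add: complex_eq_iff)
    then have "f (cis t) = f (cos t *\<^sub>R 1 + sin t *\<^sub>R \<i>)" by simp
    then show ?thesis by (simp only: add scaleR) simp
  qed
  have cs: "of_real (cos t) = (expo 1 t + expo (-1) t) / 2" "of_real (sin t) = (expo 1 t - expo (-1) t) / (2 * \<i>)" for t
    by (simp_all add: expo_def complex_eq_iff)
  have "u t * of_real (f (cis t)) =
     ((of_real (f 1) / 2 + of_real (f \<i>) / (2 * \<i>)) * (u t * expo 1 t)) +
     ((of_real (f 1) / 2 - of_real (f \<i>) / (2 * \<i>)) * (u t * expo (-1) t))" for t
    unfolding f of_real_add of_real_mult cs by (simp add: field_simps)
  then show ?case
    by (simp only:) (intro orth_add orth_cmult orth_expo ou)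
next
  case (const c)
  then show ?case using orth_cmult[of u "of_real c"] by (simp add: mult.commute)
next
  case (add f g)
  then show ?case using orth_add[OF add(3)[OF add(5)] add(4)[OF add(5)]] by (simp add: distrib_left)
next
  case (mult f g)
  then show ?case using mult(4)[OF mult(3)[OF mult(5)]] by (simp add: mult.assoc)
qed

lemma orth_zero:
  assumes u: "orth u" and c: "continuous_on UNIV u" and p: "\<And>t. u (t + 2 * pi) = u t" and t: "t \<in> {0..2 * pi}"
  shows "u t = 0"
proof -
  define H where "H z = u (Arg2pi z)" for z
  have Hcis: "H (cis s) = u s" if "s \<in> {0..2 * pi}" for s
  proof (cases "s = 2 * pi")
    case True
    have "Arg2pi 1 = 0" by (rule Arg2pi_unique[of 1]) auto
    then show ?thesis using True p[of 0] by (simp add: H_def)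
  next
    case False
    have "Arg2pi (cis s) = s"
      by (rule Arg2pi_unique[of 1]) (use that False in \<open>auto simp: cis_conv_exp\<close>)
    then show ?thesis by (simp add: H_def)
  qed
  have sph: "z \<in> cis ` {0..2 * pi}" if "z \<in> sphere 0 1" for z
  proof -
    have "z = cis (Arg2pi z)" using that Arg2pi_eq[of z] by (simp add: cis_conv_exp mult.commute)
    then show ?thesis using Arg2pi[of z] by (metis atLeastAtMost_iff image_eqI less_imp_le)
  qed
  \<comment> \<open>\<open>u\<close> descends to the circle, since \<open>cis\<close> maps closed subsets of a period to closed sets.\<close>
  have contH: "continuous_on (sphere 0 1) H"
  proof (subst continuous_on_closed_vimage)
    show "closed (sphere (0::complex) 1)" by simp
    show "\<forall>B. closed B \<longrightarrow> closed (H -` B \<inter> sphere 0 1)"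
    proof (intro allI impI)
      fix B :: "complex set" assume B: "closed B"
      have "H -` B \<inter> sphere 0 1 = cis ` (u -` B \<inter> {0..2 * pi})"
      proof safe
        fix z :: complex assume z: "z \<in> sphere 0 1" "H z \<in> B"
        then obtain s where s: "s \<in> {0..2 * pi}" "z = cis s" using sph by blast
        then show "z \<in> cis ` (u -` B \<inter> {0..2 * pi})" using z Hcis by auto
      qed (use Hcis in auto)
      moreover have "closed (u -` B)"
        using continuous_closed_vimage[OF B, of u] c by (simp add: continuous_on_eq_continuous_within)
      then have "compact (u -` B \<inter> {0..2 * pi})"
        by (intro closed_Int_compact compact_Icc)
      then have "compact (cis ` (u -` B \<inter> {0..2 * pi}))"
        by (intro compact_continuous_image continuous_intros)
      ultimately show "closed (H -` B \<inter> sphere 0 1)" using compact_imp_closed by simp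
    qed
  qed
  obtain B where B: "\<And>t. cmod (u t) \<le> B"
    using periodic_bounded[OF c p] unfolding bdd_above_def by auto
  have cu: "continuous_on {0..2 * pi} u" using c continuous_on_subset by blast
  define I where "I = integral {0..2 * pi} (\<lambda>t. (cmod (u t))\<^sup>2)"
  have I_le: "I \<le> (2 * pi * B * 2) * e" if e: "e > 0" for e
  proof -
    obtain p1 where p1: "real_polynomial_function p1" "\<And>z. z \<in> sphere 0 1 \<Longrightarrow> \<bar>Re (H z) - p1 z\<bar> < e"
      by (rule Stone_Weierstrass_real_polynomial_function[of "sphere 0 1" "\<lambda>z. Re (H z)" e])
        (use contH e in \<open>auto intro!: continuous_intros\<close>)
    obtain p2 where p2: "real_polynomial_function p2" "\<And>z. z \<in> sphere 0 1 \<Longrightarrow> \<bar>Im (H z) - p2 z\<bar> < e"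
      by (rule Stone_Weierstrass_real_polynomial_function[of "sphere 0 1" "\<lambda>z. Im (H z)" e])
        (use contH e in \<open>auto intro!: continuous_intros\<close>)
    define q where "q t = complex_of_real (p1 (cis t)) - \<i> * of_real (p2 (cis t))" for t
    have "orth (\<lambda>t. u t * of_real (p1 (cis t)) + (- \<i>) * (u t * of_real (p2 (cis t))))"
      by (intro orth_add orth_cmult orth_real_polynomial u p1 p2)
    then have oq: "orth (\<lambda>t. u t * q t)" by (simp add: q_def algebra_simps)
    then have q0: "integral {0..2 * pi} (\<lambda>t. u t * q t) = 0"
      and cq: "continuous_on {0..2 * pi} (\<lambda>t. u t * q t)"
      unfolding orth_def by (auto dest: spec[of _ 0])
    have ci: "continuous_on {0..2 * pi} (\<lambda>t. u t * cnj (u t))" using cu by (intro continuous_intros)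
    have "complex_of_real I = integral {0..2 * pi} (\<lambda>t. u t * cnj (u t))"
    proof -
      have "complex_of_real I = integral {0..2 * pi} (\<lambda>t. complex_of_real ((cmod (u t))\<^sup>2))"
        unfolding I_def using cu
        by (intro integral_linear[OF _ bounded_linear_of_real, symmetric, unfolded o_def] integrable_continuous_interval continuous_intros)
      then show ?thesis by (simp only: complex_norm_square)
    qed
    also have "\<dots> = integral {0..2 * pi} (\<lambda>t. u t * cnj (u t) - u t * q t)"
      using q0 cq ci by (subst integral_diff) (auto intro: integrable_continuous_interval)
    finally have "cmod (complex_of_real I) = cmod (integral {0..2 * pi} (\<lambda>t. u t * cnj (u t) - u t * q t))" by simp
    also have "\<dots> \<le> (B * (2 * e)) * (2 * pi - 0)"
    proof (rule integral_bound)
      show "continuous_on {0..2 * pi} (\<lambda>t. u t * cnj (u t) - u t * q t)"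
        using ci cq by (intro continuous_on_diff)
      fix s assume s: "s \<in> {0..2 * pi}"
      have "cmod (cnj (u s) - q s) \<le> \<bar>Re (cnj (u s) - q s)\<bar> + \<bar>Im (cnj (u s) - q s)\<bar>"
        by (rule cmod_le)
      also have "\<dots> = \<bar>Re (H (cis s)) - p1 (cis s)\<bar> + \<bar>Im (H (cis s)) - p2 (cis s)\<bar>"
        by (simp add: q_def Hcis[OF s])
      also have "\<dots> \<le> 2 * e" using p1(2)[of "cis s"] p2(2)[of "cis s"] by simp
      finally have "cmod (u s) * cmod (cnj (u s) - q s) \<le> B * (2 * e)"
        using B[of s] order_trans[OF norm_ge_zero B[of s]] by (intro mult_mono) auto
      then show "cmod (u s * cnj (u s) - u s * q s) \<le> B * (2 * e)"
        by (simp flip: norm_mult add: right_diff_distrib)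
    qed auto
    finally show ?thesis by (simp add: mult_ac)
  qed
  have "I \<le> 0"
  proof (rule ccontr)
    assume "\<not> I \<le> 0"
    then have Ipos: "I > 0" by simp
    define A where "A = 2 * pi * B * 2"
    have A: "A \<ge> 0" unfolding A_def using order_trans[OF norm_ge_zero B[of 0]] by simp
    have "0 < I / (2 * (A + 1))" using Ipos A by simp
    from I_le[OF this] have "I \<le> A * (I / (2 * (A + 1)))" unfolding A_def .
    also have "\<dots> \<le> I / 2" using A Ipos by (simp add: field_simps)
    finally show False using Ipos by simp
  qed
  moreover have "I \<ge> 0" unfolding I_def using cu
    by (intro integral_nonneg integrable_continuous_interval continuous_intros) auto
  ultimately have "I = 0" by simp
  then have "(cmod (u t))\<^sup>2 = 0"
    unfolding I_def using cu t
    by (subst (asm) integral_eq_0_iff) (auto intro!: continuous_intros)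
  then show ?thesis by simp
qed

text \<open>The partial sums are ordered so that frequencies \<open>n + 1\<close> and \<open>-(n + 1)\<close> enter together.\<close>

definition fterm :: "(real \<Rightarrow> complex) \<Rightarrow> nat \<Rightarrow> real \<Rightarrow> complex" where
  "fterm \<phi> n t = fcoef \<phi> (int (Suc n)) * expo (int (Suc n)) t + fcoef \<phi> (- int (Suc n)) * expo (- int (Suc n)) t"

definition fsum :: "(real \<Rightarrow> complex) \<Rightarrow> nat \<Rightarrow> real \<Rightarrow> complex" where
  "fsum \<phi> n t = fcoef \<phi> 0 + (\<Sum>i<n. fterm \<phi> i t)"

lemma fterm_bound:
  assumes "\<phi> \<in> test_functions"
  shows "cmod (fterm \<phi> n t) \<le> 2 * supnorm 2 \<phi> * inverse (real (Suc n) ^ 2)"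
proof -
  have f: "cmod (fcoef \<phi> k) \<le> supnorm 2 \<phi> * inverse (real (Suc n) ^ 2)" if "\<bar>k\<bar> = int (Suc n)" for k
  proof -
    have "\<bar>of_int k\<bar> = real (Suc n)" using that by (metis of_int_abs of_int_of_nat_eq)
    then have "real (Suc n) ^ 2 * cmod (fcoef \<phi> k) \<le> supnorm 2 \<phi>"
      using fcoef_decay[OF assms, of k 2] by simp
    then show ?thesis by (simp add: field_simps)
  qed
  have "cmod (fterm \<phi> n t) \<le> cmod (fcoef \<phi> (int (Suc n))) + cmod (fcoef \<phi> (- int (Suc n)))"
    unfolding fterm_def by (rule order.trans[OF norm_triangle_ineq]) (simp add: norm_mult)
  also have "\<dots> \<le> supnorm 2 \<phi> * inverse (real (Suc n) ^ 2) + supnorm 2 \<phi> * inverse (real (Suc n) ^ 2)"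
    by (intro add_mono f) auto
  finally show ?thesis by simp
qed

lemma summable_inverse_Suc_sq: "summable (\<lambda>n. inverse (real (Suc n) ^ 2))"
  using inverse_power_summable[of 2, where 'a = real] summable_Suc_iff[of "\<lambda>n. inverse (real n ^ 2)"] by simp

lemma fsum_uniform:
  assumes "\<phi> \<in> test_functions"
  shows "uniform_limit UNIV (fsum \<phi>) (\<lambda>t. fcoef \<phi> 0 + (\<Sum>i. fterm \<phi> i t)) sequentially"
proof -
  have "uniform_limit UNIV (\<lambda>n t. \<Sum>i<n. fterm \<phi> i t) (\<lambda>t. \<Sum>i. fterm \<phi> i t) sequentially"
    by (rule Weierstrass_m_test[OF fterm_bound[OF assms]])
       (intro summable_mult summable_inverse_Suc_sq)
  then show ?thesis unfolding fsum_def by (intro uniform_limit_intros)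
qed

lemma continuous_fterm: "continuous_on S (fterm \<phi> n)"
  unfolding fterm_def by (intro continuous_intros)

lemma continuous_fsum: "continuous_on S (fsum \<phi> n)"
  unfolding fsum_def by (intro continuous_intros continuous_fterm)

lemma fcoef_fterm: "fcoef (fterm \<phi> n) k = (if \<bar>k\<bar> = int (Suc n) then fcoef \<phi> k else 0)"
proof -
  have "fcoef (fterm \<phi> n) k = fcoef \<phi> (int (Suc n)) * fcoef (expo (int (Suc n))) k
     + fcoef \<phi> (- int (Suc n)) * fcoef (expo (- int (Suc n))) k"
    unfolding fterm_def by (subst fcoef_add) (auto intro!: continuous_intros simp: fcoef_cmult)
  then show ?thesis by (auto simp: fcoef_expo)
qed

lemma fcoef_fsum: "fcoef (fsum \<phi> n) k = (if \<bar>k\<bar> \<le> int n then fcoef \<phi> k else 0)"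
proof (induction n)
  case 0
  have "fcoef (\<lambda>t. fcoef \<phi> 0 * expo 0 t) k = fcoef \<phi> 0 * fcoef (expo 0) k" by (rule fcoef_cmult)
  then show ?case by (simp add: fsum_def fcoef_expo)
next
  case (Suc n)
  have "fsum \<phi> (Suc n) = (\<lambda>t. fsum \<phi> n t + fterm \<phi> n t)" by (simp add: fsum_def fun_eq_iff)
  then have "fcoef (fsum \<phi> (Suc n)) k = fcoef (fsum \<phi> n) k + fcoef (fterm \<phi> n) k"
    by (simp add: fcoef_add continuous_fsum continuous_fterm)
  then show ?case using Suc by (auto simp: fcoef_fterm)
qed

text \<open>The series converges uniformly to a continuous function with the same Fourier coefficients, and the
  difference vanishes because all its Fourier coefficients do.\<close>

lemma fourier_series:
  assumes \<phi>: "\<phi> \<in> test_functions"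
  shows "\<phi> t = fcoef \<phi> 0 + (\<Sum>i. fterm \<phi> i t)"
proof -
  define g where "g t = fcoef \<phi> 0 + (\<Sum>i. fterm \<phi> i t)" for t
  have ul: "uniform_limit UNIV (fsum \<phi>) g sequentially"
    using fsum_uniform[OF \<phi>] by (simp add: g_def[abs_def])
  have cg: "continuous_on UNIV g"
    by (rule uniform_limit_theorem[OF always_eventually ul]) (auto intro: continuous_fsum)
  have pg: "g (t + 2 * pi) = g t" for t
    by (simp add: g_def fterm_def expo_periodic)
  have c\<phi>: "continuous_on S \<phi>" for S using test_function_continuous[OF \<phi>, of S 0] by simp
  have p\<phi>: "\<phi> (t + 2 * pi) = \<phi> t" for t using \<phi> by (simp add: test_functions_def)
  have fg: "fcoef g k = fcoef \<phi> k" for k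
  proof -
    have ul': "uniform_limit {0..2 * pi} (\<lambda>n t. fsum \<phi> n t * expo (- k) t) (\<lambda>t. g t * expo (- k) t) sequentially"
      using uniform_limit_on_subset[OF ul, of "{0..2 * pi}"]
      by (intro uniform_lim_mult uniform_limit_const)
        (auto intro!: compact_imp_bounded compact_continuous_image continuous_on_subset[OF cg] continuous_intros)
    obtain I J where IJ: "\<And>n. ((\<lambda>t. fsum \<phi> n t * expo (- k) t) has_integral I n) {0..2 * pi}"
      "((\<lambda>t. g t * expo (- k) t) has_integral J) {0..2 * pi}" "I \<longlonglongrightarrow> J"
      by (rule uniform_limit_integral[OF ul']) (auto intro!: continuous_intros continuous_fsum)
    have "I n = 2 * pi * fcoef (fsum \<phi> n) k" for n using IJ(1)[of n] by (simp add: fcoef_def integral_unique)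
    then have "eventually (\<lambda>n. I n = 2 * pi * fcoef \<phi> k) sequentially"
      by (intro eventually_sequentiallyI[of "nat \<bar>k\<bar>"]) (auto simp: fcoef_fsum)
    then have "I \<longlonglongrightarrow> 2 * pi * fcoef \<phi> k" by (rule tendsto_eventually)
    then have "J = 2 * pi * fcoef \<phi> k" using IJ(3) LIMSEQ_unique by blast
    then show ?thesis using IJ(2) by (simp add: fcoef_def integral_unique)
  qed
  define u where "u t = \<phi> t + (-1) * g t" for t
  have "orth u"
    unfolding orth_def
  proof (intro conjI allI)
    show "continuous_on {0..2 * pi} u" unfolding u_def
      by (intro continuous_intros c\<phi> continuous_on_subset[OF cg]) auto
    fix k
    have "fcoef u (- k) = fcoef \<phi> (-k) + (-1) * fcoef g (-k)"
      unfolding u_def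
      by (subst fcoef_add) (auto intro!: continuous_intros c\<phi> continuous_on_subset[OF cg] simp: fcoef_cmult[of "-1", simplified])
    then have "fcoef u (- k) = 0" using fg[of "-k"] by simp
    then show "integral {0..2 * pi} (\<lambda>t. u t * expo k t) = 0" by (simp add: fcoef_def)
  qed
  have cu: "continuous_on UNIV u" unfolding u_def by (intro continuous_intros c\<phi> cg)
  have pu: "u (t + 2 * pi) = u t" for t by (simp add: u_def p\<phi> pg)
  obtain s where "s \<in> {0..2 * pi}" "u t = u s" by (rule periodic_reduce[of u t, OF pu])
  then have "u t = 0" using orth_zero[OF \<open>orth u\<close> cu pu] by simp
  then have "\<phi> t = g t" by (simp add: u_def)
  then show ?thesis by (simp add: g_def)
qed

lemma test_fterm: "fterm \<phi> n \<in> test_functions"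
  unfolding fterm_def by (intro test_add test_cmult test_expo)

lemma test_fsum:
  shows "fsum \<phi> n \<in> test_functions"
    "nth_vderiv j (fsum \<phi> n) t = (if j = 0 then fcoef \<phi> 0 else 0) + (\<Sum>i<n. nth_vderiv j (fterm \<phi> i) t)"
proof -
  have "fsum \<phi> n \<in> test_functions \<and>
    nth_vderiv j (fsum \<phi> n) t = (if j = 0 then fcoef \<phi> 0 else 0) + (\<Sum>i<n. nth_vderiv j (fterm \<phi> i) t)"
  proof (induction n)
    case 0
    have "fsum \<phi> 0 = (\<lambda>t. fcoef \<phi> 0 * expo 0 t)" by (simp add: fsum_def fun_eq_iff)
    then show ?case using test_cmult[OF test_expo(1)[of 0]] by (simp add: test_expo)
  next
    case (Suc n)
    have "fsum \<phi> (Suc n) = (\<lambda>t. fsum \<phi> n t + fterm \<phi> n t)" by (simp add: fsum_def fun_eq_iff)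
    then show ?case using test_add[OF conjunct1[OF Suc] test_fterm[of \<phi> n]] Suc by simp
  qed
  then show "fsum \<phi> n \<in> test_functions"
    "nth_vderiv j (fsum \<phi> n) t = (if j = 0 then fcoef \<phi> 0 else 0) + (\<Sum>i<n. nth_vderiv j (fterm \<phi> i) t)" by auto
qed

lemma nth_vderiv_fterm:
  assumes "\<phi> \<in> test_functions"
  shows "nth_vderiv j (fterm \<phi> n) = fterm (nth_vderiv j \<phi>) n"
proof -
  have "nth_vderiv j (fterm \<phi> n) =
     (\<lambda>t. nth_vderiv j (\<lambda>t. fcoef \<phi> (int (Suc n)) * expo (int (Suc n)) t) t
        + nth_vderiv j (\<lambda>t. fcoef \<phi> (- int (Suc n)) * expo (- int (Suc n)) t) t)"
    unfolding fterm_def[abs_def]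
    by (rule test_add(2)[OF test_cmult(1)[OF test_expo(1)] test_cmult(1)[OF test_expo(1)]])
  then show ?thesis
    unfolding test_cmult(2)[OF test_expo(1)] test_expo(2) fterm_def[abs_def] fcoef_deriv[OF assms]
    by (simp only: mult_ac)
qed

lemma test_deriv:
  assumes "\<phi> \<in> test_functions" shows "nth_vderiv j \<phi> \<in> test_functions"
proof (rule test_functionI)
  show "nth_vderiv j \<phi> (t + 2 * pi) = nth_vderiv j \<phi> t" for t by (rule test_function_periodic[OF assms])
  show "((\<lambda>n. nth_vderiv (j + n) \<phi>) n has_vector_derivative (\<lambda>n. nth_vderiv (j + n) \<phi>) (Suc n) t) (at t)" for n t
    using test_function_derivative[OF assms, of "j + n" t] by simp
qed simp

text \<open>The \<open>j\<close>-th derivative of a partial sum of the Fourier series of \<open>\<phi>\<close> is the partial sum for the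
  \<open>j\<close>-th derivative of \<open>\<phi>\<close>. Uniform convergence for all test functions is therefore already
  convergence in every seminorm, that is, convergence seen by distributions.\<close>

lemma fsum_tail:
  assumes "\<phi> \<in> test_functions"
  shows "(\<lambda>n. supnorm j (\<lambda>t. \<phi> t + (-1) * fsum \<phi> n t)) \<longlonglongrightarrow> 0"
proof -
  define \<psi> where "\<psi> = nth_vderiv j \<phi>"
  have \<psi>: "\<psi> \<in> test_functions" unfolding \<psi>_def by (rule test_deriv[OF assms])
  have ul: "uniform_limit UNIV (fsum \<psi>) \<psi> sequentially"
    using fsum_uniform[OF \<psi>] fourier_series[OF \<psi>, symmetric] by simp
  have nv: "nth_vderiv j (\<lambda>t. \<phi> t + (-1) * fsum \<phi> n t) t = \<psi> t - fsum \<psi> n t" for n t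
  proof -
    have "fcoef \<psi> 0 = (if j = 0 then fcoef \<phi> 0 else 0)"
      unfolding \<psi>_def by (simp add: fcoef_deriv[OF assms])
    then have "nth_vderiv j (fsum \<phi> n) t = fsum \<psi> n t"
      by (simp add: test_fsum(2) nth_vderiv_fterm[OF assms] fsum_def \<psi>_def)
    moreover have "nth_vderiv j (\<lambda>t. \<phi> t + (-1) * fsum \<phi> n t) t = nth_vderiv j \<phi> t + (-1) * nth_vderiv j (fsum \<phi> n) t"
      by (simp only: test_add(2)[OF assms test_cmult(1)[OF test_fsum(1)]] test_cmult(2)[OF test_fsum(1)])
    ultimately show ?thesis by (simp add: \<psi>_def)
  qed
  show ?thesis
  proof (rule LIMSEQ_I)
    fix e :: real assume e: "e > 0"
    have "\<forall>\<^sub>F n in sequentially. \<forall>t\<in>UNIV. dist (fsum \<psi> n t) (\<psi> t) < e/2"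
      using ul e by (intro uniform_limitD) auto
    then obtain N where N: "\<And>n t. n \<ge> N \<Longrightarrow> dist (fsum \<psi> n t) (\<psi> t) < e/2"
      by (auto simp: eventually_sequentially)
    have "norm (supnorm j (\<lambda>t. \<phi> t + (-1) * fsum \<phi> n t) - 0) < e" if "n \<ge> N" for n
    proof -
      have "supnorm j (\<lambda>t. \<phi> t + (-1) * fsum \<phi> n t) \<le> e/2"
      proof (rule supnorm_least)
        show "cmod (nth_vderiv j (\<lambda>t. \<phi> t + (-1) * fsum \<phi> n t) t) \<le> e/2" for t
          unfolding nv using N[OF that, of t] by (simp add: dist_norm norm_minus_commute)
      qed
      moreover have "0 \<le> supnorm j (\<lambda>t. \<phi> t + (-1) * fsum \<phi> n t)"
        by (intro supnorm_nonneg test_add assms test_cmult test_fsum)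
      ultimately show ?thesis using e by simp
    qed
    then show "\<exists>N. \<forall>n\<ge>N. norm (supnorm j (\<lambda>t. \<phi> t + (-1) * fsum \<phi> n t) - 0) < e" by blast
  qed
qed

lemma distributionD:
  assumes "\<mu> \<in> distributions"
  shows "\<lbrakk>\<phi> \<in> test_functions; \<psi> \<in> test_functions\<rbrakk> \<Longrightarrow> \<mu> (\<lambda>t. \<phi> t + \<psi> t) = \<mu> \<phi> + \<mu> \<psi>"
    "\<phi> \<in> test_functions \<Longrightarrow> \<mu> (\<lambda>t. c * \<phi> t) = c * \<mu> \<phi>"
    "\<phi> \<notin> test_functions \<Longrightarrow> \<mu> \<phi> = 0"
  using assms unfolding distributions_def by blast+

lemma distribution_fsum_tendsto:
  assumes \<mu>: "\<mu> \<in> distributions" and \<phi>: "\<phi> \<in> test_functions"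
  shows "(\<lambda>n. \<mu> (fsum \<phi> n)) \<longlonglongrightarrow> \<mu> \<phi>"
proof -
  obtain C N where CN: "\<And>\<phi>. \<phi> \<in> test_functions \<Longrightarrow> cmod (\<mu> \<phi>) \<le> C * (\<Sum>j\<le>N. supnorm j \<phi>)"
    using \<mu> unfolding distributions_def supnorm_def by blast
  have t: "(\<lambda>t. \<phi> t + (-1) * fsum \<phi> n t) \<in> test_functions" for n
    by (intro test_add \<phi> test_cmult test_fsum)
  have "(\<lambda>n. \<mu> (\<lambda>t. \<phi> t + (-1) * fsum \<phi> n t)) \<longlonglongrightarrow> 0"
  proof (rule Lim_null_comparison)
    show "\<forall>\<^sub>F n in sequentially. norm (\<mu> (\<lambda>t. \<phi> t + (-1) * fsum \<phi> n t))
       \<le> C * (\<Sum>j\<le>N. supnorm j (\<lambda>t. \<phi> t + (-1) * fsum \<phi> n t))"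
      using CN[OF t] by simp
    show "(\<lambda>n. C * (\<Sum>j\<le>N. supnorm j (\<lambda>t. \<phi> t + (-1) * fsum \<phi> n t))) \<longlonglongrightarrow> 0"
      by (intro tendsto_mult_right_zero tendsto_null_sum fsum_tail \<phi>)
  qed
  moreover have "\<mu> (\<lambda>t. \<phi> t + (-1) * fsum \<phi> n t) = \<mu> \<phi> - \<mu> (fsum \<phi> n)" for n
    using distributionD(1)[OF \<mu> \<phi> test_cmult(1)[OF test_fsum(1), of "-1"]]
      distributionD(2)[OF \<mu> test_fsum(1), of "-1"] by simp
  ultimately have "(\<lambda>n. \<mu> \<phi> - (\<mu> \<phi> - \<mu> (fsum \<phi> n))) \<longlonglongrightarrow> \<mu> \<phi> - 0"
    by (intro tendsto_diff tendsto_const) simp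
  then show ?thesis by simp
qed

lemma distribution_fsum:
  assumes \<mu>: "\<mu> \<in> distributions"
  shows "\<mu> (fsum \<phi> n) = fcoef \<phi> 0 * fourier_coeff \<mu> 0 +
    (\<Sum>i<n. fcoef \<phi> (int (Suc i)) * fourier_coeff \<mu> (- int (Suc i)) + fcoef \<phi> (- int (Suc i)) * fourier_coeff \<mu> (int (Suc i)))"
proof (induction n)
  case 0
  have "fsum \<phi> 0 = (\<lambda>t. fcoef \<phi> 0 * expo 0 t)" by (simp add: fsum_def fun_eq_iff)
  then show ?case using distributionD(2)[OF \<mu> test_expo(1)[of 0]] by (simp add: fourier_coeff_expo)
next
  case (Suc n)
  have "fsum \<phi> (Suc n) = (\<lambda>t. fsum \<phi> n t + fterm \<phi> n t)" by (simp add: fsum_def fun_eq_iff)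
  moreover have "\<mu> (fterm \<phi> n) = fcoef \<phi> (int (Suc n)) * fourier_coeff \<mu> (- int (Suc n)) + fcoef \<phi> (- int (Suc n)) * fourier_coeff \<mu> (int (Suc n))"
    unfolding fterm_def[abs_def] fourier_coeff_expo minus_minus
      distributionD(1)[OF \<mu> test_cmult(1)[OF test_expo(1)] test_cmult(1)[OF test_expo(1)]]
      distributionD(2)[OF \<mu> test_expo(1)] ..
  ultimately show ?case using Suc distributionD(1)[OF \<mu> test_fsum(1) test_fterm] by simp
qed

theorem distribution_eqI:
  assumes "\<mu> \<in> distributions" "\<nu> \<in> distributions" "\<And>k. fourier_coeff \<mu> k = fourier_coeff \<nu> k"
  shows "\<mu> = \<nu>"
proof
  fix \<phi>
  show "\<mu> \<phi> = \<nu> \<phi>"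
  proof (cases "\<phi> \<in> test_functions")
    case True
    have "\<mu> (fsum \<phi> n) = \<nu> (fsum \<phi> n)" for n
      unfolding distribution_fsum[OF assms(1)] distribution_fsum[OF assms(2)] assms(3) ..
    then show ?thesis
      using distribution_fsum_tendsto[OF assms(1) True] distribution_fsum_tendsto[OF assms(2) True]
      by (simp add: LIMSEQ_unique)
  qed (simp add: distributionD(3)[OF assms(1)] distributionD(3)[OF assms(2)])
qed

text \<open>The distribution pairs the Fourier coefficient of a test function at \<open>k\<close> with \<open>c (- k)\<close>. If \<open>c\<close> grows
  like the \<open>N\<close>-th power then \<open>N + 2\<close> derivatives of the test function make the series converge and
  bound its sum.\<close>

theorem distribution_exists:
  assumes C: "\<And>k. cmod (c k) \<le> C * (1 + \<bar>of_int k\<bar>) ^ N"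
  obtains \<mu> where "\<mu> \<in> distributions" "\<And>k. fourier_coeff \<mu> k = c k"
proof -
  have C0: "C \<ge> 0" using C[of 0] by (auto intro: order_trans[OF norm_ge_zero])
  define s where "s \<phi> i = fcoef \<phi> (int (Suc i)) * c (- int (Suc i)) + fcoef \<phi> (- int (Suc i)) * c (int (Suc i))" for \<phi> i
  define \<mu> where "\<mu> \<phi> = (if \<phi> \<in> test_functions then fcoef \<phi> 0 * c 0 + (\<Sum>i. s \<phi> i) else 0)" for \<phi>
  define A where "A = C * 2 ^ N * 2"
  have A0: "A \<ge> 0" using C0 by (simp add: A_def)
  have sb: "cmod (s \<phi> i) \<le> A * supnorm (N + 2) \<phi> * inverse (real (Suc i) ^ 2)"
    if \<phi>: "\<phi> \<in> test_functions" for \<phi> i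
  proof -
    have f: "cmod (fcoef \<phi> k * c l) \<le> C * 2 ^ N * supnorm (N + 2) \<phi> * inverse (real (Suc i) ^ 2)"
      if k: "\<bar>k\<bar> = int (Suc i)" "\<bar>l\<bar> = int (Suc i)" for k l
    proof -
      have kk: "\<bar>of_int k\<bar> = real (Suc i)" "\<bar>of_int l\<bar> = real (Suc i)"
        using k by (metis of_int_abs of_int_of_nat_eq)+
      define x where "x = real (Suc i)"
      have x: "x \<ge> 1" by (simp add: x_def)
      have "x ^ (N + 2) * cmod (fcoef \<phi> k) \<le> supnorm (N + 2) \<phi>"
        using fcoef_decay[OF \<phi>, of k "N + 2"] kk by (simp add: x_def)
      then have f1: "x ^ N * cmod (fcoef \<phi> k) \<le> supnorm (N + 2) \<phi> * inverse (x ^ 2)"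
        using x by (simp add: field_simps power2_eq_square)
      have "cmod (c l) \<le> C * (1 + x) ^ N" using C[of l] kk by (simp add: x_def)
      also have "(1 + x) ^ N \<le> (2 * x) ^ N" using x by (intro power_mono) auto
      finally have f2: "cmod (c l) \<le> C * 2 ^ N * x ^ N" using C0 by (simp add: power_mult_distrib mult_left_mono mult.assoc)
      have "cmod (fcoef \<phi> k * c l) \<le> cmod (fcoef \<phi> k) * (C * 2 ^ N * x ^ N)"
        using f2 by (simp add: norm_mult mult_left_mono)
      also have "\<dots> = C * 2 ^ N * (x ^ N * cmod (fcoef \<phi> k))" by (simp add: mult_ac)
      also have "\<dots> \<le> C * 2 ^ N * (supnorm (N + 2) \<phi> * inverse (x ^ 2))"
        using f1 C0 by (intro mult_left_mono) auto
      finally show ?thesis by (simp add: x_def mult_ac)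
    qed
    have "cmod (s \<phi> i) \<le> C * 2 ^ N * supnorm (N + 2) \<phi> * inverse (real (Suc i) ^ 2) + C * 2 ^ N * supnorm (N + 2) \<phi> * inverse (real (Suc i) ^ 2)"
      unfolding s_def by (rule order.trans[OF norm_triangle_ineq]) (intro add_mono f; simp)
    then show ?thesis by (simp add: A_def mult_ac)
  qed
  have summ: "summable (\<lambda>i. B * inverse (real (Suc i) ^ 2))" for B :: real
    by (intro summable_mult summable_inverse_Suc_sq)
  have ssum: "summable (s \<phi>)" if "\<phi> \<in> test_functions" for \<phi>
    by (rule summable_comparison_test'[OF summ]) (rule sb[OF that])
  define Z where "Z = (\<Sum>i. inverse (real (Suc i) ^ 2))"
  have Z0: "Z \<ge> 0" unfolding Z_def by (intro suminf_nonneg summable_inverse_Suc_sq) simp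
  have c\<phi>: "continuous_on {0..2 * pi} \<phi>" if "\<phi> \<in> test_functions" for \<phi>
    using test_function_continuous[OF that, of _ 0] by simp
  have bound: "cmod (\<mu> \<phi>) \<le> (C + A * Z) * (\<Sum>j\<le>N + 2. supnorm j \<phi>)" if \<phi>: "\<phi> \<in> test_functions" for \<phi>
  proof -
    have a: "supnorm j \<phi> \<le> (\<Sum>j\<le>N + 2. supnorm j \<phi>)" if "j \<le> N + 2" for j
      using that by (intro member_le_sum supnorm_nonneg \<phi>) auto
    have "cmod (\<Sum>i. s \<phi> i) \<le> (\<Sum>i. A * supnorm (N + 2) \<phi> * inverse (real (Suc i) ^ 2))"
      by (rule norm_suminf_le[OF sb[OF \<phi>] summ])
    also have "\<dots> = A * Z * supnorm (N + 2) \<phi>"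
      unfolding Z_def by (subst suminf_mult[OF summable_inverse_Suc_sq]) (simp add: mult_ac)
    also have "\<dots> \<le> A * Z * (\<Sum>j\<le>N + 2. supnorm j \<phi>)"
      using A0 Z0 by (intro mult_left_mono a) auto
    finally have 1: "cmod (\<Sum>i. s \<phi> i) \<le> A * Z * (\<Sum>j\<le>N + 2. supnorm j \<phi>)" .
    have "cmod (fcoef \<phi> 0) \<le> supnorm 0 \<phi>" using fcoef_decay[OF \<phi>, of 0 0] by simp
    then have "cmod (fcoef \<phi> 0 * c 0) \<le> supnorm 0 \<phi> * C"
      using C[of 0] supnorm_nonneg[OF \<phi>] unfolding norm_mult by (intro mult_mono) auto
    also have "\<dots> \<le> C * (\<Sum>j\<le>N + 2. supnorm j \<phi>)"
      using a[of 0] C0 by (simp add: mult.commute mult_left_mono)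
    finally have "cmod (fcoef \<phi> 0 * c 0) + cmod (\<Sum>i. s \<phi> i) \<le> (C + A * Z) * (\<Sum>j\<le>N + 2. supnorm j \<phi>)"
      using 1 by (simp add: distrib_right)
    then show ?thesis using \<phi> norm_triangle_ineq[of "fcoef \<phi> 0 * c 0" "\<Sum>i. s \<phi> i"] by (simp add: \<mu>_def)
  qed
  have "\<mu> \<in> distributions"
    unfolding distributions_def mem_Collect_eq
  proof (intro conjI ballI allI impI)
    fix \<phi> \<psi> assume t: "\<phi> \<in> test_functions" "\<psi> \<in> test_functions"
    have f: "fcoef (\<lambda>t. \<phi> t + \<psi> t) k = fcoef \<phi> k + fcoef \<psi> k" for k
      using t by (intro fcoef_add c\<phi>)
    have "s (\<lambda>t. \<phi> t + \<psi> t) = (\<lambda>i. s \<phi> i + s \<psi> i)"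
      by (simp add: fun_eq_iff s_def f algebra_simps)
    then show "\<mu> (\<lambda>t. \<phi> t + \<psi> t) = \<mu> \<phi> + \<mu> \<psi>"
      using t by (simp add: \<mu>_def test_add f suminf_add[OF ssum ssum, symmetric] algebra_simps)
  next
    fix d \<phi> assume t: "\<phi> \<in> test_functions"
    have "s (\<lambda>t. d * \<phi> t) = (\<lambda>i. d * s \<phi> i)"
      by (simp add: fun_eq_iff s_def fcoef_cmult algebra_simps)
    then show "\<mu> (\<lambda>t. d * \<phi> t) = d * \<mu> \<phi>"
      using t by (simp add: \<mu>_def test_cmult fcoef_cmult suminf_mult[OF ssum] algebra_simps)
  next
    show "\<exists>C N. \<forall>\<phi>\<in>test_functions. cmod (\<mu> \<phi>) \<le> C * (\<Sum>j\<le>N. SUP t. cmod (nth_vderiv j \<phi> t))"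
      using bound unfolding supnorm_def by blast
  qed (simp add: \<mu>_def)
  moreover have "fourier_coeff \<mu> k = c k" for k
  proof (cases "k = 0")
    case True
    have "s (expo 0) = (\<lambda>i. 0)" by (simp add: fun_eq_iff s_def fcoef_expo)
    then show ?thesis using True by (simp add: fourier_coeff_expo \<mu>_def test_expo fcoef_expo)
  next
    case False
    define n where "n = nat \<bar>k\<bar> - 1"
    have n: "int (Suc n) = \<bar>k\<bar>" using False by (simp add: n_def)
    have "s (expo (- k)) i = (if i = n then c k else 0)" for i
    proof (cases "i = n")
      case True
      show ?thesis
      proof (cases "k > 0")
        case kp: True
        then have k: "int (Suc n) = k" using n by simp
        show ?thesis using True False unfolding s_def True k by (simp add: fcoef_expo)
      next
        case kn: False
        then have k: "int (Suc n) = - k" using n by simp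
        show ?thesis using True False unfolding s_def True k by (simp add: fcoef_expo)
      qed
    next
      case False
      then have "- k \<noteq> int (Suc i)" "- k \<noteq> - int (Suc i)" using n by auto
      then show ?thesis using False unfolding s_def fcoef_expo by (simp only: if_False mult_zero_left add_0)
    qed
    then have "s (expo (- k)) = (\<lambda>i. if i = n then c k else 0)" by (rule ext)
    then have "(\<Sum>i. s (expo (- k)) i) = c k"
      using suminf_finite[of "{n}" "s (expo (- k))"] by simp
    then show ?thesis using False by (simp add: fourier_coeff_expo \<mu>_def test_expo fcoef_expo)
  qed
  ultimately show ?thesis using that by blast
qed

section \<open>Dominated double series\<close>

text \<open>Partial sums over squares are the ones that truncating a power series produces in a sesquilinear form.\<close>

definition sqsum :: "(nat \<Rightarrow> nat \<Rightarrow> 'a::comm_monoid_add) \<Rightarrow> nat \<Rightarrow> 'a" where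
  "sqsum t N = (\<Sum>k<N. \<Sum>l<N. t k l)"

lemma sqsum_Suc: "sqsum t (Suc N) = sqsum t N + ((\<Sum>k<N. t k N) + (\<Sum>l<Suc N. t N l))"
  by (simp add: sqsum_def sum.distrib add_ac)

lemma sqsum_product: "sqsum (\<lambda>k l. u k * v l) N = (\<Sum>k<N. u k) * (\<Sum>l<N. (v l :: real))"
  by (simp add: sqsum_def sum_product)

lemma sqsum_add: "sqsum (\<lambda>k l. s k l + t k l) N = sqsum s N + sqsum t N"
  by (simp add: sqsum_def sum.distrib)

lemma sqsum_cmult: "sqsum (\<lambda>k l. c * t k l) N = (c :: complex) * sqsum t N"
  by (simp add: sqsum_def sum_distrib_left)

text \<open>Passing from one square to the next adds an L-shaped border. The borders are dominated by those of the
  product series of \<open>u\<close> with itself, which telescope to a convergent series, so the Weierstrass test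
  applies.\<close>

lemma dominated_sqsum_uniform:
  fixes t :: "'x \<Rightarrow> nat \<Rightarrow> nat \<Rightarrow> complex" and u :: "nat \<Rightarrow> real"
  assumes t: "\<And>x k l. x \<in> Y \<Longrightarrow> cmod (t x k l) \<le> C * (u k * u l)" and u: "summable u"
  obtains h where "uniform_limit Y (\<lambda>N x. sqsum (t x) N) h sequentially"
proof -
  define b where "b n x = (\<Sum>k<n. t x k n) + (\<Sum>l<Suc n. t x n l)" for n x
  define w where "w k l = C * (u k * u l)" for k l
  define M where "M n = sqsum w (Suc n) - sqsum w n" for n
  have eq: "sqsum (t x) N = (\<Sum>n<N. b n x)" for N x
    by (induction N) (simp add: sqsum_def, simp add: sqsum_Suc b_def)
  have sq: "sqsum w N = C * ((\<Sum>k<N. u k) * (\<Sum>k<N. u k))" for N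
    unfolding w_def sqsum_product[symmetric] by (simp add: sqsum_def sum_distrib_left)
  have "(\<lambda>N. sqsum w N) \<longlonglongrightarrow> C * ((\<Sum>k. u k) * (\<Sum>k. u k))"
    unfolding sq by (intro tendsto_intros summable_LIMSEQ u)
  then have M: "summable M" unfolding M_def by (rule telescope_summable)
  have "norm (b n x) \<le> M n" if x: "x \<in> Y" for n x
  proof -
    have "norm (b n x) \<le> (\<Sum>k<n. norm (t x k n)) + (\<Sum>l<Suc n. norm (t x n l))"
      unfolding b_def by (intro order.trans[OF norm_triangle_ineq] add_mono norm_sum)
    also have "\<dots> \<le> (\<Sum>k<n. w k n) + (\<Sum>l<Suc n. w n l)"
      unfolding w_def using t[OF x] by (intro add_mono sum_mono)
    also have "\<dots> = M n" by (simp add: M_def sqsum_Suc)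
    finally show ?thesis .
  qed
  then have "uniform_limit Y (\<lambda>N x. \<Sum>n<N. b n x) (\<lambda>x. \<Sum>n. b n x) sequentially"
    using M by (intro Weierstrass_m_test)
  then show ?thesis using that by (simp add: eq)
qed

lemma dominated_sqsum_convergent:
  assumes "\<And>k l. cmod (t k l) \<le> C * (u k * u l)" "summable (u :: nat \<Rightarrow> real)"
  shows "convergent (sqsum t)"
proof -
  obtain h where "uniform_limit {()} (\<lambda>N x. sqsum t N) h sequentially"
    using dominated_sqsum_uniform[of "{()}" "\<lambda>x. t" C u] assms by blast
  then have "(\<lambda>N. sqsum t N) \<longlonglongrightarrow> h ()" by (rule tendsto_uniform_limitI) simp
  then show ?thesis by (auto simp: convergent_def)
qed

lemma dominated_sqsum_swap:
  fixes t :: "real \<Rightarrow> nat \<Rightarrow> nat \<Rightarrow> complex" and u :: "nat \<Rightarrow> real"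
  assumes t: "\<And>r k l. r \<in> {0<..<1} \<Longrightarrow> cmod (t r k l) \<le> C * (u k * u l)" and u: "summable u"
    and I: "\<And>r. r \<in> {0<..<1} \<Longrightarrow> sqsum (t r) \<longlonglongrightarrow> I r"
    and lim: "\<And>k l. ((\<lambda>r. t r k l) \<longlongrightarrow> t1 k l) (at_left 1)" and L: "sqsum t1 \<longlonglongrightarrow> L"
  shows "(I \<longlongrightarrow> L) (at_left 1)"
proof -
  obtain h where h: "uniform_limit {0<..<1} (\<lambda>N r. sqsum (t r) N) h sequentially"
    using dominated_sqsum_uniform[of "{0<..<1}" t C u] t u by blast
  have hI: "h r = I r" if "r \<in> {0<..<1}" for r
    using tendsto_uniform_limitI[OF h that] I[OF that] by (rule LIMSEQ_unique)
  have ev: "\<forall>\<^sub>F r in at_left (1::real). r \<in> {0<..<1}"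
    using eventually_at_left_real[of 0 "1::real"] by simp
  have "(h \<longlongrightarrow> L) (at_left 1)"
  proof (rule swap_uniform_limit'[OF _ L h ev])
    show "\<forall>\<^sub>F N in sequentially. ((\<lambda>r. sqsum (t r) N) \<longlongrightarrow> sqsum t1 N) (at_left 1)"
      unfolding sqsum_def by (intro always_eventually allI tendsto_sum lim)
  qed simp
  then show ?thesis
    by (rule Lim_transform_eventually) (use ev hI in \<open>auto elim!: eventually_mono\<close>)
qed

section \<open>Rapidly decaying coefficients\<close>

definition rapid :: "(nat \<Rightarrow> complex) \<Rightarrow> bool" where
  "rapid a \<longleftrightarrow> (\<forall>n. \<exists>C. \<forall>k. cmod (a k) * (1 + real k) ^ n \<le> C)"

lemma rapid_summable:
  assumes "rapid a" shows "summable (\<lambda>k. cmod (a k) * (1 + real k) ^ n)"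
proof -
  obtain C where C: "\<And>k. cmod (a k) * (1 + real k) ^ (n + 2) \<le> C" using assms unfolding rapid_def by blast
  show ?thesis
  proof (rule summable_comparison_test'[OF summable_mult[OF summable_inverse_Suc_sq, of C]])
    fix k
    have "cmod (a k) * (1 + real k) ^ n = cmod (a k) * (1 + real k) ^ (n + 2) * inverse (real (Suc k) ^ 2)"
    proof -
      have "(1 + real k) ^ 2 * inverse (real (Suc k) ^ 2) = 1" by simp
      then show ?thesis unfolding power_add by (simp only: mult.assoc mult_1_right)
    qed
    also have "\<dots> \<le> C * inverse (real (Suc k) ^ 2)" by (intro mult_right_mono C) auto
    finally show "norm (cmod (a k) * (1 + real k) ^ n) \<le> C * inverse (real (Suc k) ^ 2)" by simp
  qed
qed

definition pgrowth :: "(nat \<Rightarrow> nat \<Rightarrow> complex) \<Rightarrow> bool" where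
  "pgrowth G \<longleftrightarrow> (\<exists>C n. \<forall>k l. cmod (G k l) \<le> C * ((1 + real k) ^ n * (1 + real l) ^ n))"

text \<open>The sesquilinear form with matrix \<open>G\<close>, by its values on truncated sequences. For rapidly decreasing
  sequences and polynomially growing \<open>G\<close> the limit exists.\<close>

definition gform :: "(nat \<Rightarrow> nat \<Rightarrow> complex) \<Rightarrow> (nat \<Rightarrow> complex) \<Rightarrow> (nat \<Rightarrow> complex) \<Rightarrow> complex" where
  "gform G a b = lim (sqsum (\<lambda>k l. G k l * a k * cnj (b l)))"

lemma gform_bound:
  assumes "cmod (G k l) \<le> C * ((1 + real k) ^ n * (1 + real l) ^ n)"
  shows "cmod (G k l * a k * cnj (b l)) \<le> C * ((cmod (a k) + cmod (b k)) * (1 + real k) ^ n * ((cmod (a l) + cmod (b l)) * (1 + real l) ^ n))"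
proof -
  have C0: "0 \<le> C * ((1 + real k) ^ n * (1 + real l) ^ n)" using assms norm_ge_zero order_trans by blast
  have "cmod (G k l * a k * cnj (b l)) \<le> (C * ((1 + real k) ^ n * (1 + real l) ^ n)) * cmod (a k) * cmod (b l)"
    unfolding norm_mult complex_mod_cnj by (intro mult_right_mono assms) auto
  also have "\<dots> = (C * ((1 + real k) ^ n * (1 + real l) ^ n)) * (cmod (a k) * cmod (b l))" by simp
  also have "\<dots> \<le> (C * ((1 + real k) ^ n * (1 + real l) ^ n)) * ((cmod (a k) + cmod (b k)) * (cmod (a l) + cmod (b l)))"
    using C0 by (intro mult_left_mono mult_mono) auto
  finally show ?thesis by (simp add: mult_ac)
qed

lemma gform_tendsto:
  assumes "pgrowth G" "rapid a" "rapid b"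
  shows "sqsum (\<lambda>k l. G k l * a k * cnj (b l)) \<longlonglongrightarrow> gform G a b"
proof -
  obtain C n where C: "\<And>k l. cmod (G k l) \<le> C * ((1 + real k) ^ n * (1 + real l) ^ n)"
    using assms(1) unfolding pgrowth_def by blast
  have "summable (\<lambda>k. cmod (a k) * (1 + real k) ^ n + cmod (b k) * (1 + real k) ^ n)"
    by (intro summable_add rapid_summable assms)
  then have "summable (\<lambda>k. (cmod (a k) + cmod (b k)) * (1 + real k) ^ n)"
    by (simp add: distrib_right)
  then have "convergent (sqsum (\<lambda>k l. G k l * a k * cnj (b l)))"
    by (intro dominated_sqsum_convergent[of _ C "\<lambda>k. (cmod (a k) + cmod (b k)) * (1 + real k) ^ n"] gform_bound C)
  then show ?thesis by (simp add: gform_def convergent_LIMSEQ_iff)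
qed

lemma rapid_add: "rapid a \<Longrightarrow> rapid b \<Longrightarrow> rapid (\<lambda>k. a k + b k)"
  unfolding rapid_def
proof
  fix n assume ab: "\<forall>n. \<exists>C. \<forall>k. cmod (a k) * (1 + real k) ^ n \<le> C" "\<forall>n. \<exists>C. \<forall>k. cmod (b k) * (1 + real k) ^ n \<le> C"
  obtain A where A: "\<And>k. cmod (a k) * (1 + real k) ^ n \<le> A" using ab by blast
  obtain B where B: "\<And>k. cmod (b k) * (1 + real k) ^ n \<le> B" using ab by blast
  have "cmod (a k + b k) * (1 + real k) ^ n \<le> A + B" for k
  proof -
    have "cmod (a k + b k) * (1 + real k) ^ n \<le> (cmod (a k) + cmod (b k)) * (1 + real k) ^ n"
      by (intro mult_right_mono norm_triangle_ineq) auto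
    then show ?thesis using A[of k] B[of k] by (simp add: distrib_right)
  qed
  then show "\<exists>C. \<forall>k. cmod (a k + b k) * (1 + real k) ^ n \<le> C" by blast
qed

lemma rapid_cmult: "rapid a \<Longrightarrow> rapid (\<lambda>k. c * a k)"
  unfolding rapid_def
proof
  fix n assume a: "\<forall>n. \<exists>C. \<forall>k. cmod (a k) * (1 + real k) ^ n \<le> C"
  obtain A where A: "\<And>k. cmod (a k) * (1 + real k) ^ n \<le> A" using a by blast
  have "cmod (c * a k) * (1 + real k) ^ n \<le> cmod c * A" for k
    using A[of k] by (simp add: norm_mult mult.assoc mult_left_mono)
  then show "\<exists>C. \<forall>k. cmod (c * a k) * (1 + real k) ^ n \<le> C" by blast
qed

context
  fixes G assumes G: "pgrowth G"
begin

lemma gform_add_left: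
  "rapid a \<Longrightarrow> rapid a' \<Longrightarrow> rapid b \<Longrightarrow> gform G (\<lambda>k. a k + a' k) b = gform G a b + gform G a' b"
  by (rule LIMSEQ_unique[OF gform_tendsto[OF G rapid_add]])
     (use tendsto_add[OF gform_tendsto[OF G] gform_tendsto[OF G]] in \<open>auto simp: algebra_simps simp flip: sqsum_add\<close>)

lemma gform_add_right:
  "rapid a \<Longrightarrow> rapid b' \<Longrightarrow> rapid b \<Longrightarrow> gform G a (\<lambda>k. b k + b' k) = gform G a b + gform G a b'"
  by (rule LIMSEQ_unique[OF gform_tendsto[OF G _ rapid_add]])
     (use tendsto_add[OF gform_tendsto[OF G] gform_tendsto[OF G]] in \<open>auto simp: algebra_simps simp flip: sqsum_add\<close>)

lemma gform_cmult_left: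
  "rapid a \<Longrightarrow> rapid b \<Longrightarrow> gform G (\<lambda>k. c * a k) b = c * gform G a b"
  by (rule LIMSEQ_unique[OF gform_tendsto[OF G rapid_cmult]])
     (use tendsto_mult_left[OF gform_tendsto[OF G], of _ _ c] in \<open>auto simp: algebra_simps simp flip: sqsum_cmult\<close>)

lemma gform_cmult_right:
  "rapid a \<Longrightarrow> rapid b \<Longrightarrow> gform G a (\<lambda>k. c * b k) = cnj c * gform G a b"
  by (rule LIMSEQ_unique[OF gform_tendsto[OF G _ rapid_cmult]])
     (use tendsto_mult_left[OF gform_tendsto[OF G], of a b "cnj c"] in \<open>auto simp: mult_ac simp flip: sqsum_cmult\<close>)

end

section \<open>Taylor coefficients of functions smooth up to the boundary\<close>

definition tcoef :: "(complex \<Rightarrow> complex) \<Rightarrow> nat \<Rightarrow> complex" where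
  "tcoef f k = (deriv ^^ k) f 0 / fact k"

lemma DaD:
  assumes "f \<in> Da"
  shows "f holomorphic_on ball 0 1" "continuous_on (cball 0 1) f"
    "\<exists>g. continuous_on (cball 0 1) g \<and> (\<forall>z\<in>ball 0 1. g z = (deriv ^^ n) f z)"
  using assms by (auto simp: Da_def)

lemma Da_deriv_bound:
  assumes "f \<in> Da"
  obtains M where "\<And>z. z \<in> ball 0 1 \<Longrightarrow> cmod ((deriv ^^ n) f z) \<le> M"
proof -
  obtain g where g: "continuous_on (cball 0 1) g" "\<And>z. z \<in> ball 0 1 \<Longrightarrow> g z = (deriv ^^ n) f z"
    using DaD(3)[OF assms] by blast
  have "bounded (g ` cball 0 1)"
    by (intro compact_imp_bounded compact_continuous_image g) simp
  then obtain M where "\<And>z. z \<in> cball 0 1 \<Longrightarrow> cmod (g z) \<le> M" unfolding bounded_iff by blast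
  then have "cmod ((deriv ^^ n) f z) \<le> M" if "z \<in> ball 0 1" for z
    using g(2)[OF that] that by (metis ball_subset_cball subsetD)
  then show ?thesis by (rule that)
qed

lemma disc_coefficient_bound:
  assumes g: "g holomorphic_on ball 0 1" "\<And>z. z \<in> ball 0 1 \<Longrightarrow> cmod (g z) \<le> M"
  shows "cmod ((deriv ^^ k) g 0) \<le> fact k * M"
proof -
  have r: "cmod ((deriv ^^ k) g 0) * r ^ k \<le> fact k * M" if "r \<in> {0<..<1}" for r
  proof -
    have "cball 0 r \<subseteq> ball (0::complex) 1" using that by auto
    then have "cmod ((deriv ^^ k) g 0) \<le> fact k * M / r ^ k"
      using that g
      by (intro Cauchy_inequality)
        (auto intro!: holomorphic_on_subset[OF g(1)] holomorphic_on_imp_continuous_on g(2))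
    then show ?thesis using that by (simp add: field_simps)
  qed
  have "((\<lambda>r. cmod ((deriv ^^ k) g 0) * r ^ k) \<longlongrightarrow> cmod ((deriv ^^ k) g 0) * 1 ^ k) (at_left (1::real))"
    by (intro tendsto_intros)
  moreover have "\<forall>\<^sub>F r in at_left (1::real). cmod ((deriv ^^ k) g 0) * r ^ k \<le> fact k * M"
    using eventually_at_left_real[of 0 "1::real"] r by (auto elim!: eventually_mono)
  ultimately have "cmod ((deriv ^^ k) g 0) * 1 ^ k \<le> fact k * M"
    by (intro tendsto_upperbound) auto
  then show ?thesis by simp
qed

lemma fact_add_ge: "fact k * (1 + real k) ^ n \<le> fact (k + n)"
proof (induction n)
  case (Suc n)
  have "fact k * (1 + real k) ^ Suc n = (fact k * (1 + real k) ^ n) * (1 + real k)" by simp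
  also have "\<dots> \<le> fact (k + n) * real (k + n + 1)" by (intro mult_mono Suc) auto
  finally show ?case by (simp add: mult.commute)
qed simp

text \<open>Since the \<open>n\<close>-th derivative is bounded on the disc, Cauchy's estimate bounds its Taylor coefficients,
  which are those of \<open>f\<close> multiplied by about \<open>k\<^sup>n\<close>.\<close>

lemma Da_rapid:
  assumes f: "f \<in> Da" shows "rapid (tcoef f)"
  unfolding rapid_def
proof
  fix n
  obtain M where M: "\<And>z. z \<in> ball 0 1 \<Longrightarrow> cmod ((deriv ^^ n) f z) \<le> M" using Da_deriv_bound[OF f, of n] by blast
  have hol: "(deriv ^^ n) f holomorphic_on ball 0 1"
    by (intro holomorphic_higher_deriv DaD(1)[OF f]) simp
  have M0: "M \<ge> 0" using M[of 0] norm_ge_zero order_trans by (metis centre_in_ball zero_less_one)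
  have b: "cmod (tcoef f (k + n)) * (1 + real (k + n)) ^ n \<le> M * (1 + real n) ^ n" for k
  proof -
    have "cmod ((deriv ^^ (k + n)) f 0) \<le> fact k * M"
      using disc_coefficient_bound[OF hol M, of k] by (simp add: funpow_add)
    then have "cmod (tcoef f (k + n)) \<le> fact k * M / fact (k + n)"
      by (simp add: tcoef_def norm_divide divide_right_mono)
    then have 1: "cmod (tcoef f (k + n)) * fact (k + n) \<le> fact k * M"
      by (simp add: field_simps)
    have "(1 + real (k + n)) ^ n \<le> ((1 + real k) * (1 + real n)) ^ n"
      by (intro power_mono) (auto simp: algebra_simps)
    also have "\<dots> = (1 + real k) ^ n * (1 + real n) ^ n" by (rule power_mult_distrib)
    finally have "cmod (tcoef f (k + n)) * (1 + real (k + n)) ^ n * fact k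
        \<le> cmod (tcoef f (k + n)) * ((1 + real k) ^ n * (1 + real n) ^ n) * fact k"
      by (intro mult_right_mono mult_left_mono) auto
    also have "\<dots> = cmod (tcoef f (k + n)) * (fact k * (1 + real k) ^ n) * (1 + real n) ^ n" by (simp add: mult_ac)
    also have "\<dots> \<le> cmod (tcoef f (k + n)) * fact (k + n) * (1 + real n) ^ n"
      by (intro mult_right_mono mult_left_mono fact_add_ge) auto
    also have "\<dots> \<le> fact k * M * (1 + real n) ^ n" by (intro mult_right_mono 1) auto
    finally have "(cmod (tcoef f (k + n)) * (1 + real (k + n)) ^ n) * fact k \<le> (M * (1 + real n) ^ n) * fact k"
      by (simp add: mult_ac)
    then show ?thesis by (rule mult_right_le_imp_le) simp
  qed
  define B where "B = M * (1 + real n) ^ n + (\<Sum>j<n. cmod (tcoef f j) * (1 + real j) ^ n)"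
  have "cmod (tcoef f k) * (1 + real k) ^ n \<le> B" for k
  proof (cases "k < n")
    case True
    have "cmod (tcoef f k) * (1 + real k) ^ n \<le> (\<Sum>j<n. cmod (tcoef f j) * (1 + real j) ^ n)"
      using True by (intro member_le_sum[of k "{..<n}"]) auto
    then show ?thesis using M0 by (simp add: B_def add_increasing)
  next
    case False
    have "0 \<le> (\<Sum>j<n. cmod (tcoef f j) * (1 + real j) ^ n)" by (intro sum_nonneg) auto
    then show ?thesis using b[of "k - n"] False by (simp add: B_def)
  qed
  then show "\<exists>C. \<forall>k. cmod (tcoef f k) * (1 + real k) ^ n \<le> C" by blast
qed

lemma Da_add:
  assumes f: "f \<in> Da" and g: "g \<in> Da"
  shows "(\<lambda>z. f z + g z) \<in> Da" "tcoef (\<lambda>z. f z + g z) = (\<lambda>k. tcoef f k + tcoef g k)"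
proof -
  have d: "(deriv ^^ n) (\<lambda>z. f z + g z) z = (deriv ^^ n) f z + (deriv ^^ n) g z" if "z \<in> ball 0 1" for n z
    using higher_deriv_add[OF DaD(1)[OF f] DaD(1)[OF g] open_ball that] .
  show "(\<lambda>z. f z + g z) \<in> Da"
    unfolding Da_def mem_Collect_eq
  proof (intro conjI allI)
    fix n
    obtain f' where f': "continuous_on (cball 0 1) f'" "\<forall>z\<in>ball 0 1. f' z = (deriv ^^ n) f z" using DaD(3)[OF f] by blast
    obtain g' where g': "continuous_on (cball 0 1) g'" "\<forall>z\<in>ball 0 1. g' z = (deriv ^^ n) g z" using DaD(3)[OF g] by blast
    show "\<exists>h. continuous_on (cball 0 1) h \<and> (\<forall>z\<in>ball 0 1. h z = (deriv ^^ n) (\<lambda>z. f z + g z) z)"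
      by (rule exI[of _ "\<lambda>z. f' z + g' z"]) (use f' g' d in \<open>auto intro!: continuous_intros\<close>)
  qed (use DaD[OF f] DaD[OF g] in \<open>auto intro!: continuous_intros holomorphic_intros\<close>)
  show "tcoef (\<lambda>z. f z + g z) = (\<lambda>k. tcoef f k + tcoef g k)"
    by (simp add: fun_eq_iff tcoef_def d add_divide_distrib)
qed

lemma higher_deriv_Mz:
  assumes f: "f holomorphic_on ball 0 1" and z: "z \<in> ball 0 1"
  shows "(deriv ^^ n) (Mz f) z = z * (deriv ^^ n) f z + of_nat n * (deriv ^^ (n - 1)) f z"
proof -
  have "(deriv ^^ n) (Mz f) z = (\<Sum>i = 0..n. of_nat (n choose i) * (deriv ^^ i) (\<lambda>w. w) z * (deriv ^^ (n-i)) f z)"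
    unfolding Mz_def using higher_deriv_mult[OF holomorphic_on_ident f open_ball z] .
  also have "\<dots> = (\<Sum>i = 0..n. (if i = 0 then z * (deriv ^^ n) f z else 0) + (if i = 1 then of_nat n * (deriv ^^ (n - 1)) f z else 0))"
    by (intro sum.cong) auto
  also have "\<dots> = z * (deriv ^^ n) f z + of_nat n * (deriv ^^ (n - 1)) f z"
    by (simp add: sum.distrib)
  finally show ?thesis .
qed

lemma Da_Mz:
  assumes f: "f \<in> Da"
  shows "Mz f \<in> Da" "tcoef (Mz f) = (\<lambda>k. if k = 0 then 0 else tcoef f (k - 1))"
proof -
  note d = higher_deriv_Mz[OF DaD(1)[OF f]]
  show "Mz f \<in> Da"
    unfolding Da_def mem_Collect_eq
  proof (intro conjI allI)
    fix n
    obtain f' where f': "continuous_on (cball 0 1) f'" "\<forall>z\<in>ball 0 1. f' z = (deriv ^^ n) f z" using DaD(3)[OF f] by blast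
    obtain g' where g': "continuous_on (cball 0 1) g'" "\<forall>z\<in>ball 0 1. g' z = (deriv ^^ (n - 1)) f z" using DaD(3)[OF f] by blast
    show "\<exists>h. continuous_on (cball 0 1) h \<and> (\<forall>z\<in>ball 0 1. h z = (deriv ^^ n) (Mz f) z)"
      by (rule exI[of _ "\<lambda>z. z * f' z + of_nat n * g' z"]) (use f' g' d in \<open>auto intro!: continuous_intros\<close>)
  qed (use DaD[OF f] in \<open>auto simp: Mz_def intro!: continuous_intros holomorphic_intros\<close>)
  show "tcoef (Mz f) = (\<lambda>k. if k = 0 then 0 else tcoef f (k - 1))"
  proof
    fix k
    show "tcoef (Mz f) k = (if k = 0 then 0 else tcoef f (k - 1))"
    proof (cases k)
      case 0
      then show ?thesis by (simp add: tcoef_def Mz_def)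
    next
      case (Suc j)
      have "(deriv ^^ k) (Mz f) 0 = of_nat k * (deriv ^^ j) f 0" using d[of 0 k] Suc by simp
      moreover have "(fact k :: complex) = of_nat k * fact j" using Suc by simp
      ultimately show ?thesis using Suc by (simp add: tcoef_def del: fact_Suc of_nat_Suc)
    qed
  qed
qed

lemma Da_const: "(\<lambda>z. c) \<in> Da" "tcoef (\<lambda>z. c) = (\<lambda>k. if k = 0 then c else 0)"
proof -
  show "(\<lambda>z. c) \<in> Da"
    unfolding Da_def mem_Collect_eq
  proof (intro conjI allI)
    fix n
    show "\<exists>g. continuous_on (cball 0 1) g \<and> (\<forall>z\<in>ball 0 1. g z = (deriv ^^ n) (\<lambda>z. c) z)"
      by (rule exI[of _ "\<lambda>z. if n = 0 then c else 0"]) (auto simp del: funpow.simps)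
  qed auto
qed (simp add: fun_eq_iff tcoef_def)

lemma Da_cmult:
  assumes f: "f \<in> Da"
  shows "(\<lambda>z. c * f z) \<in> Da" "tcoef (\<lambda>z. c * f z) = (\<lambda>k. c * tcoef f k)"
proof -
  have d: "(deriv ^^ n) (\<lambda>z. c * f z) z = c * (deriv ^^ n) f z" if "z \<in> ball 0 1" for n z
    using higher_deriv_cmult[OF DaD(1)[OF f] that open_ball] .
  show "(\<lambda>z. c * f z) \<in> Da"
    unfolding Da_def mem_Collect_eq
  proof (intro conjI allI)
    fix n
    obtain f' where f': "continuous_on (cball 0 1) f'" "\<forall>z\<in>ball 0 1. f' z = (deriv ^^ n) f z" using DaD(3)[OF f] by blast
    show "\<exists>h. continuous_on (cball 0 1) h \<and> (\<forall>z\<in>ball 0 1. h z = (deriv ^^ n) (\<lambda>z. c * f z) z)"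
      by (rule exI[of _ "\<lambda>z. c * f' z"]) (use f' d in \<open>auto intro!: continuous_intros\<close>)
  qed (use DaD[OF f] in \<open>auto intro!: continuous_intros holomorphic_intros\<close>)
  show "tcoef (\<lambda>z. c * f z) = (\<lambda>k. c * tcoef f k)"
    by (simp add: fun_eq_iff tcoef_def d)
qed

lemma Da_power: "(\<lambda>z. z ^ n) \<in> Da" "tcoef (\<lambda>z. z ^ n) = (\<lambda>k. if k = n then 1 else 0)"
proof -
  have "(\<lambda>z. z ^ n) \<in> Da \<and> tcoef (\<lambda>z. z ^ n) = (\<lambda>k. if k = n then 1 else 0)"
  proof (induction n)
    case (Suc n)
    have "(\<lambda>z. z ^ Suc n) = Mz (\<lambda>z. z ^ n)" by (simp add: Mz_def fun_eq_iff)
    then show ?case using Da_Mz[of "\<lambda>z. z ^ n"] Suc by (auto simp: fun_eq_iff)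
  qed (use Da_const[of 1] in simp)
  then show "(\<lambda>z. z ^ n) \<in> Da" "tcoef (\<lambda>z. z ^ n) = (\<lambda>k. if k = n then 1 else 0)" by auto
qed

lemma higher_deriv_sums:
  assumes f: "f \<in> Da" and z: "z \<in> ball 0 1"
  shows "(\<lambda>k. tcoef f (k + n) * (fact (k + n) / fact k) * z ^ k) sums ((deriv ^^ n) f z)"
proof -
  have "(\<lambda>k. (deriv ^^ k) ((deriv ^^ n) f) 0 / fact k * (z - 0) ^ k) sums ((deriv ^^ n) f z)"
    by (intro holomorphic_power_series[OF _ z] holomorphic_higher_deriv DaD(1)[OF f]) simp
  moreover have "(deriv ^^ k) ((deriv ^^ n) f) 0 / fact k = tcoef f (k + n) * (fact (k + n) / fact k)" for k
    by (simp add: tcoef_def funpow_add)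
  ultimately show ?thesis by simp
qed

section \<open>Finite differences\<close>

definition fdiff :: "(nat \<Rightarrow> complex) \<Rightarrow> nat \<Rightarrow> complex" where
  "fdiff g k = g (Suc k) - g k"

lemma fdiff_pow_formula:
  "(fdiff ^^ n) g k = (\<Sum>j\<le>n. (-1) ^ (n - j) * of_nat (n choose j) * g (k + j))"
proof (induction n arbitrary: k)
  case (Suc n)
  let ?a = "\<lambda>n j. (-1) ^ (n - j) * of_nat (n choose j) :: complex"
  have "(\<Sum>j\<le>Suc n. ?a (Suc n) j * g (k + j)) =
      (\<Sum>j\<le>Suc n. (if j = 0 then 0 else ?a n (j - 1) * g (k + j)) - (if j \<le> n then ?a n j * g (k + j) else 0))"
  proof (intro sum.cong refl)
    fix j assume j: "j \<in> {..Suc n}"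
    show "?a (Suc n) j * g (k + j) = (if j = 0 then 0 else ?a n (j - 1) * g (k + j)) - (if j \<le> n then ?a n j * g (k + j) else 0)"
    proof (cases j)
      case (Suc i)
      show ?thesis
      proof (cases "j \<le> n")
        case True
        then have "n - i = Suc (n - j)" using Suc by simp
        then show ?thesis using Suc True by (simp add: algebra_simps)
      qed (use Suc j in auto)
    qed simp
  qed
  also have "\<dots> = (\<Sum>j\<le>Suc n. if j = 0 then 0 else ?a n (j - 1) * g (k + j)) - (\<Sum>j\<le>Suc n. if j \<le> n then ?a n j * g (k + j) else 0)"
    by (rule sum_subtractf)
  also have "(\<Sum>j\<le>Suc n. if j = 0 then 0 else ?a n (j - 1) * g (k + j)) = (\<Sum>j\<le>n. ?a n j * g (Suc k + j))"
    by (subst sum.atMost_Suc_shift) simp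
  also have "(\<Sum>j\<le>Suc n. if j \<le> n then ?a n j * g (k + j) else 0) = (\<Sum>j\<le>n. ?a n j * g (k + j))"
    by simp
  finally show ?case using Suc by (simp add: fdiff_def)
qed simp

lemma newton_forward: "g k = (\<Sum>n\<le>k. of_nat (k choose n) * (fdiff ^^ n) g 0)"
proof -
  have "g (k + i) = (\<Sum>n\<le>k. of_nat (k choose n) * (fdiff ^^ n) g i)" for i
  proof (induction k arbitrary: i)
    case (Suc k)
    have "(\<Sum>n\<le>Suc k. of_nat (Suc k choose n) * (fdiff ^^ n) g i) =
      (\<Sum>n\<le>Suc k. (if n \<le> k then of_nat (k choose n) * (fdiff ^^ n) g i else 0) + (if n = 0 then 0 else of_nat (k choose (n - 1)) * (fdiff ^^ n) g i))"
      by (intro sum.cong refl) (auto simp: algebra_simps not_le gr0_conv_Suc split: nat.splits simp del: funpow.simps elim!: le_SucE)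
    also have "\<dots> = (\<Sum>n\<le>k. of_nat (k choose n) * (fdiff ^^ n) g i) + (\<Sum>n\<le>k. of_nat (k choose n) * (fdiff ^^ Suc n) g i)"
      unfolding sum.distrib by (subst (2) sum.atMost_Suc_shift) (simp del: funpow.simps)
    also have "\<dots> = (\<Sum>n\<le>k. of_nat (k choose n) * (fdiff ^^ n) g (Suc i))"
      by (simp add: fdiff_def sum.distrib[symmetric] algebra_simps)
    finally show ?case using Suc[of "Suc i"] by simp
  qed simp
  from this[of 0] show ?thesis by simp
qed

lemma fdiff_choose: "(fdiff ^^ m) (\<lambda>k. of_nat (k choose n) * c) = (\<lambda>k. if m \<le> n then of_nat (k choose (n - m)) * c else 0)"
proof (induction m)
  case (Suc m)
  show ?case
  proof (cases "Suc m \<le> n")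
    case True
    then obtain j where j: "n - m = Suc j" "n - Suc m = j" by (metis Suc_diff_Suc Suc_le_lessD)
    show ?thesis using True unfolding funpow.simps o_apply Suc by (simp add: fdiff_def fun_eq_iff j algebra_simps)
  next
    case False
    then show ?thesis unfolding funpow.simps o_apply Suc by (auto simp: fdiff_def fun_eq_iff)
  qed
qed simp

section \<open>Rotation invariance and radial integrals in the plane\<close>

definition r2c :: "real ^ 2 \<Rightarrow> complex" where "r2c v = Complex (v $ 1) (v $ 2)"
definition c2r :: "complex \<Rightarrow> real ^ 2" where "c2r z = vector [Re z, Im z]"

lemma r2c_c2r [simp]: "r2c (c2r z) = z" "c2r (r2c v) = v"
  by (simp_all add: r2c_def c2r_def complex_eq_iff vec_eq_iff forall_2)

lemma linear_r2c: "linear r2c" and linear_c2r: "linear c2r"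
  by (auto simp: r2c_def c2r_def linear_iff complex_eq_iff vec_eq_iff forall_2)

lemma norm_c2r: "norm (c2r z) = cmod z"
  by (simp add: c2r_def norm_vec_def L2_set_def UNIV_2 cmod_def)

lemma measurable_r2c [measurable]: "r2c \<in> borel_measurable borel"
  using linear_r2c by (intro borel_measurable_continuous_onI linear_continuous_on linear_linear[THEN iffD2]) 

lemma r2c_vimage_box: "r2c -` box l u = box (c2r l) (c2r u)"
  by (auto simp: r2c_def c2r_def mem_box_cart forall_2 in_box_complex_iff)

lemma emeasure_box_c2r:
  assumes "Re l \<le> Re u" "Im l \<le> Im u"
  shows "emeasure lborel (box (c2r l) (c2r u)) = ennreal ((Re u - Re l) * (Im u - Im l))"
proof -
  have B: "(Basis :: (real ^ 2) set) = (\<lambda>i. axis i 1) ` UNIV" by (auto simp: Basis_vec_def)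
  have "emeasure lborel (box (c2r l) (c2r u)) = ennreal (\<Prod>b\<in>Basis. (c2r u - c2r l) \<bullet> b)"
    using assms by (subst emeasure_lborel_box) (auto simp: B inner_axis c2r_def UNIV_2)
  also have "(\<Prod>b\<in>Basis. (c2r u - c2r l) \<bullet> b) = (Re u - Re l) * (Im u - Im l)"
    unfolding B by (subst prod.reindex) (auto simp: inj_on_def axis_eq_axis inner_axis c2r_def UNIV_2)
  finally show ?thesis .
qed

text \<open>The invariance of Lebesgue measure under orthogonal maps lives on \<open>\<real>\<^sup>2\<close>; this transports it to the
  complex plane.\<close>

lemma lborel_complex_eq: "(lborel :: complex measure) = distr lborel borel r2c"
proof (rule lborel_eqI)
  fix l u :: complex assume "\<And>b. b \<in> Basis \<Longrightarrow> l \<bullet> b \<le> u \<bullet> b"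
  from this[of 1] this[of \<i>] have "Re l \<le> Re u" "Im l \<le> Im u"
    by (auto simp: Basis_complex_def inner_complex_def)
  then show "emeasure (distr lborel borel r2c) (box l u) = ennreal (\<Prod>b\<in>Basis. (u - l) \<bullet> b)"
    by (simp add: emeasure_distr r2c_vimage_box emeasure_box_c2r Basis_complex_def inner_complex_def)
qed simp

lemma orthogonal_rotation:
  assumes "cmod u = 1" shows "orthogonal_transformation (\<lambda>v. c2r (u * r2c v))"
proof -
  have "linear (\<lambda>v. c2r (u * r2c v))"
    using linear_compose[OF linear_compose[OF linear_r2c, of "\<lambda>z. u * z"] linear_c2r]
    by (simp add: o_def linear_times)
  moreover have "norm (c2r (u * r2c v)) = norm v" for v
    using norm_c2r[of "r2c v"] assms by (simp add: norm_c2r norm_mult)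
  ultimately show ?thesis by (simp add: orthogonal_transformation)
qed

lemma lborel_rotation:
  assumes u: "cmod u = 1" shows "(lborel :: complex measure) = distr lborel borel (\<lambda>z. u * z)"
proof (rule lborel_eqI)
  fix a b :: complex assume "\<And>i. i \<in> Basis \<Longrightarrow> a \<bullet> i \<le> b \<bullet> i"
  from this[of 1] this[of \<i>] have ab: "Re a \<le> Re b" "Im a \<le> Im b"
    by (auto simp: Basis_complex_def inner_complex_def)
  define B where "B = box (c2r a) (c2r b)"
  define R where "R v = c2r (cnj u * r2c v)" for v
  have uu: "u * cnj u = 1" using u by (simp add: complex_norm_square[symmetric])
  then have uu': "u * (cnj u * z) = z" "cnj u * (u * z) = z" for z
    by (simp_all add: mult.assoc[symmetric] mult.commute[of "cnj u" u])
  have R: "orthogonal_transformation R"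
    unfolding R_def using u by (intro orthogonal_rotation) simp
  have vim: "r2c -` ((\<lambda>z. u * z) -` box a b) = R ` B"
  proof (rule equalityI; rule subsetI)
    fix v assume "v \<in> r2c -` ((\<lambda>z. u * z) -` box a b)"
    then have "u * r2c v \<in> box a b" by simp
    then have "c2r (u * r2c v) \<in> B" unfolding B_def r2c_vimage_box[symmetric] by simp
    moreover have "R (c2r (u * r2c v)) = v" by (simp add: R_def uu')
    ultimately show "v \<in> R ` B" by (metis imageI)
  next
    fix x assume "x \<in> R ` B"
    then obtain v where v: "x = R v" "v \<in> B" by blast
    then have "r2c v \<in> box a b" unfolding B_def r2c_vimage_box[symmetric] by simp
    then show "x \<in> r2c -` ((\<lambda>z. u * z) -` box a b)" by (simp add: v R_def uu')
  qed
  have [measurable]: "(\<lambda>z. u * z) \<in> borel_measurable borel" by measurable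
  have Bm: "B \<in> lmeasurable" unfolding B_def by (rule lmeasurable_box)
  have "emeasure (distr lborel borel (\<lambda>z. u * z)) (box a b) = emeasure (lborel :: complex measure) ((\<lambda>z. u * z) -` box a b)"
    by (subst emeasure_distr) auto
  also have "\<dots> = emeasure lborel (r2c -` ((\<lambda>z. u * z) -` box a b))"
    by (subst lborel_complex_eq, subst emeasure_distr) (auto intro!: measurable_sets_borel[of _ borel])
  also have "\<dots> = emeasure lborel (R ` B)" by (simp only: vim)
  also have "\<dots> = emeasure lebesgue (R ` B)"
  proof -
    have "R ` B \<in> sets borel"
      unfolding vim[symmetric] by (intro measurable_sets_borel[of _ borel]) (auto intro!: measurable_sets_borel[of _ borel])
    then show ?thesis by simp
  qed
  also have "\<dots> = ennreal (measure lebesgue (R ` B))"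
    using measurable_orthogonal_image[OF R Bm] by (simp add: emeasure_eq_measure2)
  also have "\<dots> = ennreal (measure lebesgue B)" by (simp add: measure_orthogonal_image[OF R Bm])
  also have "\<dots> = emeasure lebesgue B" using Bm by (simp add: emeasure_eq_measure2)
  also have "\<dots> = emeasure lborel B" by (simp add: B_def)
  also have "\<dots> = ennreal ((Re b - Re a) * (Im b - Im a))" unfolding B_def by (rule emeasure_box_c2r[OF ab])
  finally show "emeasure (distr lborel borel (\<lambda>z. u * z)) (box a b) = ennreal (\<Prod>i\<in>Basis. (b - a) \<bullet> i)"
    by (simp add: Basis_complex_def inner_complex_def)
qed simp

text \<open>Rotating by the angle \<open>\<pi> / (a - b)\<close> changes the sign of \<open>z\<^sup>a\<close> times the \<open>b\<close>-th power of the conjugate.\<close>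

lemma rotation_integral_zero:
  fixes w :: "complex \<Rightarrow> real"
  assumes [measurable]: "w \<in> borel_measurable borel" and w: "\<And>u z. cmod u = 1 \<Longrightarrow> w (u * z) = w z" and ab: "a \<noteq> b"
  shows "(LINT z|lborel. complex_of_real (w z) * (z ^ a * cnj z ^ b)) = 0"
proof -
  define u where "u = cis (pi / (real a - real b))"
  have u: "cmod u = 1" by (simp add: u_def)
  have "u ^ a * cnj u ^ b = cis (real a * (pi / (real a - real b)) + real b * (- (pi / (real a - real b))))"
    unfolding u_def cis_cnj Complex.DeMoivre cis_mult by simp
  also have "real a * (pi / (real a - real b)) + real b * (- (pi / (real a - real b))) = (real a - real b) * (pi / (real a - real b))"
    by (simp only: left_diff_distrib)
  also have "\<dots> = pi" using ab by simp
  finally have ua: "u ^ a * cnj u ^ b = -1" by simp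
  let ?F = "\<lambda>z. complex_of_real (w z) * (z ^ a * cnj z ^ b)"
  have [measurable]: "cnj \<in> borel_measurable borel"
    by (intro borel_measurable_continuous_onI continuous_intros)
  have "(LINT z|lborel. ?F z) = (LINT z|distr lborel borel (\<lambda>z. u * z). ?F z)"
    using lborel_rotation[OF u] by simp
  also have "\<dots> = (LINT z|lborel. ?F (u * z))"
    by (rule integral_distr) measurable
  also have "\<dots> = (LINT z|lborel. (u ^ a * cnj u ^ b) * ?F z)"
    by (intro Bochner_Integration.integral_cong refl) (simp only: w[OF u] power_mult_distrib complex_cnj_mult, simp only: mult_ac)
  also have "\<dots> = - (LINT z|lborel. ?F z)" unfolding ua by simp
  finally show ?thesis by simp
qed

text \<open>The disc of radius \<open>sqrt x\<close> has area \<open>\<pi> x\<close>, so under area measure \<open>\<bar>z\<bar>\<^sup>2\<close> is uniformly distributed.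
  This takes the place of polar coordinates for radial integrands.\<close>

lemma radial_distr:
  "distr (density lborel (indicator (ball (0::complex) 1))) borel (\<lambda>z. (cmod z)\<^sup>2) =
   density lborel (\<lambda>s. ennreal pi * indicator {0..<1} s)"
proof (rule measure_eqI_lessThan)
  let ?M = "density lborel (indicator (ball (0::complex) 1))"
  let ?N = "density lborel (\<lambda>s. ennreal pi * indicator {0..<1} s)"
  have N: "emeasure ?N {x<..} = ennreal pi * emeasure lborel ({0..<1} \<inter> {x<..})" for x :: real
    by (subst emeasure_density) (auto simp: nn_integral_cmult mult.assoc indicator_inter_arith[symmetric] nn_integral_cmult_indicator)
  have M: "emeasure (distr ?M borel (\<lambda>z. (cmod z)\<^sup>2)) {x<..} = emeasure lborel (ball (0::complex) 1 \<inter> {z. x < (cmod z)\<^sup>2})" for x :: real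
    by (subst emeasure_distr, simp, simp, subst emeasure_density)
       (auto simp: indicator_inter_arith[symmetric] vimage_def intro!: borel_measurable_indicator)
  show eq: "emeasure (distr ?M borel (\<lambda>z. (cmod z)\<^sup>2)) {x<..} = emeasure ?N {x<..}" for x :: real
  proof -
    have b1: "emeasure lborel (ball (0::complex) 1) = ennreal pi"
      by (simp add: emeasure_ball unit_ball_vol_2)
    consider "x < 0" | "0 \<le> x" "x < 1" | "1 \<le> x" by linarith
    then show ?thesis
    proof cases
      case 1
      then have "ball (0::complex) 1 \<inter> {z. x < (cmod z)\<^sup>2} = ball 0 1" "{0..<1} \<inter> {x<..} = {0..<1}"
        by (auto intro: less_le_trans[OF _ zero_le_power2])
      then show ?thesis unfolding M N using b1 by simp
    next
      case 2
      have e: "ball (0::complex) 1 \<inter> {z. x < (cmod z)\<^sup>2} = ball 0 1 - cball 0 (sqrt x)"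
        using 2 by (auto simp: not_le real_less_lsqrt real_sqrt_less_iff dest: real_le_lsqrt real_sqrt_le_iff[THEN iffD2])
           (metis abs_norm_cancel linorder_not_less real_sqrt_abs real_sqrt_le_iff real_sqrt_less_iff)+
      have "cball (0::complex) (sqrt x) \<subseteq> ball 0 1"
      proof -
        have "sqrt x < 1" using 2 by simp
        then show ?thesis by (simp add: cball_subset_ball_iff)
      qed
      then have "emeasure lborel (ball (0::complex) 1 - cball 0 (sqrt x)) = ennreal pi - emeasure lborel (cball (0::complex) (sqrt x))"
        by (subst emeasure_Diff) (auto simp: b1 emeasure_cball 2)
      also have "emeasure lborel (cball (0::complex) (sqrt x)) = ennreal (pi * x)"
        using 2 by (simp add: emeasure_cball unit_ball_vol_2)
      also have "ennreal pi - ennreal (pi * x) = ennreal (pi - pi * x)"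
        using 2 by (intro ennreal_minus) auto
      finally have m: "emeasure lborel (ball (0::complex) 1 \<inter> {z. x < (cmod z)\<^sup>2}) = ennreal (pi - pi * x)" by (simp add: e)
      have "{0..<1} \<inter> {x<..} = {x<..<1}" using 2 by auto
      then have n: "ennreal pi * emeasure lborel ({0..<1} \<inter> {x<..}) = ennreal (pi - pi * x)"
        using 2 by (simp add: ennreal_mult[symmetric] algebra_simps)
      show ?thesis unfolding M N m n ..
    next
      case 3
      have "ball (0::complex) 1 \<inter> {z. x < (cmod z)\<^sup>2} = {}"
      proof -
        have "(cmod z)\<^sup>2 \<le> x" if "cmod z < 1" for z
          using that 3 power_le_one[of "cmod z" 2] by (intro order.trans[OF _ 3]) auto
        then show ?thesis by (auto simp: not_less[symmetric])
      qed
      moreover have "{0..<1} \<inter> {x<..} = {}" using 3 by auto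
      ultimately show ?thesis unfolding M N by simp
    qed
  qed
  show "emeasure (distr ?M borel (\<lambda>z. (cmod z)\<^sup>2)) {x<..} < \<infinity>" for x :: real
  proof -
    have "emeasure lborel ({0..<1} \<inter> {x<..}) \<le> emeasure lborel {0..<1::real}"
      by (intro emeasure_mono) auto
    then have "ennreal pi * emeasure lborel ({0..<1} \<inter> {x<..}) \<le> ennreal pi * emeasure lborel {0..<1::real}"
      by (rule mult_left_mono) simp
    then show ?thesis
      unfolding eq N by (rule le_less_trans) (simp add: ennreal_mult_less_top)
  qed
qed auto

text \<open>Up to the factor \<open>\<pi>\<close> the integral of \<open>\<bar>z\<bar>\<close> to the power \<open>2 a\<close> against the weight
  \<open>(1 - \<bar>z\<bar>\<^sup>2)\<close> to the power \<open>n - 1\<close> over the disc of radius \<open>r\<close>, in the variable \<open>s = \<bar>z\<bar>\<^sup>2\<close>: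
  an incomplete Beta integral.\<close>

definition betaint :: "nat \<Rightarrow> nat \<Rightarrow> real \<Rightarrow> real" where
  "betaint n a r = integral {0..r\<^sup>2} (\<lambda>s. s ^ a * (1 - s) ^ (n - 1))"

lemma radial_integral_eq:
  assumes r: "0 < r" "r < 1"
  shows "(LINT z|lborel. complex_of_real (indicator (ball 0 r) z * (1 - (cmod z)\<^sup>2) ^ (n - 1)) * (z ^ a * cnj z ^ a))
     = complex_of_real (pi * betaint n a r)"
proof -
  let ?g = "\<lambda>s::real. indicator {0..<r\<^sup>2} s * (s ^ a * (1 - s) ^ (n - 1))"
  have r2: "r\<^sup>2 < 1" using r by (simp add: power_less_one_iff)
  have lt: "cmod z < r \<longleftrightarrow> (cmod z)\<^sup>2 < r\<^sup>2" for z
    using r by (metis less_eq_real_def norm_ge_zero power_less_imp_less_base power_strict_mono zero_less_numeral)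
  have "(LINT z|lborel. complex_of_real (indicator (ball 0 r) z * (1 - (cmod z)\<^sup>2) ^ (n - 1)) * (z ^ a * cnj z ^ a))
     = (LINT z|lborel. complex_of_real (indicator (ball 0 1) z *\<^sub>R ?g ((cmod z)\<^sup>2)))"
  proof (intro Bochner_Integration.integral_cong refl)
    fix z :: complex
    have "z * cnj z = complex_of_real ((cmod z)\<^sup>2)" by (simp only: complex_norm_square)
    then have "z ^ a * cnj z ^ a = complex_of_real (((cmod z)\<^sup>2) ^ a)"
      by (simp only: power_mult_distrib[symmetric] of_real_power)
    moreover have "z \<in> ball 0 r \<Longrightarrow> z \<in> ball 0 1" using r by auto
    ultimately show "complex_of_real (indicator (ball 0 r) z * (1 - (cmod z)\<^sup>2) ^ (n - 1)) * (z ^ a * cnj z ^ a)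
       = complex_of_real (indicator (ball 0 1) z *\<^sub>R ?g ((cmod z)\<^sup>2))"
      using lt[of z] by (auto simp: indicator_def)
  qed
  also have "\<dots> = complex_of_real (LINT z|lborel. indicator (ball (0::complex) 1) z *\<^sub>R ?g ((cmod z)\<^sup>2))"
    by (rule integral_complex_of_real)
  also have "(LINT z|lborel. indicator (ball (0::complex) 1) z *\<^sub>R ?g ((cmod z)\<^sup>2)) =
     (LINT z|density lborel (\<lambda>z. ennreal (indicator (ball (0::complex) 1) z)). ?g ((cmod z)\<^sup>2))"
    by (subst integral_density) (auto intro!: borel_measurable_indicator)
  also have "density lborel (\<lambda>z. ennreal (indicator (ball (0::complex) 1) z)) = density lborel (indicator (ball (0::complex) 1))"
    by (simp add: ennreal_indicator)
  also have "(LINT z|density lborel (indicator (ball (0::complex) 1)). ?g ((cmod z)\<^sup>2)) =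
     (LINT s|distr (density lborel (indicator (ball (0::complex) 1))) borel (\<lambda>z. (cmod z)\<^sup>2). ?g s)"
    by (subst integral_distr) auto
  also have "\<dots> = (LINT s|density lborel (\<lambda>s. ennreal (pi * indicator {0..<1} s)). ?g s)"
    unfolding radial_distr by (simp add: ennreal_mult' ennreal_indicator)
  also have "\<dots> = (LINT s|lborel. (pi * indicator {0..<1} s) *\<^sub>R ?g s)"
    by (subst integral_density) auto
  also have "\<dots> = (LINT s|lborel. pi * (indicator {0..<r\<^sup>2} s *\<^sub>R (s ^ a * (1 - s) ^ (n - 1))))"
    using r2 by (intro Bochner_Integration.integral_cong refl) (auto simp: indicator_def)
  also have "\<dots> = pi * (LINT s:{0..<r\<^sup>2}|lborel. s ^ a * (1 - s) ^ (n - 1))"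
    by (simp add: set_lebesgue_integral_def)
  also have "(LINT s:{0..<r\<^sup>2}|lborel. s ^ a * (1 - s) ^ (n - 1)) = (LINT s:{0..r\<^sup>2}|lborel. s ^ a * (1 - s) ^ (n - 1))"
    by (rule set_integral_cong_set) (auto simp: set_borel_measurable_def intro!: AE_I[of _ _ "{r\<^sup>2}"])
  also have "\<dots> = betaint n a r"
    unfolding betaint_def
    by (intro set_borel_integral_eq_integral borel_integrable_atLeastAtMost') (intro continuous_intros)
  finally show ?thesis .
qed

lemma betaint_bounds:
  assumes r: "0 < r" "r < 1" shows "0 \<le> betaint n a r" "betaint n a r \<le> 1"
proof -
  have r2: "r\<^sup>2 \<le> 1" using r by (simp add: power_le_one)
  have int: "(\<lambda>s::real. s ^ a * (1 - s) ^ (n - 1)) integrable_on {0..r\<^sup>2}"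
    by (intro integrable_continuous_interval continuous_intros)
  show "0 \<le> betaint n a r" unfolding betaint_def
    by (rule integral_nonneg[OF int]) (use r2 in auto)
  have "betaint n a r \<le> integral {0..r\<^sup>2} (\<lambda>s. 1)"
    unfolding betaint_def
    by (rule integral_le[OF int]) (use r2 in \<open>auto intro!: mult_le_one power_le_one\<close>)
  then show "betaint n a r \<le> 1" using r2 by simp
qed

lemma beta_integral_nat:
  assumes n: "n > 0"
  shows "integral {0..1} (\<lambda>s::real. s ^ a * (1 - s) ^ (n - 1)) = fact a * fact (n - 1) / fact (a + n)"
proof -
  have "((\<lambda>t. t powr (real a + 1 - 1) * (1 - t) powr (real n - 1)) has_integral Beta (real a + 1) (real n)) {0..1}"
    using n by (intro has_integral_Beta_real) auto
  then have "((\<lambda>s::real. s ^ a * (1 - s) ^ (n - 1)) has_integral Beta (real a + 1) (real n)) {0..1}"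
  proof (rule has_integral_spike_finite[of "{0, 1}", rotated 2])
    fix s :: real assume s: "s \<in> {0..1} - {0, 1}"
    have "(1 - s) powr (real n - 1) = (1 - s) ^ (n - 1)"
      using s n by (subst powr_realpow[symmetric]) (auto simp: of_nat_diff)
    moreover have "s powr (real a + 1 - 1) = s ^ a" using s by (simp add: powr_realpow)
    ultimately show "s ^ a * (1 - s) ^ (n - 1) = s powr (real a + 1 - 1) * (1 - s) powr (real n - 1)" by simp
  qed auto
  moreover have "Beta (real a + 1) (real n) = fact a * fact (n - 1) / fact (a + n)"
  proof -
    have "Gamma (real a + 1) = fact a" using Gamma_fact[of a, where 'a = real] by (simp add: add.commute)
    moreover have "Gamma (real n) = fact (n - 1)" using Gamma_fact[of "n - 1", where 'a = real] n by (simp add: of_nat_diff)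
    moreover have "Gamma (real a + 1 + real n) = fact (a + n)"
      using Gamma_fact[of "a + n", where 'a = real] by (simp add: add_ac)
    ultimately show ?thesis by (simp add: Beta_def)
  qed
  ultimately show ?thesis by (simp add: integral_unique)
qed

lemma betaint_tendsto:
  assumes n: "n > 0"
  shows "((\<lambda>r. betaint n a r) \<longlongrightarrow> fact a * fact (n - 1) / fact (a + n)) (at_left 1)"
proof -
  let ?f = "\<lambda>s::real. s ^ a * (1 - s) ^ (n - 1)"
  have "continuous_on {0..1} (\<lambda>x. integral {0..x} ?f)"
    by (intro indefinite_integral_continuous_1 integrable_continuous_interval continuous_intros)
  then have c: "((\<lambda>x. integral {0..x} ?f) \<longlongrightarrow> integral {0..1} ?f) (at 1 within {0..1})"
    by (auto simp: continuous_on_def)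
  have "filterlim (\<lambda>r::real. r\<^sup>2) (at 1 within {0..1}) (at_left 1)"
    unfolding filterlim_at
  proof
    show "((\<lambda>r::real. r\<^sup>2) \<longlongrightarrow> 1) (at_left 1)"
      using tendsto_power[OF tendsto_ident_at[of "1::real" "{..<1}"], of 2] by simp
    show "\<forall>\<^sub>F r::real in at_left 1. r\<^sup>2 \<in> {0..1} \<and> r\<^sup>2 \<noteq> 1"
      using eventually_at_left_real[of 0 "1::real"]
      by (auto elim!: eventually_mono simp: power_le_one power2_eq_1_iff)
  qed
  from filterlim_compose[OF c this] show ?thesis
    unfolding betaint_def[abs_def] beta_integral_nat[OF n] .
qed

section \<open>Termwise integration\<close>

lemma summable_poly_geometric:
  fixes R :: real assumes "0 \<le> R" "R < 1"
  shows "summable (\<lambda>k. (1 + real k) ^ N * R ^ k)"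
proof (cases "R = 0")
  case True
  then show ?thesis by (intro summable_finite[of "{0}"]) auto
next
  case False
  then have R: "R > 0" using assms by simp
  obtain s where s: "R < s" "s < 1" using dense[OF assms(2)] by blast
  have "(\<lambda>k. ((2 + real k) / (1 + real k)) ^ N) \<longlonglongrightarrow> 1 ^ N"
    by (intro tendsto_power) real_asymp
  moreover have "1 ^ N < s / R" using s R by simp
  ultimately have "\<forall>\<^sub>F k in sequentially. ((2 + real k) / (1 + real k)) ^ N < s / R"
    by (rule order_tendstoD)
  then obtain K where K: "\<And>k. k \<ge> K \<Longrightarrow> ((2 + real k) / (1 + real k)) ^ N < s / R"
    by (auto simp: eventually_sequentially)
  show ?thesis
  proof (rule summable_ratio_test[OF s(2), of K])
    fix k assume "k \<ge> K"
    have p: "(1 + real k) ^ N > 0" by simp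
    have "(2 + real k) ^ N * R = ((2 + real k) / (1 + real k)) ^ N * R * (1 + real k) ^ N"
      using p by (simp add: power_divide)
    also have "\<dots> \<le> (s / R) * R * (1 + real k) ^ N"
      using K[OF \<open>k \<ge> K\<close>] R by (intro mult_right_mono) auto
    also have "\<dots> = s * (1 + real k) ^ N" using R by simp
    finally have "((2 + real k) ^ N * R) * R ^ k \<le> (s * (1 + real k) ^ N) * R ^ k"
      using R by (intro mult_right_mono) auto
    then show "norm ((1 + real (Suc k)) ^ N * R ^ Suc k) \<le> s * norm ((1 + real k) ^ N * R ^ k)"
      using R by (simp add: mult_ac abs_mult)
  qed
qed

text \<open>The product of two power series and a Poisson extension is integrated against the weight \<open>w\<close> pulled back
  along \<open>\<zeta>\<close>. By hypothesis monomials with unequal exponents integrate to 0, so for each pair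
  \<open>(k, l)\<close> exactly one term of the Poisson extension contributes, the one of frequency \<open>l - k\<close>, and
  it leaves the moment with the larger of the two exponents. A general measure space is used in order to
  cover the circle and the disc at once.\<close>

lemma termwise_integration:
  fixes \<zeta> :: "'x \<Rightarrow> complex" and w :: "'x \<Rightarrow> real" and c :: "int \<Rightarrow> complex" and d :: "nat \<Rightarrow> complex" and j :: "nat \<Rightarrow> real"
  assumes [measurable]: "\<zeta> \<in> borel_measurable M" and wi: "integrable M w" and w0: "\<And>x. w x \<ge> 0"
    and \<zeta>R: "\<And>x. w x \<noteq> 0 \<Longrightarrow> cmod (\<zeta> x) \<le> R" and R: "0 \<le> R" "R < 1"
    and J: "\<And>a b. (LINT x|M. complex_of_real (w x) * (\<zeta> x ^ a * cnj (\<zeta> x) ^ b)) = (if a = b then complex_of_real (j a) else 0)"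
    and c: "\<And>k. cmod (c k) \<le> C * (1 + \<bar>of_int k\<bar>) ^ N" and d: "\<And>k. cmod (d k) \<le> D"
  defines "G \<equiv> (\<lambda>z. \<Sum>k. d k * z ^ k)"
    and "P \<equiv> (\<lambda>z. (\<Sum>k. c (int k) * z ^ k) + (\<Sum>k. c (- int (Suc k)) * cnj z ^ Suc k))"
  shows "sqsum (\<lambda>k l. d k * cnj (d l) * c (int l - int k) * complex_of_real (j (max k l)))
    \<longlonglongrightarrow> (LINT x|M. complex_of_real (w x) * (G (\<zeta> x) * cnj (G (\<zeta> x)) * P (\<zeta> x)))"
proof -
  have [measurable]: "cnj \<in> borel_measurable borel"
    by (intro borel_measurable_continuous_onI continuous_intros)
  have [measurable]: "w \<in> borel_measurable M" using wi by simp
  define g where "g n z = (\<Sum>k<n. d k * z ^ k)" for n z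
  define p where "p n z = (\<Sum>k<n. c (int k) * z ^ k) + (\<Sum>k<n. c (- int (Suc k)) * cnj z ^ Suc k)" for n z
  define u where "u k = (C * (1 + real k) ^ N) * R ^ k" for k
  define v where "v k = (C * (1 + real (Suc k)) ^ N) * R ^ Suc k" for k
  have us: "summable u"
    unfolding u_def mult.assoc by (intro summable_mult summable_poly_geometric R)
  have "v = (\<lambda>k. u (Suc k))" by (simp add: u_def v_def fun_eq_iff)
  then have vs: "summable v" using us by (simp only: summable_Suc_iff)
  have ds: "summable (\<lambda>k. D * R ^ k)" using R by (intro summable_mult summable_geometric) auto
  have gb: "cmod (d k * z ^ k) \<le> D * R ^ k" if "cmod z \<le> R" for z k
    unfolding norm_mult norm_power using that d[of k] order_trans[OF norm_ge_zero d[of k]] by (intro mult_mono power_mono) auto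
  have cb: "cmod (c (int k) * z ^ k) \<le> u k" if "cmod z \<le> R" for z k
    unfolding norm_mult norm_power u_def using that c[of "int k"] order_trans[OF norm_ge_zero c[of "int k"]]
    by (intro mult_mono power_mono) auto
  have cb': "cmod (c (- int (Suc k)) * cnj z ^ Suc k) \<le> v k" if "cmod z \<le> R" for z k
    unfolding norm_mult norm_power complex_mod_cnj v_def using that c[of "- int (Suc k)"] order_trans[OF norm_ge_zero c[of "- int (Suc k)"]]
    by (intro mult_mono power_mono) (auto simp: add_ac)
  have glim: "(\<lambda>n. g n z) \<longlonglongrightarrow> G z" if "cmod z \<le> R" for z
    unfolding g_def G_def by (intro summable_LIMSEQ summable_comparison_test'[OF ds] gb that)
  have plim: "(\<lambda>n. p n z) \<longlonglongrightarrow> P z" if "cmod z \<le> R" for z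
    unfolding p_def P_def
    by (intro tendsto_add summable_LIMSEQ summable_comparison_test'[OF us] summable_comparison_test'[OF vs] cb cb' that)
  define h where "h n x = complex_of_real (w x) * (g n (\<zeta> x) * cnj (g n (\<zeta> x)) * p n (\<zeta> x))" for n x
  define H where "H x = complex_of_real (w x) * (G (\<zeta> x) * cnj (G (\<zeta> x)) * P (\<zeta> x))" for x
  have hlim: "(\<lambda>n. h n x) \<longlonglongrightarrow> H x" for x
  proof (cases "w x = 0")
    case False
    then show ?thesis unfolding h_def H_def
      by (intro tendsto_intros glim plim \<zeta>R)
  qed (simp add: h_def H_def)
  have hm: "h n \<in> borel_measurable M" for n
    unfolding h_def[abs_def] g_def p_def by measurable
  have Hm: "H \<in> borel_measurable M"
    by (rule borel_measurable_LIMSEQ_metric[OF hm hlim])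
  define A where "A = (\<Sum>k. D * R ^ k)"
  define B where "B = (\<Sum>k. u k) + (\<Sum>k. v k)"
  have D0: "D \<ge> 0" using d[of 0] norm_ge_zero order_trans by blast
  have C0: "C \<ge> 0" using c[of 0] by (auto intro: order_trans[OF norm_ge_zero])
  have u0: "u k \<ge> 0" "v k \<ge> 0" for k using C0 R by (auto simp: u_def v_def)
  have gA: "cmod (g n z) \<le> A" if "cmod z \<le> R" for n z
  proof -
    have "cmod (g n z) \<le> (\<Sum>k<n. D * R ^ k)" unfolding g_def by (intro order.trans[OF norm_sum] sum_mono gb that)
    also have "\<dots> \<le> A" unfolding A_def using D0 R by (intro sum_le_suminf ds) auto
    finally show ?thesis .
  qed
  have pB: "cmod (p n z) \<le> B" if "cmod z \<le> R" for n z
  proof -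
    have "cmod (p n z) \<le> (\<Sum>k<n. u k) + (\<Sum>k<n. v k)"
      unfolding p_def by (intro order.trans[OF norm_triangle_ineq] add_mono order.trans[OF norm_sum] sum_mono cb cb' that)
    also have "\<dots> \<le> B" unfolding B_def using u0 by (intro add_mono sum_le_suminf us vs) auto
    finally show ?thesis .
  qed
  have hb: "cmod (h n x) \<le> w x * (A * A * B)" for n x
  proof (cases "w x = 0")
    case False
    note z = \<zeta>R[OF False]
    have "cmod (h n x) = w x * (cmod (g n (\<zeta> x)) * cmod (g n (\<zeta> x)) * cmod (p n (\<zeta> x)))"
      using w0[of x] by (simp add: h_def norm_mult)
    also have "\<dots> \<le> w x * (A * A * B)"
      using w0[of x] order_trans[OF norm_ge_zero gA[OF z]]
      by (intro mult_left_mono mult_mono gA pB z mult_nonneg_nonneg) auto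
    finally show ?thesis .
  qed (simp add: h_def)
  have lim: "(\<lambda>n. LINT x|M. h n x) \<longlonglongrightarrow> (LINT x|M. H x)"
    by (rule integral_dominated_convergence[where w = "\<lambda>x. w x * (A * A * B)"])
       (use hm Hm wi hlim hb in auto)
  have mi: "integrable M (\<lambda>x. complex_of_real (w x) * (\<zeta> x ^ a * cnj (\<zeta> x) ^ b))" for a b
  proof (rule Bochner_Integration.integrable_bound[OF wi])
    show "AE x in M. norm (complex_of_real (w x) * (\<zeta> x ^ a * cnj (\<zeta> x) ^ b)) \<le> norm (w x)"
    proof (rule AE_I2)
      fix x
      have "cmod (\<zeta> x) ^ a * cmod (\<zeta> x) ^ b \<le> 1" if "w x \<noteq> 0"
        using \<zeta>R[OF that] R by (intro mult_le_one power_le_one) auto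
      then show "norm (complex_of_real (w x) * (\<zeta> x ^ a * cnj (\<zeta> x) ^ b)) \<le> norm (w x)"
        using w0[of x] by (cases "w x = 0") (auto simp: norm_mult norm_power mult_left_le)
    qed
  qed measurable
  have "(LINT x|M. h n x) = sqsum (\<lambda>k l. d k * cnj (d l) * c (int l - int k) * complex_of_real (j (max k l))) n" for n
  proof -
    define m where "m a b x = complex_of_real (w x) * (\<zeta> x ^ a * cnj (\<zeta> x) ^ b)" for a b x
    define c' where "c' i = c (- int (Suc i))" for i
    have mint: "integrable M (m a b)" and J': "(LINT x|M. m a b x) = (if a = b then complex_of_real (j a) else 0)" for a b
      using mi[of a b] J[of a b] by (simp_all add: m_def[abs_def])
    have m_mult: "(\<zeta> x ^ k * cnj (\<zeta> x) ^ l) * m a b x = m (k + a) (l + b) x" for k l a b x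
      by (simp add: m_def power_add mult_ac)
    have hm: "h n x = (\<Sum>k<n. \<Sum>l<n. d k * cnj (d l) * ((\<Sum>i<n. c (int i) * m (k + i) l x) + (\<Sum>i<n. c' i * m k (l + Suc i) x)))" for x
    proof -
      have "h n x = g n (\<zeta> x) * cnj (g n (\<zeta> x)) * (complex_of_real (w x) * p n (\<zeta> x))"
        by (simp add: h_def mult_ac)
      also have "g n (\<zeta> x) * cnj (g n (\<zeta> x)) = (\<Sum>k<n. \<Sum>l<n. d k * cnj (d l) * (\<zeta> x ^ k * cnj (\<zeta> x) ^ l))"
        by (simp add: g_def sum_product mult_ac)
      also have "complex_of_real (w x) * p n (\<zeta> x) = (\<Sum>i<n. c (int i) * m i 0 x) + (\<Sum>i<n. c' i * m 0 (Suc i) x)"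
        by (simp add: p_def m_def c'_def distrib_left sum_distrib_left mult_ac)
      finally have "h n x = (\<Sum>k<n. \<Sum>l<n. (d k * cnj (d l) * (\<zeta> x ^ k * cnj (\<zeta> x) ^ l)) *
          ((\<Sum>i<n. c (int i) * m i 0 x) + (\<Sum>i<n. c' i * m 0 (Suc i) x)))"
        by (simp only: sum_distrib_right)
      moreover have "(d k * cnj (d l) * (\<zeta> x ^ k * cnj (\<zeta> x) ^ l)) * ((\<Sum>i<n. c (int i) * m i 0 x) + (\<Sum>i<n. c' i * m 0 (Suc i) x))
        = d k * cnj (d l) * ((\<Sum>i<n. c (int i) * m (k + i) l x) + (\<Sum>i<n. c' i * m k (l + Suc i) x))" for k l
      proof -
        have "(\<zeta> x ^ k * cnj (\<zeta> x) ^ l) * ((\<Sum>i<n. c (int i) * m i 0 x) + (\<Sum>i<n. c' i * m 0 (Suc i) x))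
          = (\<Sum>i<n. c (int i) * ((\<zeta> x ^ k * cnj (\<zeta> x) ^ l) * m i 0 x)) + (\<Sum>i<n. c' i * ((\<zeta> x ^ k * cnj (\<zeta> x) ^ l) * m 0 (Suc i) x))"
          by (simp only: distrib_left sum_distrib_left mult.left_commute)
        then show ?thesis unfolding m_mult by (simp add: mult.assoc)
      qed
      ultimately show ?thesis by simp
    qed
    have "(LINT x|M. h n x) = (\<Sum>k<n. \<Sum>l<n. d k * cnj (d l) *
        ((\<Sum>i<n. c (int i) * (LINT x|M. m (k + i) l x)) + (\<Sum>i<n. c' i * (LINT x|M. m k (l + Suc i) x))))"
      unfolding hm using mint
      by (simp add: Bochner_Integration.integral_sum Bochner_Integration.integral_add)
    also have "\<dots> = sqsum (\<lambda>k l. d k * cnj (d l) * c (int l - int k) * complex_of_real (j (max k l))) n"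
      unfolding sqsum_def
    proof (intro sum.cong refl)
      fix k l assume kl: "k \<in> {..<n}" "l \<in> {..<n}"
      have 1: "(\<Sum>i<n. c (int i) * (LINT x|M. m (k + i) l x)) = (if k \<le> l then c (int l - int k) * j l else 0)"
      proof (cases "k \<le> l")
        case True
        have "(\<Sum>i<n. c (int i) * (LINT x|M. m (k + i) l x)) = (\<Sum>i<n. if i = l - k then c (int l - int k) * j l else 0)"
          unfolding J' using True by (intro sum.cong) (auto simp: of_nat_diff)
        also have "\<dots> = c (int l - int k) * j l"
          using kl True by (subst sum.delta) auto
        finally show ?thesis using True by simp
      next
        case False
        then show ?thesis unfolding J' by (intro sum.neutral[THEN trans]) auto
      qed
      have 2: "(\<Sum>i<n. c' i * (LINT x|M. m k (l + Suc i) x)) = (if k \<le> l then 0 else c (int l - int k) * j k)"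
      proof (cases "k \<le> l")
        case False
        have "(\<Sum>i<n. c' i * (LINT x|M. m k (l + Suc i) x)) = (\<Sum>i<n. if i = k - l - 1 then c (int l - int k) * j k else 0)"
          unfolding J' c'_def using False by (intro sum.cong) (auto simp: of_nat_diff)
        also have "\<dots> = c (int l - int k) * j k"
          using kl False by (subst sum.delta) auto
        finally show ?thesis using False by simp
      next
        case True
        then show ?thesis unfolding J' by (intro sum.neutral[THEN trans]) auto
      qed
      show "d k * cnj (d l) * ((\<Sum>i<n. c (int i) * (LINT x|M. m (k + i) l x)) + (\<Sum>i<n. c' i * (LINT x|M. m k (l + Suc i) x)))
         = d k * cnj (d l) * c (int l - int k) * complex_of_real (j (max k l))"
        unfolding 1 2 by (auto simp: max_def)
    qed
    finally show ?thesis .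
  qed
  then show ?thesis using lim unfolding H_def by simp
qed

section \<open>Dirichlet integrals in terms of Taylor coefficients\<close>

text \<open>The matrix of the Dirichlet integral of order \<open>n\<close> in the basis of monomials.\<close>

definition dirichlet_matrix :: "((real \<Rightarrow> complex) \<Rightarrow> complex) \<Rightarrow> nat \<Rightarrow> nat \<Rightarrow> nat \<Rightarrow> complex" where
  "dirichlet_matrix \<mu> n k l = of_nat (min k l choose n) * fourier_coeff \<mu> (int l - int k)"

lemma fourier_coeff_diff_bound:
  assumes c: "\<And>k. cmod (c k) \<le> C * (1 + \<bar>of_int k\<bar>) ^ N" and C: "C > 0"
  shows "cmod (c (int l - int k)) \<le> C * ((1 + real k) ^ N * (1 + real l) ^ N)"
proof -
  have "(1 + \<bar>of_int (int l - int k)\<bar>) ^ N \<le> ((1 + real k) * (1 + real l)) ^ N"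
  proof (rule power_mono)
    have "\<bar>of_int (int l - int k)\<bar> \<le> real k + real l" by simp
    also have "\<dots> \<le> real k + real l + real k * real l" by simp
    finally show "1 + \<bar>of_int (int l - int k)\<bar> \<le> (1 + real k) * (1 + real l)" by (simp add: algebra_simps)
  qed auto
  then have "C * (1 + \<bar>of_int (int l - int k)\<bar>) ^ N \<le> C * ((1 + real k) ^ N * (1 + real l) ^ N)"
    using C by (simp only: power_mult_distrib mult_le_cancel_left_pos)
  then show ?thesis using c[of "int l - int k"] by linarith
qed

lemma pgrowth_dirichlet_matrix:
  assumes "\<mu> \<in> distributions" shows "pgrowth (dirichlet_matrix \<mu> n)"
proof -
  obtain C N where C: "C > 0" "\<And>k. cmod (fourier_coeff \<mu> k) \<le> C * (1 + \<bar>of_int k\<bar>) ^ N"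
    using distribution_coeff_bound[OF assms] by blast
  have "cmod (dirichlet_matrix \<mu> n k l) \<le> C * ((1 + real k) ^ (n + N) * (1 + real l) ^ (n + N))" for k l
  proof -
    have "real (min k l choose n) \<le> real (min k l) ^ n"
      using binomial_le_pow2[of "min k l" n] by (metis binomial_le_pow le_cases of_nat_le_iff of_nat_power binomial_eq_0_iff not_le of_nat_0_le_iff of_nat_0 zero_le_power)
    also have "\<dots> \<le> (1 + real k) ^ n" by (intro power_mono) auto
    also have "\<dots> \<le> (1 + real k) ^ n * (1 + real l) ^ n"
      using one_le_power[of "1 + real l" n] by (simp add: mult_left_le)
    finally have "cmod (dirichlet_matrix \<mu> n k l) \<le> ((1 + real k) ^ n * (1 + real l) ^ n) * (C * ((1 + real k) ^ N * (1 + real l) ^ N))"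
      unfolding dirichlet_matrix_def norm_mult norm_of_nat
      by (intro mult_mono fourier_coeff_diff_bound C) auto
    then show ?thesis by (simp add: power_add mult_ac)
  qed
  then show ?thesis unfolding pgrowth_def by blast
qed

text \<open>The limit \<open>r \<rightarrow> 1\<close>, common to circle and disc integrals: \<open>j r a\<close> stands for a normalised moment of
  order \<open>2 a\<close> of a rotation invariant measure on the disc of radius \<open>r\<close>. Taking the \<open>n\<close>-th derivative shifts
  the coefficients of \<open>f\<close> by \<open>n\<close> and multiplies the \<open>k\<close>-th by \<open>(k + n)! / k!\<close>. With \<open>M = max k l\<close> the product
  \<open>((k + n)! / k!) ((l + n)! / l!) (M! n! / (M + n)!)\<close> collapses to \<open>n!\<^sup>2\<close> times the binomial coefficient
  of \<open>min k l + n\<close> over \<open>n\<close>.\<close>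

lemma dirichlet_limit:
  fixes j :: "real \<Rightarrow> nat \<Rightarrow> real" and I :: "real \<Rightarrow> complex"
  assumes f: "f \<in> Da" and \<mu>: "\<mu> \<in> distributions"
    and j: "\<And>r a. r \<in> {0<..<1} \<Longrightarrow> \<bar>j r a\<bar> \<le> B"
    and jlim: "\<And>a. ((\<lambda>r. j r a) \<longlongrightarrow> fact a * fact n / fact (a + n)) (at_left 1)"
    and I: "\<And>r. r \<in> {0<..<1} \<Longrightarrow>
      sqsum (\<lambda>k l. (tcoef f (k + n) * (fact (k + n) / fact k)) * cnj (tcoef f (l + n) * (fact (l + n) / fact l)) *
        fourier_coeff \<mu> (int l - int k) * complex_of_real (j r (max k l))) \<longlonglongrightarrow> complex_of_real ((fact n)\<^sup>2) * I r"
  shows "(I \<longlongrightarrow> gform (dirichlet_matrix \<mu> n) (tcoef f) (tcoef f)) (at_left 1)"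
proof -
  define d where "d k = tcoef f (k + n) * (fact (k + n) / fact k)" for k
  define c where "c = fourier_coeff \<mu>"
  obtain C N where C: "C > 0" "\<And>k. cmod (c k) \<le> C * (1 + \<bar>of_int k\<bar>) ^ N"
    unfolding c_def using distribution_coeff_bound[OF \<mu>] by blast
  define u where "u k = cmod (d k) * (1 + real k) ^ N" for k
  define T where "T k l = dirichlet_matrix \<mu> n k l * tcoef f k * cnj (tcoef f l)" for k l
  have us: "summable u"
  proof (rule summable_comparison_test')
    show "summable (\<lambda>k. cmod (tcoef f (k + n)) * (1 + real (k + n)) ^ (n + N))"
      using rapid_summable[OF Da_rapid[OF f], of "n + N"] by (rule summable_ignore_initial_segment)
    fix k
    have "fact (k + n) \<le> fact k * (1 + real (k + n)) ^ n"
    proof (induction n)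
      case (Suc n)
      have "fact (k + Suc n) = fact (k + n) * real (k + n + 1)" by simp
      also have "\<dots> \<le> (fact k * (1 + real (k + n)) ^ n) * real (k + n + 1)" by (intro mult_right_mono Suc) auto
      also have "\<dots> \<le> (fact k * (1 + real (k + Suc n)) ^ n) * (1 + real (k + Suc n))"
        by (intro mult_mono mult_left_mono power_mono) auto
      finally show ?case by (simp add: mult_ac)
    qed simp
    then have "fact (k + n) / fact k \<le> (1 + real (k + n)) ^ n" by (simp add: field_simps)
    moreover have "(1 + real k) ^ N \<le> (1 + real (k + n)) ^ N" by (intro power_mono) auto
    ultimately have "cmod (tcoef f (k + n)) * (fact (k + n) / fact k) * (1 + real k) ^ N
      \<le> cmod (tcoef f (k + n)) * (1 + real (k + n)) ^ n * (1 + real (k + n)) ^ N"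
      by (intro mult_mono mult_left_mono) auto
    then show "norm (u k) \<le> cmod (tcoef f (k + n)) * (1 + real (k + n)) ^ (n + N)"
      by (simp add: u_def d_def norm_mult norm_divide power_add mult_ac)
  qed
  define t where "t r k l = d k * cnj (d l) * c (int l - int k) * complex_of_real (j r (max k l))" for r k l
  define t1 where "t1 k l = d k * cnj (d l) * c (int l - int k) * complex_of_real (fact (max k l) * fact n / fact (max k l + n))" for k l
  have tb: "cmod (t r k l) \<le> (B * C) * (u k * u l)" if r: "r \<in> {0<..<1}" for r k l
  proof -
    have "cmod (t r k l) = cmod (d k) * cmod (d l) * cmod (c (int l - int k)) * \<bar>j r (max k l)\<bar>"
      by (simp add: t_def norm_mult)
    also have "\<dots> \<le> cmod (d k) * cmod (d l) * (C * ((1 + real k) ^ N * (1 + real l) ^ N)) * B"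
      using fourier_coeff_diff_bound[OF C(2,1)] j[OF r] C(1) by (intro mult_mono mult_left_mono) auto
    finally show ?thesis by (simp add: u_def mult_ac)
  qed
  have t1: "t1 k l = complex_of_real ((fact n)\<^sup>2) * T (k + n) (l + n)" for k l
  proof -
    have ch: "(fact (k + n) / fact k) * (fact (l + n) / fact l) * (fact (max k l) * fact n / fact (max k l + n))
       = (fact n)\<^sup>2 * real (min (k + n) (l + n) choose n)"
    proof -
      have b: "real ((p + n) choose n) = fact (p + n) / (fact n * fact p)" for p
        by (subst binomial_fact) auto
      show ?thesis
        by (cases "k \<le> l") (simp_all add: b min_def max_def power2_eq_square field_simps)
    qed
    have "t1 k l = (tcoef f (k + n) * cnj (tcoef f (l + n)) * c (int l - int k)) *
      complex_of_real ((fact (k + n) / fact k) * (fact (l + n) / fact l) * (fact (max k l) * fact n / fact (max k l + n)))"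
      by (simp add: t1_def d_def mult_ac)
    also have "\<dots> = complex_of_real ((fact n)\<^sup>2) * T (k + n) (l + n)"
      unfolding ch by (simp add: T_def dirichlet_matrix_def c_def mult_ac)
    finally show ?thesis .
  qed
  have Tsq: "sqsum T (N + n) = sqsum (\<lambda>k l. T (k + n) (l + n)) N" for N
  proof -
    have z: "T k l = 0" if "k < n \<or> l < n" for k l
      using that by (auto simp: T_def dirichlet_matrix_def min_def)
    have sh: "(\<Sum>k<N + n. g k) = (\<Sum>k<N. g (k + n))" if "\<And>k. k < n \<Longrightarrow> g k = 0" for g :: "nat \<Rightarrow> complex"
    proof -
      have "(\<Sum>k<N + n. g k) = (\<Sum>k\<in>{n..<N + n}. g k)"
        by (rule sum.mono_neutral_right) (auto intro: that)
      also have "\<dots> = (\<Sum>k\<in>{0..<N}. g (k + n))"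
        using sum.shift_bounds_nat_ivl[of g 0 n N] by simp
      finally show ?thesis by (simp add: atLeast0LessThan)
    qed
    show ?thesis unfolding sqsum_def
      by (subst sh) (auto intro!: sum.neutral sum.cong sh simp: z)
  qed
  have "sqsum T \<longlonglongrightarrow> gform (dirichlet_matrix \<mu> n) (tcoef f) (tcoef f)"
    unfolding T_def by (intro gform_tendsto pgrowth_dirichlet_matrix \<mu> Da_rapid f)
  then have "(\<lambda>N. sqsum T (N + n)) \<longlonglongrightarrow> gform (dirichlet_matrix \<mu> n) (tcoef f) (tcoef f)"
    by (rule LIMSEQ_ignore_initial_segment)
  then have L: "sqsum t1 \<longlonglongrightarrow> complex_of_real ((fact n)\<^sup>2) * gform (dirichlet_matrix \<mu> n) (tcoef f) (tcoef f)"
    unfolding Tsq t1[abs_def] sqsum_cmult by (intro tendsto_mult_left)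
  have "((\<lambda>r. complex_of_real ((fact n)\<^sup>2) * I r) \<longlongrightarrow> complex_of_real ((fact n)\<^sup>2) * gform (dirichlet_matrix \<mu> n) (tcoef f) (tcoef f)) (at_left 1)"
  proof (rule dominated_sqsum_swap[where t = t and u = u and ?t1.0 = t1 and C = "B * C"
          and I = "\<lambda>r. complex_of_real ((fact n)\<^sup>2) * I r", OF tb us _ _ L])
    show "sqsum (t r) \<longlonglongrightarrow> complex_of_real ((fact n)\<^sup>2) * I r" if "r \<in> {0<..<1}" for r
      using I[OF that] by (simp only: t_def[abs_def] d_def c_def)
    show "((\<lambda>r. t r k l) \<longlongrightarrow> t1 k l) (at_left 1)" for k l
      unfolding t_def t1_def by (intro tendsto_intros tendsto_of_real jlim)
  qed
  from tendsto_mult_left[OF this, of "complex_of_real (1 / (fact n)\<^sup>2)"] show ?thesis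
    by simp
qed

lemma Da_deriv_coef_bounded:
  assumes f: "f \<in> Da"
  obtains D where "\<And>k. cmod (tcoef f (k + n) * (fact (k + n) / fact k)) \<le> D"
proof -
  obtain M where M: "\<And>z. z \<in> ball 0 1 \<Longrightarrow> cmod ((deriv ^^ n) f z) \<le> M" using Da_deriv_bound[OF f, of n] by blast
  have hol: "(deriv ^^ n) f holomorphic_on ball 0 1"
    by (intro holomorphic_higher_deriv DaD(1)[OF f]) simp
  have "cmod (tcoef f (k + n) * (fact (k + n) / fact k)) \<le> M" for k
  proof -
    have "tcoef f (k + n) * (fact (k + n) / fact k) = (deriv ^^ k) ((deriv ^^ n) f) 0 / fact k"
      by (simp add: tcoef_def funpow_add)
    then show ?thesis using disc_coefficient_bound[OF hol M, of k] by (simp add: norm_divide field_simps)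
  qed
  then show ?thesis by (rule that)
qed

text \<open>The moments are \<open>r\<close> to the power \<open>2 a\<close> on the circle and incomplete Beta integrals on the disc.\<close>

theorem dirichlet_int_eq:
  assumes f: "f \<in> Da" and \<mu>: "\<mu> \<in> distributions"
  shows "dirichlet_int \<mu> n f = gform (dirichlet_matrix \<mu> n) (tcoef f) (tcoef f)"
proof -
  obtain C N where C: "C > 0" "\<And>k. cmod (fourier_coeff \<mu> k) \<le> C * (1 + \<bar>of_int k\<bar>) ^ N"
    using distribution_coeff_bound[OF \<mu>] by blast
  obtain D where D: "\<And>k. cmod (tcoef f (k + n) * (fact (k + n) / fact k)) \<le> D"
    using Da_deriv_coef_bounded[OF f, of n] by blast
  define d where "d k = tcoef f (k + n) * (fact (k + n) / fact k)" for k
  have G: "(\<Sum>k. d k * z ^ k) = (deriv ^^ n) f z" if "cmod z < 1" for z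
    using higher_deriv_sums[OF f, of z n] that by (simp add: sums_iff d_def)
  have sq: "complex_of_real ((cmod w)\<^sup>2) = w * cnj w" for w by (rule complex_norm_square)
  show ?thesis
  proof (cases "n = 0")
    case True
    define I where "I r = complex_of_real (1 / (2 * pi * r)) *
          (LINT t:{0..2 * pi}|lborel.
             complex_of_real ((cmod (f (r * cis t)))\<^sup>2) * poisson_ext \<mu> (r * cis t) * r)" for r
    have "(I \<longlongrightarrow> gform (dirichlet_matrix \<mu> n) (tcoef f) (tcoef f)) (at_left 1)"
    proof (rule dirichlet_limit[OF f \<mu>, where j = "\<lambda>r a. r ^ (2 * a)" and B = 1])
      show "\<bar>r ^ (2 * a)\<bar> \<le> 1" if "r \<in> {0<..<1}" for r :: real and a
        using that by (simp add: power_le_one)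
      show "((\<lambda>r::real. r ^ (2 * a)) \<longlongrightarrow> fact a * fact n / fact (a + n)) (at_left 1)" for a
        using tendsto_power[OF tendsto_ident_at[of "1::real" "{..<1}"], of "2 * a"] True by simp
      fix r :: real assume r: "r \<in> {0<..<1}"
      define w where "w t = indicator {0..2 * pi} t / (2 * pi)" for t :: real
      define \<zeta> where "\<zeta> t = complex_of_real r * cis t" for t
      have \<zeta>m: "\<zeta> \<in> borel_measurable lborel"
        unfolding \<zeta>_def by (auto intro!: borel_measurable_continuous_onI continuous_intros)
      have J: "(LINT t|lborel. complex_of_real (w t) * (\<zeta> t ^ a * cnj (\<zeta> t) ^ b)) = (if a = b then complex_of_real (r ^ (2 * a)) else 0)" for a b
      proof -
        have e: "\<zeta> t ^ a * cnj (\<zeta> t) ^ b = complex_of_real (r ^ (a + b)) * expo (int a - int b) t" for t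
        proof -
          have "cis t ^ a * cnj (cis t) ^ b = expo (int a - int b) t"
            unfolding cis_cnj Complex.DeMoivre cis_mult expo_def by (simp add: algebra_simps)
          then show ?thesis by (simp add: \<zeta>_def power_mult_distrib power_add mult_ac)
        qed
        have si: "set_integrable lborel {0..2 * pi} (expo k)" for k
          by (intro borel_integrable_atLeastAtMost' continuous_expo)
        have "(LINT t|lborel. complex_of_real (w t) * (\<zeta> t ^ a * cnj (\<zeta> t) ^ b)) =
          (LINT t|lborel. complex_of_real (r ^ (a + b) / (2 * pi)) * (indicator {0..2 * pi} t *\<^sub>R expo (int a - int b) t))"
          by (intro Bochner_Integration.integral_cong refl) (simp add: e w_def scaleR_conv_of_real)
        also have "\<dots> = complex_of_real (r ^ (a + b) / (2 * pi)) * (LINT t:{0..2 * pi}|lborel. expo (int a - int b) t)"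
          unfolding set_lebesgue_integral_def by (rule integral_mult_right_zero)
        also have "(LINT t:{0..2 * pi}|lborel. expo (int a - int b) t) = (if a = b then 2 * pi else 0)"
          unfolding set_borel_integral_eq_integral(2)[OF si] integral_expo by simp
        finally have "(LINT t|lborel. complex_of_real (w t) * (\<zeta> t ^ a * cnj (\<zeta> t) ^ b)) =
          complex_of_real (r ^ (a + b) / (2 * pi)) * (if a = b then 2 * pi else 0)" .
        moreover have "r ^ (b + b) = r ^ (2 * b)" by (simp only: mult_2)
        ultimately show ?thesis by (cases "a = b") (simp_all del: of_real_power)
      qed
      have wi: "integrable lborel w"
      proof -
        have "integrable lborel (\<lambda>t. (1 / (2 * pi)) * indicator {0..2 * pi} t)"
          by (intro integrable_mult_right integrable_real_indicator) auto
        then show ?thesis by (simp add: w_def[abs_def])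
      qed
      have lim: "sqsum (\<lambda>k l. d k * cnj (d l) * fourier_coeff \<mu> (int l - int k) * complex_of_real (r ^ (2 * max k l)))
        \<longlonglongrightarrow> (LINT t|lborel. complex_of_real (w t) * ((\<Sum>k. d k * \<zeta> t ^ k) * cnj (\<Sum>k. d k * \<zeta> t ^ k) *
           ((\<Sum>k. fourier_coeff \<mu> (int k) * \<zeta> t ^ k) + (\<Sum>k. fourier_coeff \<mu> (- int (Suc k)) * cnj (\<zeta> t) ^ Suc k))))"
      proof (rule termwise_integration[OF \<zeta>m wi _ _ _ _ J C(2) D[folded d_def], where R = r])
        show "0 \<le> w x" for x by (simp add: w_def)
        show "cmod (\<zeta> x) \<le> r" for x using r by (simp add: \<zeta>_def norm_mult)
      qed (use r in simp_all)
      have "(LINT t|lborel. complex_of_real (w t) * ((\<Sum>k. d k * \<zeta> t ^ k) * cnj (\<Sum>k. d k * \<zeta> t ^ k) *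
           ((\<Sum>k. fourier_coeff \<mu> (int k) * \<zeta> t ^ k) + (\<Sum>k. fourier_coeff \<mu> (- int (Suc k)) * cnj (\<zeta> t) ^ Suc k))))
         = (LINT t|lborel. complex_of_real (1 / (2 * pi * r)) * (indicator {0..2 * pi} t *\<^sub>R
             (complex_of_real ((cmod (f (r * cis t)))\<^sup>2) * poisson_ext \<mu> (r * cis t) * r)))"
      proof (intro Bochner_Integration.integral_cong refl)
        fix t
        have z: "cmod (\<zeta> t) < 1" using r by (simp add: \<zeta>_def norm_mult)
        have fz: "(\<Sum>k. d k * \<zeta> t ^ k) = f (\<zeta> t)" using G[OF z] True by simp
        show "complex_of_real (w t) * ((\<Sum>k. d k * \<zeta> t ^ k) * cnj (\<Sum>k. d k * \<zeta> t ^ k) *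
           ((\<Sum>k. fourier_coeff \<mu> (int k) * \<zeta> t ^ k) + (\<Sum>k. fourier_coeff \<mu> (- int (Suc k)) * cnj (\<zeta> t) ^ Suc k)))
         = complex_of_real (1 / (2 * pi * r)) * (indicator {0..2 * pi} t *\<^sub>R
             (complex_of_real ((cmod (f (r * cis t)))\<^sup>2) * poisson_ext \<mu> (r * cis t) * r))"
          unfolding fz poisson_ext_def[symmetric] sq \<zeta>_def[symmetric]
          using r by (cases "t \<in> {0..2 * pi}") (simp_all add: w_def)
      qed
      also have "\<dots> = I r"
        unfolding I_def set_lebesgue_integral_def by (rule integral_mult_right_zero)
      finally show "sqsum (\<lambda>k l. (tcoef f (k + n) * (fact (k + n) / fact k)) * cnj (tcoef f (l + n) * (fact (l + n) / fact l)) *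
        fourier_coeff \<mu> (int l - int k) * complex_of_real (r ^ (2 * max k l))) \<longlonglongrightarrow> complex_of_real ((fact n)\<^sup>2) * I r"
        using lim True unfolding d_def by simp
    qed
    then show ?thesis
      unfolding dirichlet_int_def I_def using True by (simp add: tendsto_Lim)
  next
    case False
    then have n: "n > 0" by simp
    define I where "I r = complex_of_real (1 / (fact n * fact (n - 1) * pi)) *
          (LINT z:ball 0 r|lborel.
             complex_of_real ((cmod ((deriv ^^ n) f z))\<^sup>2) * poisson_ext \<mu> z *
             complex_of_real ((1 - (cmod z)\<^sup>2) ^ (n - 1)))" for r :: real
    define \<kappa> where "\<kappa> = (fact n / fact (n - 1) :: real)"
    have \<kappa>: "\<kappa> > 0" by (simp add: \<kappa>_def)
    have "(I \<longlongrightarrow> gform (dirichlet_matrix \<mu> n) (tcoef f) (tcoef f)) (at_left 1)"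
    proof (rule dirichlet_limit[OF f \<mu>, where j = "\<lambda>r a. \<kappa> * betaint n a r" and B = \<kappa>])
      show "\<bar>\<kappa> * betaint n a r\<bar> \<le> \<kappa>" if "r \<in> {0<..<1}" for r a
        using betaint_bounds[of r n a] that \<kappa> by (simp add: abs_mult mult_left_le)
      have e: "\<kappa> * (fact a * fact (n - 1) / fact (a + n)) = fact a * fact n / fact (a + n)" for a
        by (simp add: \<kappa>_def)
      show "((\<lambda>r. \<kappa> * betaint n a r) \<longlongrightarrow> fact a * fact n / fact (a + n)) (at_left 1)" for a
        using tendsto_mult_left[OF betaint_tendsto[OF n, of a], of \<kappa>] unfolding e .
      fix r :: real assume r: "r \<in> {0<..<1}"
      define w where "w z = \<kappa> / pi * (indicator (ball 0 r) z * (1 - (cmod z)\<^sup>2) ^ (n - 1))" for z :: complex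
      have wm: "w \<in> borel_measurable borel"
        unfolding w_def by (intro borel_measurable_times borel_measurable_indicator borel_measurable_continuous_onI continuous_intros) auto
      have ball1: "(1 - (cmod z)\<^sup>2) ^ (n - 1) \<in> {0..1}" if "z \<in> ball 0 r" for z
        using that r by (auto intro!: power_le_one simp: abs_square_le_1)
      have w0: "w z \<ge> 0" for z
        using ball1[of z] \<kappa> by (auto simp: w_def indicator_def)
      have J0: "(LINT z|lborel. complex_of_real (indicator (ball 0 r) z * (1 - (cmod z)\<^sup>2) ^ (n - 1)) * (z ^ a * cnj z ^ b)) = (if a = b then complex_of_real (pi * betaint n a r) else 0)" for a b
      proof (cases "a = b")
        case True
        then show ?thesis using radial_integral_eq[of r n a] r by simp
      next
        case False
        have "(LINT z|lborel. complex_of_real (indicator (ball 0 r) z * (1 - (cmod z)\<^sup>2) ^ (n - 1)) * (z ^ a * cnj z ^ b)) = 0"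
        proof (rule rotation_integral_zero[OF _ _ False])
          show "(\<lambda>z. indicator (ball 0 r) z * (1 - (cmod z)\<^sup>2) ^ (n - 1)) \<in> borel_measurable borel"
            by (intro borel_measurable_times borel_measurable_indicator borel_measurable_continuous_onI continuous_intros) auto
        qed (simp add: norm_mult indicator_def)
        then show ?thesis using False by simp
      qed
      have J: "(LINT z|lborel. complex_of_real (w z) * (z ^ a * cnj z ^ b)) = (if a = b then complex_of_real (\<kappa> * betaint n a r) else 0)" for a b
      proof -
        have "(LINT z|lborel. complex_of_real (w z) * (z ^ a * cnj z ^ b)) = (LINT z|lborel. complex_of_real (\<kappa> / pi) * (complex_of_real (indicator (ball 0 r) z * (1 - (cmod z)\<^sup>2) ^ (n - 1)) * (z ^ a * cnj z ^ b)))"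
          unfolding w_def by (simp only: of_real_mult mult.assoc)
        also have "\<dots> = complex_of_real (\<kappa> / pi) * (LINT z|lborel. complex_of_real (indicator (ball 0 r) z * (1 - (cmod z)\<^sup>2) ^ (n - 1)) * (z ^ a * cnj z ^ b))"
          by (rule integral_mult_right_zero)
        finally show ?thesis unfolding J0 by simp
      qed
      have wi: "integrable lborel w"
      proof (rule Bochner_Integration.integrable_bound)
        show "integrable lborel (\<lambda>z. \<kappa> / pi * indicator (ball (0::complex) r) z)"
          by (intro integrable_mult_right integrable_real_indicator) (use emeasure_bounded_finite[of "ball (0::complex) r"] in auto)
        show "AE z in lborel. norm (w z) \<le> norm (\<kappa> / pi * indicator (ball (0::complex) r) z)"
          using ball1 \<kappa> by (intro AE_I2) (auto simp: w_def indicator_def abs_mult divide_right_mono mult_left_le)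
      qed (use wm in simp)
      have lim: "sqsum (\<lambda>k l. d k * cnj (d l) * fourier_coeff \<mu> (int l - int k) * complex_of_real (\<kappa> * betaint n (max k l) r))
        \<longlonglongrightarrow> (LINT z|lborel. complex_of_real (w z) * ((\<Sum>k. d k * z ^ k) * cnj (\<Sum>k. d k * z ^ k) *
           ((\<Sum>k. fourier_coeff \<mu> (int k) * z ^ k) + (\<Sum>k. fourier_coeff \<mu> (- int (Suc k)) * cnj z ^ Suc k))))"
      proof (rule termwise_integration[OF _ wi w0 _ _ _ J C(2) D[folded d_def], where R = r])
        show "cmod x \<le> r" if "w x \<noteq> 0" for x
          using that by (simp add: w_def indicator_def split: if_splits)
      qed (use r in simp_all)
      have "(LINT z|lborel. complex_of_real (w z) * ((\<Sum>k. d k * z ^ k) * cnj (\<Sum>k. d k * z ^ k) *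
           ((\<Sum>k. fourier_coeff \<mu> (int k) * z ^ k) + (\<Sum>k. fourier_coeff \<mu> (- int (Suc k)) * cnj z ^ Suc k))))
         = (LINT z|lborel. complex_of_real (\<kappa> / pi) * (indicator (ball 0 r) z *\<^sub>R
             (complex_of_real ((cmod ((deriv ^^ n) f z))\<^sup>2) * poisson_ext \<mu> z *
             complex_of_real ((1 - (cmod z)\<^sup>2) ^ (n - 1)))))"
      proof (intro Bochner_Integration.integral_cong refl)
        fix z :: complex
        show "complex_of_real (w z) * ((\<Sum>k. d k * z ^ k) * cnj (\<Sum>k. d k * z ^ k) *
           ((\<Sum>k. fourier_coeff \<mu> (int k) * z ^ k) + (\<Sum>k. fourier_coeff \<mu> (- int (Suc k)) * cnj z ^ Suc k)))
         = complex_of_real (\<kappa> / pi) * (indicator (ball 0 r) z *\<^sub>R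
             (complex_of_real ((cmod ((deriv ^^ n) f z))\<^sup>2) * poisson_ext \<mu> z *
             complex_of_real ((1 - (cmod z)\<^sup>2) ^ (n - 1))))"
        proof (cases "z \<in> ball 0 r")
          case True
          then have z: "cmod z < 1" using r by simp
          show ?thesis
            unfolding G[OF z] poisson_ext_def[symmetric] sq w_def using True by (simp add: mult_ac)
        qed (simp add: w_def)
      qed
      also have "\<dots> = complex_of_real (\<kappa> / pi) * (LINT z:ball 0 r|lborel.
             complex_of_real ((cmod ((deriv ^^ n) f z))\<^sup>2) * poisson_ext \<mu> z *
             complex_of_real ((1 - (cmod z)\<^sup>2) ^ (n - 1)))"
        unfolding set_lebesgue_integral_def by (rule integral_mult_right_zero)
      also have "\<dots> = complex_of_real ((fact n)\<^sup>2) * I r"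
      proof -
        have "\<kappa> / pi = (fact n)\<^sup>2 * (1 / (fact n * fact (n - 1) * pi))"
          by (simp add: \<kappa>_def power2_eq_square)
        then show ?thesis unfolding I_def by (simp only: of_real_mult mult.assoc)
      qed
      finally show "sqsum (\<lambda>k l. (tcoef f (k + n) * (fact (k + n) / fact k)) * cnj (tcoef f (l + n) * (fact (l + n) / fact l)) *
        fourier_coeff \<mu> (int l - int k) * complex_of_real (\<kappa> * betaint n (max k l) r)) \<longlonglongrightarrow> complex_of_real ((fact n)\<^sup>2) * I r"
        using lim unfolding d_def by simp
    qed
    then show ?thesis
      unfolding dirichlet_int_def I_def using False by (simp add: tendsto_Lim)
  qed
qed

definition tuple_matrix :: "((real \<Rightarrow> complex) \<Rightarrow> complex) list \<Rightarrow> nat \<Rightarrow> nat \<Rightarrow> complex" where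
  "tuple_matrix \<mu> k l = (\<Sum>n<length \<mu>. dirichlet_matrix (\<mu> ! n) n k l)"

lemma pgrowth_add:
  assumes "pgrowth G" "pgrowth G'" shows "pgrowth (\<lambda>k l. G k l + G' k l)"
proof -
  obtain A n where A: "\<And>k l. cmod (G k l) \<le> A * ((1 + real k) ^ n * (1 + real l) ^ n)" using assms(1) unfolding pgrowth_def by blast
  obtain B p where B: "\<And>k l. cmod (G' k l) \<le> B * ((1 + real k) ^ p * (1 + real l) ^ p)" using assms(2) unfolding pgrowth_def by blast
  have up: "(1 + real k) ^ i * (1 + real l) ^ i \<le> (1 + real k) ^ (n + p) * (1 + real l) ^ (n + p)" if "i \<le> n + p" for k l i
    using that by (intro mult_mono power_increasing) auto
  have "cmod (G k l + G' k l) \<le> (\<bar>A\<bar> + \<bar>B\<bar>) * ((1 + real k) ^ (n + p) * (1 + real l) ^ (n + p))" for k l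
  proof -
    have "cmod (G k l) \<le> \<bar>A\<bar> * ((1 + real k) ^ (n + p) * (1 + real l) ^ (n + p))"
      by (rule order.trans[OF A]) (intro mult_mono up; simp)
    moreover have "cmod (G' k l) \<le> \<bar>B\<bar> * ((1 + real k) ^ (n + p) * (1 + real l) ^ (n + p))"
      by (rule order.trans[OF B]) (intro mult_mono up; simp)
    ultimately show ?thesis using norm_triangle_ineq[of "G k l" "G' k l"] by (simp add: distrib_right)
  qed
  then show ?thesis unfolding pgrowth_def by blast
qed

lemma pgrowth_tuple_matrix:
  assumes "set \<mu> \<subseteq> distributions" shows "pgrowth (tuple_matrix \<mu>)"
proof -
  have "pgrowth (\<lambda>k l. \<Sum>n<N. dirichlet_matrix (\<mu> ! n) n k l)" if "N \<le> length \<mu>" for N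
    using that
  proof (induction N)
    case 0
    show ?case unfolding pgrowth_def by (intro exI[of _ 0]) simp
  next
    case (Suc N)
    then have "\<mu> ! N \<in> distributions" using assms nth_mem[of N \<mu>] by auto
    then show ?case using pgrowth_add[OF Suc.IH pgrowth_dirichlet_matrix] Suc.prems by simp
  qed
  then show ?thesis unfolding tuple_matrix_def[abs_def] by blast
qed

theorem sqnorm_eq:
  assumes \<mu>: "set \<mu> \<subseteq> distributions" and f: "f \<in> Da"
  shows "sqnorm \<mu> f = gform (tuple_matrix \<mu>) (tcoef f) (tcoef f)"
proof -
  have d: "\<mu> ! n \<in> distributions" if "n < length \<mu>" for n using \<mu> nth_mem[OF that] by auto
  note r = Da_rapid[OF f]
  have "(\<lambda>N. \<Sum>n<length \<mu>. sqsum (\<lambda>k l. dirichlet_matrix (\<mu> ! n) n k l * tcoef f k * cnj (tcoef f l)) N)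
      \<longlonglongrightarrow> (\<Sum>n<length \<mu>. gform (dirichlet_matrix (\<mu> ! n) n) (tcoef f) (tcoef f))"
    by (intro tendsto_sum gform_tendsto pgrowth_dirichlet_matrix d r) simp
  moreover have "(\<Sum>n<length \<mu>. sqsum (\<lambda>k l. dirichlet_matrix (\<mu> ! n) n k l * tcoef f k * cnj (tcoef f l)) N)
      = sqsum (\<lambda>k l. tuple_matrix \<mu> k l * tcoef f k * cnj (tcoef f l)) N" for N
  proof -
    let ?X = "\<lambda>n k l. dirichlet_matrix (\<mu> ! n) n k l * tcoef f k * cnj (tcoef f l)"
    have "(\<Sum>n<length \<mu>. sqsum (?X n) N) = (\<Sum>k<N. \<Sum>n<length \<mu>. \<Sum>l<N. ?X n k l)"
      unfolding sqsum_def by (rule sum.swap)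
    also have "\<dots> = (\<Sum>k<N. \<Sum>l<N. \<Sum>n<length \<mu>. ?X n k l)"
      by (intro sum.cong refl sum.swap)
    also have "\<dots> = sqsum (\<lambda>k l. tuple_matrix \<mu> k l * tcoef f k * cnj (tcoef f l)) N"
      unfolding sqsum_def tuple_matrix_def sum_distrib_right ..
    finally show ?thesis .
  qed
  ultimately have "sqsum (\<lambda>k l. tuple_matrix \<mu> k l * tcoef f k * cnj (tcoef f l))
      \<longlonglongrightarrow> (\<Sum>n<length \<mu>. gform (dirichlet_matrix (\<mu> ! n) n) (tcoef f) (tcoef f))" by simp
  then have "gform (tuple_matrix \<mu>) (tcoef f) (tcoef f) = (\<Sum>n<length \<mu>. gform (dirichlet_matrix (\<mu> ! n) n) (tcoef f) (tcoef f))"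
    using gform_tendsto[OF pgrowth_tuple_matrix[OF \<mu>] r r] LIMSEQ_unique by blast
  then show ?thesis
    unfolding sqnorm_def using dirichlet_int_eq[OF f d] by simp
qed

section \<open>The space of an allowable tuple\<close>

lemma gform_le:
  assumes C: "\<And>k l. cmod (G k l) \<le> C * ((1 + real k) ^ n * (1 + real l) ^ n)" and a: "rapid a"
  shows "cmod (gform G a a) \<le> C * ((\<Sum>k. cmod (a k) * (1 + real k) ^ n) * (\<Sum>k. cmod (a k) * (1 + real k) ^ n))"
proof -
  define u where "u k = cmod (a k) * (1 + real k) ^ n" for k
  have us: "summable u" unfolding u_def by (rule rapid_summable[OF a])
  have C0: "C \<ge> 0" using C[of 0 0] by (auto intro: order_trans[OF norm_ge_zero])
  have G: "pgrowth G" using C unfolding pgrowth_def by blast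
  have lim: "(\<lambda>N. cmod (sqsum (\<lambda>k l. G k l * a k * cnj (a l)) N)) \<longlonglongrightarrow> cmod (gform G a a)"
    by (intro tendsto_norm gform_tendsto G a)
  have "cmod (sqsum (\<lambda>k l. G k l * a k * cnj (a l)) N) \<le> C * ((\<Sum>k. u k) * (\<Sum>k. u k))" for N
  proof -
    have "cmod (sqsum (\<lambda>k l. G k l * a k * cnj (a l)) N) \<le> (\<Sum>k<N. \<Sum>l<N. C * (u k * u l))"
      unfolding sqsum_def
    proof (intro order.trans[OF norm_sum] sum_mono)
      fix k l
      have "cmod (G k l * a k * cnj (a l)) \<le> (C * ((1 + real k) ^ n * (1 + real l) ^ n)) * cmod (a k) * cmod (a l)"
        unfolding norm_mult complex_mod_cnj by (intro mult_right_mono C) auto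
      then show "cmod (G k l * a k * cnj (a l)) \<le> C * (u k * u l)" by (simp add: u_def mult_ac)
    qed
    also have "\<dots> = C * ((\<Sum>k<N. u k) * (\<Sum>k<N. u k))"
      unfolding sum_product unfolding sum_distrib_left ..
    also have "\<dots> \<le> C * ((\<Sum>k. u k) * (\<Sum>k. u k))"
      using C0 by (intro mult_left_mono mult_mono sum_le_suminf us suminf_nonneg sum_nonneg) (auto simp: u_def)
    finally show ?thesis .
  qed
  then show ?thesis using lim unfolding u_def by (intro LIMSEQ_le_const2) auto
qed

lemma gform_unit: "pgrowth G \<Longrightarrow> gform G (\<lambda>j. if j = k then 1 else 0) (\<lambda>j. if j = l then 1 else 0) = G k l"
proof -
  assume "pgrowth G"
  let ?t = "\<lambda>i j. G i j * (if i = k then 1 else 0) * cnj (if j = l then 1 else 0)"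
  have "eventually (\<lambda>N. sqsum ?t N = G k l) sequentially"
  proof (rule eventually_sequentiallyI[of "Suc (max k l)"])
    fix N assume N: "Suc (max k l) \<le> N"
    have "sqsum ?t N = (\<Sum>i<N. \<Sum>j<N. if i = k then (if j = l then G k l else 0) else 0)"
      unfolding sqsum_def by (intro sum.cong refl) auto
    also have "\<dots> = (\<Sum>i<N. if i = k then (\<Sum>j<N. if j = l then G k l else 0) else 0)"
      by (intro sum.cong refl) auto
    also have "\<dots> = G k l"
    proof -
      have "k < N" "l < N" using N by auto
      then show ?thesis by (simp add: sum.delta)
    qed
    finally show "sqsum ?t N = G k l" .
  qed
  then have "sqsum ?t \<longlonglongrightarrow> G k l" by (rule tendsto_eventually)
  then show ?thesis unfolding gform_def by (rule limI)
qed

lemma Da_space_simps [simp]: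
  "carrier (Da_space \<mu>) = Da" "f \<oplus>\<^bsub>Da_space \<mu>\<^esub> g = (\<lambda>z. f z + g z)"
  "c \<odot>\<^bsub>Da_space \<mu>\<^esub> f = (\<lambda>z. c * f z)" "\<zero>\<^bsub>Da_space \<mu>\<^esub> = (\<lambda>z. 0)"
  by (auto simp: Da_space_def)

lemma complex_ring_uminus: "\<ominus>\<^bsub>complex_ring\<^esub> x = - (x :: complex)"
proof -
  interpret cring "complex_ring :: complex ring" by (rule cring_from_type_algebra)
  show ?thesis by (rule minus_equality) simp_all
qed

lemma module_Da_space: "module complex_ring (Da_space \<mu>)"
proof (rule moduleI)
  show "cring complex_ring" by (rule cring_from_type_algebra)
  show "abelian_group (Da_space \<mu>)"
  proof (rule abelian_groupI)
    fix f assume f: "f \<in> carrier (Da_space \<mu>)"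
    show "\<exists>g\<in>carrier (Da_space \<mu>). g \<oplus>\<^bsub>Da_space \<mu>\<^esub> f = \<zero>\<^bsub>Da_space \<mu>\<^esub>"
      using Da_cmult(1)[of f "-1"] f by (intro bexI[of _ "\<lambda>z. -1 * f z"]) auto
  qed (auto simp: Da_add Da_const algebra_simps)
qed (auto simp: Da_cmult Da_add algebra_simps)

locale allowable_tuple =
  fixes \<mu> :: "((real \<Rightarrow> complex) \<Rightarrow> complex) list" and m :: nat
  assumes allow: "allowable m \<mu>"
begin

lemma len: "length \<mu> = m" and dist: "set \<mu> \<subseteq> distributions"
  using allow by (auto simp: allowable_def)

abbreviation "P \<equiv> Da_space \<mu>"
abbreviation "B f g \<equiv> gform (tuple_matrix \<mu>) (tcoef f) (tcoef g)"

lemma sqnorm_B: "f \<in> Da \<Longrightarrow> sqnorm \<mu> f = B f f"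
  by (rule sqnorm_eq[OF dist])

text \<open>Positivity of \<open>\<parallel>M\<^sub>z f\<parallel>\<^sup>2\<close> passes to \<open>\<parallel>f\<parallel>\<^sup>2\<close> through the upper bound in the definition of an allowable
  tuple.\<close>

lemma sqnorm_nonneg: assumes f: "f \<in> Da" shows "0 \<le> sqnorm \<mu> f"
proof -
  obtain C where C: "C > 0" "0 \<le> sqnorm \<mu> (Mz f)" "sqnorm \<mu> (Mz f) \<le> complex_of_real (C\<^sup>2) * sqnorm \<mu> f"
    using allow f unfolding allowable_def by blast
  then have "0 \<le> complex_of_real (C\<^sup>2) * sqnorm \<mu> f" by (rule_tac order.trans)
  moreover have "C\<^sup>2 > 0" using C by simp
  ultimately show ?thesis
    by (simp add: less_eq_complex_def zero_le_mult_iff del: of_real_power)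
qed

lemma B_expand:
  assumes f: "f \<in> Da" and g: "g \<in> Da"
  shows "sqnorm \<mu> (\<lambda>z. f z + c * g z) = B f f + cnj c * B f g + c * B g f + c * cnj c * B g g"
proof -
  note r = Da_rapid[OF f] Da_rapid[OF g] rapid_cmult[OF Da_rapid[OF g]]
  note G = pgrowth_tuple_matrix[OF dist]
  show ?thesis
    using f g
    by (simp add: sqnorm_B Da_add Da_cmult gform_add_left[OF G] gform_add_right[OF G] r rapid_add
        gform_cmult_left[OF G] gform_cmult_right[OF G] algebra_simps)
qed

lemma cinner_P: assumes f: "f \<in> Da" and g: "g \<in> Da" shows "cinner P f g = B f g"
proof -
  have "cinner P f g = (\<Sum>k<4. \<i> ^ k * sqnorm \<mu> (\<lambda>z. f z + \<i> ^ k * g z)) / 4"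
    by (simp add: Da_space_def)
  also have "\<dots> = B f g"
    unfolding B_expand[OF f g] by (simp add: eval_nat_numeral algebra_simps)
  finally show ?thesis .
qed

text \<open>A sesquilinear form with real values on the diagonal is Hermitian.\<close>

lemma B_herm: assumes f: "f \<in> Da" and g: "g \<in> Da" shows "B g f = cnj (B f g)"
proof -
  have re: "Im (sqnorm \<mu> (\<lambda>z. f z + c * g z)) = 0" for c
    using sqnorm_nonneg[OF Da_add(1)[OF f Da_cmult(1)[OF g]], of c] by (simp add: less_eq_complex_def)
  have "Im (B f f) = 0" "Im (B g g) = 0"
    using sqnorm_nonneg[OF f] sqnorm_nonneg[OF g] sqnorm_B[OF f] sqnorm_B[OF g] by (auto simp: less_eq_complex_def)
  then show ?thesis
    using re[of 1] re[of \<i>] unfolding B_expand[OF f g] by (auto simp: complex_eq_iff)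
qed

sublocale semi_inner_space "Da_space \<mu>"
proof (intro semi_inner_space.intro module_Da_space semi_inner_space_axioms.intro)
  note G = pgrowth_tuple_matrix[OF dist]
  fix f g h assume "f \<in> carrier P" "g \<in> carrier P" "h \<in> carrier P"
  then have *: "f \<in> Da" "g \<in> Da" "h \<in> Da" by auto
  show "cinner P (f \<oplus>\<^bsub>P\<^esub> g) h = cinner P f h + cinner P g h"
    using * by (simp add: cinner_P Da_add gform_add_left[OF G] Da_rapid)
next
  note G = pgrowth_tuple_matrix[OF dist]
  fix c f g assume "f \<in> carrier P" "g \<in> carrier P"
  then have *: "f \<in> Da" "g \<in> Da" by auto
  show "cinner P g f = cnj (cinner P f g)"
    using * B_herm[of f g] by (simp only: cinner_P)
  show "cinner P (c \<odot>\<^bsub>P\<^esub> f) g = c * cinner P f g"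
    using * by (simp add: cinner_P Da_cmult gform_cmult_left[OF G] Da_rapid)
next
  fix f assume "f \<in> carrier P"
  then show "0 \<le> cinner P f f" using sqnorm_nonneg[of f] by (simp add: cinner_P sqnorm_B)
qed

lemma P_diff: assumes "f \<in> Da" "g \<in> Da" shows "f \<ominus>\<^bsub>P\<^esub> g = (\<lambda>z. f z + (-1) * g z)"
proof -
  have "\<ominus>\<^bsub>P\<^esub> g = (\<ominus>\<^bsub>complex_ring\<^esub> 1) \<odot>\<^bsub>P\<^esub> g"
    using smult_l_minus[of 1 g] smult_one[of g] assms by simp
  then show ?thesis by (simp add: a_minus_def complex_ring_uminus)
qed

lemma Mz_linear: "linear_op P P Mz"
  by (auto simp: linear_op_def Da_Mz) (auto simp: Mz_def algebra_simps)

lemma Mz_bounded: obtains C where "\<And>f. f \<in> carrier P \<Longrightarrow> hnorm P (Mz f) \<le> C * hnorm P f"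
proof -
  obtain C :: real where C: "C > 0" "\<forall>f\<in>Da. 0 \<le> sqnorm \<mu> (Mz f) \<and> sqnorm \<mu> (Mz f) \<le> complex_of_real (C\<^sup>2) * sqnorm \<mu> f"
    using allow unfolding allowable_def by blast
  have sq: "(hnorm P f)\<^sup>2 = Re (sqnorm \<mu> f)" if "f \<in> Da" for f
    using that hnorm_sq[of f] by (simp add: cinner_P sqnorm_B)
  have "hnorm P (Mz f) \<le> C * hnorm P f" if "f \<in> carrier P" for f
  proof -
    have f: "f \<in> Da" using that by simp
    have "sqnorm \<mu> (Mz f) \<le> complex_of_real (C\<^sup>2) * sqnorm \<mu> f" using C(2) f by blast
    then have "Re (sqnorm \<mu> (Mz f)) \<le> C\<^sup>2 * Re (sqnorm \<mu> f)"
      by (simp add: less_eq_complex_def del: of_real_power)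
    then have "(hnorm P (Mz f))\<^sup>2 \<le> (C * hnorm P f)\<^sup>2"
      unfolding power_mult_distrib sq[OF f] sq[OF Da_Mz(1)[OF f]] .
    moreover have "0 \<le> C * hnorm P f" using C(1) hnorm_nonneg[of f] f by simp
    ultimately show ?thesis by (rule power2_le_imp_le)
  qed
  then show ?thesis by (rule that)
qed

lemma tcoef_lincomb: "lincomb (\<lambda>k z. z ^ k) c N \<in> Da \<and> tcoef (lincomb (\<lambda>k z. z ^ k) c N) = (\<lambda>k. if k < N then c k else 0)"
proof (induction N)
  case 0
  show ?case using Da_const[of 0] by (simp add: fun_eq_iff)
next
  case (Suc N)
  have m: "(\<lambda>z. c N * z ^ N) \<in> Da" by (intro Da_cmult Da_power)
  show ?case
    using Suc m Da_add[OF conjunct1[OF Suc] m] Da_cmult(2)[OF Da_power(1)[of N], of "c N"]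
    by (auto simp: fun_eq_iff Da_power less_Suc_eq)
qed

text \<open>Taylor polynomials approximate in the seminorm, since it is dominated by weighted
  \<open>l\<^sup>1\<close>-norms of the coefficients.\<close>

lemma power_total: "total_seq (\<lambda>k z. z ^ k)"
  unfolding total_seq_def
proof (intro conjI allI ballI impI)
  fix f and e :: real assume "f \<in> carrier P" and e: "e > 0"
  then have f: "f \<in> Da" by simp
  obtain C n where C: "\<And>k l. cmod (tuple_matrix \<mu> k l) \<le> C * ((1 + real k) ^ n * (1 + real l) ^ n)"
    using pgrowth_tuple_matrix[OF dist] unfolding pgrowth_def by blast
  define u where "u k = cmod (tcoef f k) * (1 + real k) ^ n" for k
  have us: "summable u" unfolding u_def by (rule rapid_summable[OF Da_rapid[OF f]])
  define p where "p N = lincomb (\<lambda>k z. z ^ k) (tcoef f) N" for N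
  have p: "p N \<in> Da" "tcoef (p N) = (\<lambda>k. if k < N then tcoef f k else 0)" for N
    using tcoef_lincomb[of "tcoef f" N] by (auto simp: p_def)
  define R where "R N = (\<Sum>k. u k) - (\<Sum>k<N. u k)" for N
  have b: "(hnorm P (f \<ominus>\<^bsub>P\<^esub> p N))\<^sup>2 \<le> C * (R N * R N)" for N
  proof -
    define t where "t k = (if k < N then 0 else tcoef f k)" for k
    have d: "f \<ominus>\<^bsub>P\<^esub> p N \<in> Da"
      unfolding P_diff[OF f p(1)] by (intro Da_add f Da_cmult p)
    have "tcoef (f \<ominus>\<^bsub>P\<^esub> p N) = t"
      using f p by (simp only: P_diff Da_add(2)[OF f Da_cmult(1)[OF p(1)]] Da_cmult(2)[OF p(1)]) (auto simp: t_def fun_eq_iff)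
    then have tt: "rapid t" "cinner P (f \<ominus>\<^bsub>P\<^esub> p N) (f \<ominus>\<^bsub>P\<^esub> p N) = gform (tuple_matrix \<mu>) t t"
      using Da_rapid[OF d] cinner_P[OF d d] by simp_all
    note \<open>rapid t\<close>
    have "(hnorm P (f \<ominus>\<^bsub>P\<^esub> p N))\<^sup>2 = Re (gform (tuple_matrix \<mu>) t t)"
      using hnorm_sq[of "f \<ominus>\<^bsub>P\<^esub> p N"] d tt(2) by simp
    also have "\<dots> \<le> cmod (gform (tuple_matrix \<mu>) t t)" by (rule complex_Re_le_cmod)
    also have "cmod (gform (tuple_matrix \<mu>) t t) \<le> C * ((\<Sum>k. cmod (t k) * (1 + real k) ^ n) * (\<Sum>k. cmod (t k) * (1 + real k) ^ n))"
      by (rule gform_le[OF C \<open>rapid t\<close>])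
    also have "(\<Sum>k. cmod (t k) * (1 + real k) ^ n) = R N"
    proof -
      have ts: "summable (\<lambda>k. cmod (t k) * (1 + real k) ^ n)" by (rule rapid_summable[OF \<open>rapid t\<close>])
      have "(\<Sum>k. cmod (t k) * (1 + real k) ^ n) = (\<Sum>k. cmod (t (k + N)) * (1 + real (k + N)) ^ n) + (\<Sum>k<N. cmod (t k) * (1 + real k) ^ n)"
        by (rule suminf_split_initial_segment[OF ts])
      moreover have "(\<Sum>k<N. cmod (t k) * (1 + real k) ^ n) = 0" by (intro sum.neutral) (auto simp: t_def)
      moreover have "(\<Sum>k. cmod (t (k + N)) * (1 + real (k + N)) ^ n) = (\<Sum>k. u (k + N))"
        by (simp add: t_def u_def)
      ultimately show ?thesis using suminf_split_initial_segment[OF us, of N] by (simp add: R_def)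
    qed
    finally show ?thesis .
  qed
  have "(\<lambda>N. C * (R N * R N)) \<longlonglongrightarrow> C * (((\<Sum>k. u k) - (\<Sum>k. u k)) * ((\<Sum>k. u k) - (\<Sum>k. u k)))"
    unfolding R_def by (intro tendsto_intros summable_LIMSEQ us)
  then have "\<forall>\<^sub>F N in sequentially. C * (R N * R N) < e\<^sup>2"
    using e by (intro order_tendstoD) auto
  then obtain N where N: "C * (R N * R N) < e\<^sup>2" by (auto simp: eventually_sequentially)
  have "(hnorm P (f \<ominus>\<^bsub>P\<^esub> p N))\<^sup>2 < e\<^sup>2" using b[of N] N by linarith
  then have "hnorm P (f \<ominus>\<^bsub>P\<^esub> p N) < e" using e by (simp add: power_less_imp_less_base)
  then show "\<exists>c n. hnorm P (f \<ominus>\<^bsub>P\<^esub> lincomb (\<lambda>k z. z ^ k) c n) < e" unfolding p_def by blast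
qed (simp add: Da_power)

abbreviation "zp k \<equiv> D2_class \<mu> (\<lambda>z. z ^ k)"

lemma D2_hilbert: "hilbert (D2 \<mu>)"
  unfolding D2_def by (rule completion_hilbert)

lemma D2_total: "semi_inner_space.total_seq (D2 \<mu>) zp"
  unfolding D2_def D2_class_def by (rule completion_total[OF power_total])

lemma D2_class_in: "f \<in> Da \<Longrightarrow> D2_class \<mu> f \<in> carrier (D2 \<mu>)"
  unfolding D2_def D2_class_def by (rule to_completion_in) simp

lemma cinner_D2_class: "f \<in> Da \<Longrightarrow> g \<in> Da \<Longrightarrow> cinner (D2 \<mu>) (D2_class \<mu> f) (D2_class \<mu> g) = B f g"
  unfolding D2_def D2_class_def by (simp add: cinner_to_completion cinner_P)

lemma D2_gram: "cinner (D2 \<mu>) (zp k) (zp l) = tuple_matrix \<mu> k l"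
  by (simp add: cinner_D2_class Da_power gform_unit pgrowth_tuple_matrix[OF dist])

text \<open>\<open>M\<^sub>z\<close> is bounded for the seminorm and so acts on the completion. The extension is unique because classes of
  polynomials are dense.\<close>

lemma M_op_props:
  "M_op \<mu> \<in> extensional (carrier (D2 \<mu>))" "bounded_op (D2 \<mu>) (D2 \<mu>) (M_op \<mu>)"
  "f \<in> Da \<Longrightarrow> M_op \<mu> (D2_class \<mu> f) = D2_class \<mu> (Mz f)"
proof -
  interpret K: hilbert "D2 \<mu>" by (rule D2_hilbert)
  obtain C where C: "\<And>f. f \<in> carrier P \<Longrightarrow> hnorm P (Mz f) \<le> C * hnorm P f" using Mz_bounded by blast
  let ?Q = "\<lambda>M. M \<in> extensional (carrier (D2 \<mu>)) \<and> bounded_op (D2 \<mu>) (D2 \<mu>) M \<and> (\<forall>f\<in>Da. M (D2_class \<mu> f) = D2_class \<mu> (Mz f))"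
  obtain M where M: "M \<in> extensional (carrier (completion P))" "bounded_op (completion P) (completion P) M"
    "\<And>f. f \<in> carrier P \<Longrightarrow> M (to_completion P f) = to_completion P (Mz f)"
    using completion_extend_op[OF Mz_linear C] by blast
  have QM: "?Q M" using M by (simp add: D2_def D2_class_def)
  have "N = M" if "?Q N" for N
  proof (rule extensionalityI[of _ "carrier (D2 \<mu>)"])
    fix h assume h: "h \<in> carrier (D2 \<mu>)"
    show "N h = M h"
    proof (rule bounded_op_eq_on_total[OF _ _ K.semi_inner_space_axioms K.inner_space_axioms D2_total _ h])
      show "N (zp k) = M (zp k)" for k
        using that QM Da_power(1)[of k] by simp
    qed (use that QM in auto)
  qed (use that QM in auto)
  then have "?Q (M_op \<mu>)" unfolding M_op_def using QM theI[of ?Q M] by blast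
  then show "M_op \<mu> \<in> extensional (carrier (D2 \<mu>))" "bounded_op (D2 \<mu>) (D2 \<mu>) (M_op \<mu>)"
    "f \<in> Da \<Longrightarrow> M_op \<mu> (D2_class \<mu> f) = D2_class \<mu> (Mz f)" by auto
qed

lemma M_op_zp: "M_op \<mu> (zp k) = zp (Suc k)"
  using M_op_props(3)[OF Da_power(1)[of k]] by (simp add: Mz_def)

lemma M_op_pow_zp: "(M_op \<mu> ^^ j) (zp k) = zp (k + j)"
  by (induction j) (auto simp: M_op_zp)

lemma M_op_pow_1: "(M_op \<mu> ^^ k) (D2_class \<mu> (\<lambda>z. 1)) = zp k"
  using M_op_pow_zp[of k 0] by simp

end

section \<open>Powers of a bounded operator\<close>

lemma bounded_op_comp:
  assumes S: "bounded_op H K S" and T: "bounded_op K L T" and K: "semi_inner_space K"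
  shows "bounded_op H L (\<lambda>x. T (S x))"
proof -
  note SD = linear_opD[OF bounded_op_linear[OF S]] and TD = linear_opD[OF bounded_op_linear[OF T]]
  obtain A where A: "\<And>x. x \<in> carrier H \<Longrightarrow> hnorm K (S x) \<le> A * hnorm H x" using S by (auto simp: bounded_op_def)
  obtain B where B: "B > 0" "\<And>x. x \<in> carrier K \<Longrightarrow> hnorm L (T x) \<le> B * hnorm K x"
    using bounded_op_bound[OF T K] by blast
  have "hnorm L (T (S x)) \<le> (B * A) * hnorm H x" if "x \<in> carrier H" for x
  proof -
    have "hnorm L (T (S x)) \<le> B * hnorm K (S x)" using B(2) SD(1) that by blast
    also have "\<dots> \<le> B * (A * hnorm H x)" using A[OF that] B(1) by simp
    finally show ?thesis by (simp add: mult.assoc)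
  qed
  moreover have "linear_op H L (\<lambda>x. T (S x))"
    using SD TD by (auto simp: linear_op_def)
  ultimately show ?thesis by (auto simp: bounded_op_def)
qed

lemma bounded_op_funpow:
  assumes "bounded_op H H T" "semi_inner_space H" shows "bounded_op H H (T ^^ j)"
proof (induction j)
  case 0
  show ?case by (auto simp: bounded_op_def linear_op_def intro: exI[of _ 1])
next
  case (Suc j)
  show ?case using bounded_op_comp[OF Suc assms] by (simp add: o_def)
qed

lemma (in semi_inner_space) cinner_lincomb:
  assumes "\<And>k. x k \<in> carrier P" "\<And>k. y k \<in> carrier P"
  shows "cinner P (lincomb x c n) (lincomb y d p) = (\<Sum>k<n. \<Sum>l<p. c k * cnj (d l) * cinner P (x k) (y l))"
proof -
  have "cinner P (lincomb x c n) (lincomb y d p) = (\<Sum>k<n. c k * cinner P (x k) (lincomb y d p))"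
    using assms by (intro cinner_lincomb_left lincomb_closed)
  also have "\<dots> = (\<Sum>k<n. \<Sum>l<p. c k * cnj (d l) * cinner P (x k) (y l))"
    by (intro sum.cong refl, subst cinner_lincomb_right) (use assms in \<open>simp_all add: sum_distrib_left mult.assoc\<close>)
  finally show ?thesis .
qed

text \<open>The defect form is sesquilinear and continuous, hence determined by its values on a total sequence.\<close>

lemma m_isometry_on_total:
  assumes H: "hilbert H" and T: "bounded_op H H T" and x: "semi_inner_space.total_seq H x"
    and eq: "\<And>k l. (\<Sum>j\<le>m. (-1) ^ (m - j) * of_nat (m choose j) * cinner H ((T ^^ j) (x k)) ((T ^^ j) (x l))) = 0"
  shows "m_isometry H m T"
proof -
  interpret H: hilbert H by fact
  note S = H.semi_inner_space_axioms
  note xc = H.total_carrier[OF x]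
  note Tj = bounded_op_funpow[OF T S]
  have TD: "(T ^^ j) v \<in> carrier H" if "v \<in> carrier H" for j v
    using linear_opD(1)[OF bounded_op_linear[OF Tj] that] .
  let ?a = "\<lambda>j. (-1) ^ (m - j) * of_nat (m choose j) :: complex"
  have lc: "(\<Sum>j\<le>m. ?a j * cinner H ((T ^^ j) (H.lincomb x c n)) ((T ^^ j) (H.lincomb x c' n'))) = 0" for c n c' n'
  proof -
    have "(\<Sum>j\<le>m. ?a j * cinner H ((T ^^ j) (H.lincomb x c n)) ((T ^^ j) (H.lincomb x c' n')))
      = (\<Sum>j\<le>m. \<Sum>k<n. \<Sum>l<n'. (c k * cnj (c' l)) * (?a j * cinner H ((T ^^ j) (x k)) ((T ^^ j) (x l))))"
      by (intro sum.cong refl)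
        (simp add: linear_op_lincomb[OF bounded_op_linear[OF Tj] S S xc] H.cinner_lincomb TD xc
          sum_distrib_left mult_ac)
    also have "\<dots> = (\<Sum>k<n. \<Sum>j\<le>m. \<Sum>l<n'. (c k * cnj (c' l)) * (?a j * cinner H ((T ^^ j) (x k)) ((T ^^ j) (x l))))"
      by (rule sum.swap)
    also have "\<dots> = (\<Sum>k<n. \<Sum>l<n'. \<Sum>j\<le>m. (c k * cnj (c' l)) * (?a j * cinner H ((T ^^ j) (x k)) ((T ^^ j) (x l))))"
      by (intro sum.cong refl sum.swap)
    also have "\<dots> = 0"
      unfolding sum_distrib_left[symmetric] eq by simp
    finally show ?thesis .
  qed
  have "(\<Sum>j\<le>m. ?a j * cinner H ((T ^^ j) v) ((T ^^ j) w)) = 0" if v: "v \<in> carrier H" and w: "w \<in> carrier H" for v w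
  proof -
    obtain c n where 1: "H.hconv (\<lambda>i. H.lincomb x (c i) (n i)) v" using H.total_approx[OF x v] .
    obtain c' n' where 2: "H.hconv (\<lambda>i. H.lincomb x (c' i) (n' i)) w" using H.total_approx[OF x w] .
    have "(\<lambda>i. \<Sum>j\<le>m. ?a j * cinner H ((T ^^ j) (H.lincomb x (c i) (n i))) ((T ^^ j) (H.lincomb x (c' i) (n' i))))
       \<longlonglongrightarrow> (\<Sum>j\<le>m. ?a j * cinner H ((T ^^ j) v) ((T ^^ j) w))"
      by (intro tendsto_sum tendsto_mult_left H.hconv_cinner hconv_image[OF Tj S S] 1 2)
    then have "0 = (\<Sum>j\<le>m. ?a j * cinner H ((T ^^ j) v) ((T ^^ j) w))"
      unfolding lc LIMSEQ_const_iff .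
    then show ?thesis by (rule sym)
  qed
  then show ?thesis using H T by (simp add: m_isometry_iff)
qed

text \<open>Binomial coefficients of lower index \<open>n\<close> are polynomials of degree \<open>n\<close> in the upper one, and an
  \<open>m\<close>-th difference annihilates polynomials of smaller degree.\<close>

lemma choose_difference_zero:
  assumes "n < m"
  shows "(\<Sum>j\<le>m. (-1) ^ (m - j) * of_nat (m choose j) * (of_nat ((a + j) choose n) * c)) = (0 :: complex)"
  using fdiff_pow_formula[of m "\<lambda>k. of_nat (k choose n) * c" a] fdiff_choose[of m n c] assms by simp

context allowable_tuple
begin

text \<open>Along each diagonal the Gram matrix of the monomials combines the binomial coefficients of lower index
  \<open>n < m\<close>.\<close>

theorem M_op_m_isometry: "m_isometry (D2 \<mu>) m (M_op \<mu>)"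
proof (rule m_isometry_on_total[OF D2_hilbert M_op_props(2) D2_total])
  fix k l
  have "tuple_matrix \<mu> (k + j) (l + j) = (\<Sum>n<m. of_nat ((min k l + j) choose n) * fourier_coeff (\<mu> ! n) (int l - int k))" for j
    by (simp add: tuple_matrix_def dirichlet_matrix_def len min_add_distrib_left)
  then have "(\<Sum>j\<le>m. (-1) ^ (m - j) * of_nat (m choose j) * cinner (D2 \<mu>) ((M_op \<mu> ^^ j) (zp k)) ((M_op \<mu> ^^ j) (zp l)))
    = (\<Sum>j\<le>m. \<Sum>n<m. (-1) ^ (m - j) * of_nat (m choose j) * (of_nat ((min k l + j) choose n) * fourier_coeff (\<mu> ! n) (int l - int k)))"
    by (simp add: M_op_pow_zp D2_gram sum_distrib_left)
  also have "\<dots> = (\<Sum>n<m. \<Sum>j\<le>m. (-1) ^ (m - j) * of_nat (m choose j) * (of_nat ((min k l + j) choose n) * fourier_coeff (\<mu> ! n) (int l - int k)))"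
    by (rule sum.swap)
  also have "\<dots> = 0" by (intro sum.neutral ballI choose_difference_zero) simp
  finally show "(\<Sum>j\<le>m. (-1) ^ (m - j) * of_nat (m choose j) * cinner (D2 \<mu>) ((M_op \<mu> ^^ j) (zp k)) ((M_op \<mu> ^^ j) (zp l))) = 0" .
qed

lemma one_cyclic: "cyclic_vector (D2 \<mu>) (M_op \<mu>) (D2_class \<mu> (\<lambda>z. 1))"
proof -
  interpret K: hilbert "D2 \<mu>" by (rule D2_hilbert)
  show ?thesis
    using D2_total D2_class_in[OF Da_const(1)] linear_opD(1)[OF bounded_op_linear[OF M_op_props(2)]]
    by (subst K.cyclic_vector_iff) (auto simp: M_op_pow_1)
qed

lemma one_norm:
  assumes "m \<ge> 1" "fourier_coeff (\<mu> ! 0) 0 = 1"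
  shows "hnorm (D2 \<mu>) (D2_class \<mu> (\<lambda>z. 1)) = 1"
proof -
  have "tuple_matrix \<mu> 0 0 = (\<Sum>n<m. if n = 0 then 1 else 0)"
    unfolding tuple_matrix_def len using assms(2) by (intro sum.cong refl) (auto simp: dirichlet_matrix_def)
  also have "\<dots> = 1" using assms(1) by simp
  finally show ?thesis using D2_gram[of 0 0] by (simp add: hnorm_def)
qed

end

section \<open>The tuple of an \<open>m\<close>-isometry with a distinguished vector\<close>

locale m_isometry_vector =
  fixes H :: "'a hilb" and m :: nat and T :: "'a \<Rightarrow> 'a" and e :: 'a
  assumes iso: "m_isometry H m T" and e: "e \<in> carrier H"
begin

lemma H: "hilbert H" and T: "bounded_op H H T"
  using iso by (auto simp: m_isometry_iff)

sublocale H: hilbert H by (rule H)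

abbreviation "x k \<equiv> (T ^^ k) e"
abbreviation "gram k l \<equiv> cinner H (x k) (x l)"
definition "coef n d = cinner H (beta H T n e) (x d)"

lemma T_in: "v \<in> carrier H \<Longrightarrow> T v \<in> carrier H"
  using linear_opD(1)[OF bounded_op_linear[OF T]] .

lemma x_in: "x k \<in> carrier H"
  using funpow_carrier[of "carrier H" T e] T_in e by blast

lemma x_add: "(T ^^ j) (x k) = x (k + j)"
  by (simp add: funpow_add add.commute)

text \<open>Shifting both vectors of \<open>\<langle>T\<^sup>i e, T\<^sup>i\<^sup>+\<^sup>d e\<rangle>\<close> by \<open>T\<close> moves along the diagonal of offset \<open>d\<close> in the Gram
  matrix, so \<open>\<beta>\<^sub>n\<close> is an \<open>n\<close>-th difference along that diagonal.\<close>

lemma coef_eq: "coef n d = (fdiff ^^ n) (\<lambda>i. gram i (i + d)) 0"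
  unfolding coef_def cinner_beta[OF T H e x_in] fdiff_pow_formula by (simp add: x_add add.commute)

lemma gram_difference_zero:
  assumes "m \<le> n" shows "(fdiff ^^ n) (\<lambda>i. gram i (i + d)) k = 0"
proof -
  have z: "(fdiff ^^ m) (\<lambda>i. gram i (i + d)) = (\<lambda>k. 0)"
  proof
    fix k
    have "(\<Sum>j\<le>m. (-1) ^ (m - j) * of_nat (m choose j) * cinner H ((T ^^ j) (x k)) ((T ^^ j) (x (k + d)))) = 0"
      using iso x_in unfolding m_isometry_iff by blast
    then show "(fdiff ^^ m) (\<lambda>i. gram i (i + d)) k = 0"
      unfolding fdiff_pow_formula x_add by (simp add: add_ac)
  qed
  have z': "(fdiff ^^ p) (\<lambda>k. 0) = (\<lambda>k. 0)" for p
    by (induction p) (auto simp: fdiff_def fun_eq_iff)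
  have "(fdiff ^^ (a + b)) g = (fdiff ^^ a) ((fdiff ^^ b) g)" for a b g
    by (simp add: funpow_add)
  from this[of "n - m" m "\<lambda>i. gram i (i + d)"]
  have "(fdiff ^^ ((n - m) + m)) (\<lambda>i. gram i (i + d)) = (\<lambda>k. 0)"
    unfolding z z' .
  then show ?thesis using assms by simp
qed

text \<open>Newton's forward difference formula along the diagonal of offset \<open>d\<close>. Differences of order \<open>m\<close> and
  above vanish, so at most \<open>m\<close> terms remain.\<close>

lemma gram_eq: "gram k (k + d) = (\<Sum>n<m. of_nat (k choose n) * coef n d)"
proof -
  have "gram k (k + d) = (\<Sum>n\<le>k. of_nat (k choose n) * coef n d)"
    unfolding coef_eq by (rule newton_forward)
  also have "\<dots> = (\<Sum>n\<in>{..k} \<inter> {..<m}. of_nat (k choose n) * coef n d)"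
  proof (rule sum.mono_neutral_right)
    show "\<forall>n\<in>{..k} - {..k} \<inter> {..<m}. of_nat (k choose n) * coef n d = 0"
    proof
      fix n assume "n \<in> {..k} - {..k} \<inter> {..<m}"
      then have "m \<le> n" by auto
      then have "coef n d = 0" unfolding coef_eq by (rule gram_difference_zero)
      then show "of_nat (k choose n) * coef n d = 0" by simp
    qed
  qed auto
  also have "\<dots> = (\<Sum>n<m. of_nat (k choose n) * coef n d)"
  proof (rule sum.mono_neutral_left)
    show "\<forall>n\<in>{..<m} - {..k} \<inter> {..<m}. of_nat (k choose n) * coef n d = 0"
      by (auto simp: not_le)
  qed auto
  finally show ?thesis .
qed

lemma coef_0_real: "cnj (coef n 0) = coef n 0"
proof -
  have "cnj (gram i i) = gram i i" for i
    using H.cinner_herm[OF x_in x_in, of i i] by simp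
  then show ?thesis unfolding coef_eq fdiff_pow_formula by simp
qed

text \<open>By Newton's formula \<open>\<parallel>T\<^sup>k e\<parallel>\<^sup>2\<close> is a polynomial in \<open>k\<close>. Boundedness of \<open>T\<close> alone would only give
  exponential growth, which is too much for Fourier coefficients of distributions.\<close>

lemma x_growth: obtains A where "\<And>k. hnorm H (x k) \<le> A * (1 + real k) ^ m"
proof -
  define A where "A = (\<Sum>n<m. cmod (coef n 0))"
  have "hnorm H (x k) \<le> (A + 1) * (1 + real k) ^ m" for k
  proof -
    have "(hnorm H (x k))\<^sup>2 = Re (gram k (k + 0))" using H.hnorm_sq[OF x_in] by simp
    also have "\<dots> \<le> cmod (gram k (k + 0))" by (rule complex_Re_le_cmod)
    also have "\<dots> \<le> (\<Sum>n<m. cmod (of_nat (k choose n) * coef n 0))"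
      unfolding gram_eq by (rule norm_sum)
    also have "\<dots> \<le> (\<Sum>n<m. (1 + real k) ^ m * cmod (coef n 0))"
    proof (rule sum_mono)
      fix n assume "n \<in> {..<m}"
      have "real (k choose n) \<le> (1 + real k) ^ n"
      proof (cases "n \<le> k")
        case True
        then have "real (k choose n) \<le> real (k ^ n)" by (intro of_nat_mono binomial_le_pow)
        also have "\<dots> \<le> (1 + real k) ^ n" unfolding of_nat_power by (intro power_mono) auto
        finally show ?thesis .
      qed (simp add: binomial_eq_0)
      also have "\<dots> \<le> (1 + real k) ^ m" using \<open>n \<in> {..<m}\<close> by (intro power_increasing) auto
      finally show "cmod (of_nat (k choose n) * coef n 0) \<le> (1 + real k) ^ m * cmod (coef n 0)"
        by (simp add: norm_mult mult_right_mono)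
    qed
    also have "\<dots> = A * (1 + real k) ^ m" by (simp add: A_def sum_distrib_left mult.commute)
    finally have "(hnorm H (x k))\<^sup>2 \<le> A * (1 + real k) ^ m" .
    moreover have "hnorm H (x k) \<le> 1 + (hnorm H (x k))\<^sup>2"
    proof -
      have "0 \<le> (hnorm H (x k) - 1)\<^sup>2" by simp
      then show ?thesis using H.hnorm_nonneg[OF x_in, of k] by (simp add: power2_diff)
    qed
    moreover have "1 \<le> (1 + real k) ^ m" by (rule one_le_power) simp
    ultimately show ?thesis unfolding distrib_right by linarith
  qed
  then show ?thesis by (rule that)
qed

lemma coef_growth: obtains C where "\<And>d. cmod (coef n d) \<le> C * (1 + real d) ^ m"
proof -
  obtain A where A: "\<And>k. hnorm H (x k) \<le> A * (1 + real k) ^ m" using x_growth by blast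
  have b: "beta H T n e \<in> carrier H" by (rule beta_closed[OF T H e])
  have "cmod (coef n d) \<le> (hnorm H (beta H T n e) * A) * (1 + real d) ^ m" for d
  proof -
    have "cmod (coef n d) \<le> hnorm H (beta H T n e) * hnorm H (x d)"
      unfolding coef_def by (rule H.cauchy_schwarz[OF b x_in])
    also have "\<dots> \<le> hnorm H (beta H T n e) * (A * (1 + real d) ^ m)"
      using b by (intro mult_left_mono A) auto
    finally show ?thesis by (simp add: mult.assoc)
  qed
  then show ?thesis by (rule that)
qed

lemma associated_iff:
  "associated_tuple m H T e \<mu> \<longleftrightarrow> length \<mu> = m \<and> set \<mu> \<subseteq> distributions \<and>
    (\<forall>n<m. \<forall>k. fourier_coeff (\<mu> ! n) (int k) = coef n k \<and> cnj (fourier_coeff (\<mu> ! n) (- int k)) = coef n k)"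
  by (simp add: associated_tuple_def coef_def)

lemma associated_unique:
  assumes "associated_tuple m H T e \<mu>" "associated_tuple m H T e \<nu>" shows "\<mu> = \<nu>"
proof (rule nth_equalityI)
  show "length \<mu> = length \<nu>" using assms by (simp add: associated_iff)
  fix n assume "n < length \<mu>"
  then have n: "n < m" "\<mu> ! n \<in> distributions" "\<nu> ! n \<in> distributions"
    using assms nth_mem unfolding associated_iff by (metis subsetD)+
  show "\<mu> ! n = \<nu> ! n"
  proof (rule distribution_eqI[OF n(2,3)])
    fix k :: int
    show "fourier_coeff (\<mu> ! n) k = fourier_coeff (\<nu> ! n) k"
    proof (cases k rule: int_cases4)
      case (nonneg j)
      then show ?thesis using assms n(1) unfolding associated_iff by simp
    next
      case (neg j)
      then show ?thesis using assms n(1) unfolding associated_iff by (metis complex_cnj_cancel_iff)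
    qed
  qed
qed

text \<open>The coefficients at negative frequencies are conjugates of those at positive ones. At frequency 0 both
  prescriptions must agree, which is \<open>coef_0_real\<close>.\<close>

lemma associated_exists: "\<exists>\<mu>. associated_tuple m H T e \<mu>"
proof -
  define c where "c n k = (if k \<ge> 0 then coef n (nat k) else cnj (coef n (nat (- k))))" for n and k :: int
  have "\<exists>\<mu>. \<mu> \<in> distributions \<and> (\<forall>k. fourier_coeff \<mu> k = c n k)" for n
  proof -
    obtain C where C: "\<And>d. cmod (coef n d) \<le> C * (1 + real d) ^ m" using coef_growth by blast
    have "cmod (c n k) \<le> C * (1 + \<bar>of_int k\<bar>) ^ m" for k
      using C[of "nat k"] C[of "nat (- k)"] by (auto simp: c_def)
    then show ?thesis using distribution_exists[of "c n" C m] by metis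
  qed
  then obtain \<nu> where \<nu>: "\<And>n. \<nu> n \<in> distributions" "\<And>n k. fourier_coeff (\<nu> n) k = c n k" by metis
  have "associated_tuple m H T e (map \<nu> [0..<m])"
    unfolding associated_iff using \<nu> coef_0_real by (auto simp: c_def)
  then show ?thesis by blast
qed

lemma associated_ex1: "\<exists>!\<mu>. associated_tuple m H T e \<mu>"
  using associated_exists associated_unique by blast

text \<open>On and above the diagonal this is \<open>gram_eq\<close>; below it, both sides are conjugates of their transposes.\<close>

lemma tuple_matrix_gram:
  assumes "associated_tuple m H T e \<mu>" shows "tuple_matrix \<mu> k l = gram k l"
proof -
  have fc: "fourier_coeff (\<mu> ! n) (int d) = coef n d" "fourier_coeff (\<mu> ! n) (- int d) = cnj (coef n d)" if "n < m" for n d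
    using assms that unfolding associated_iff by (metis complex_cnj_cnj)+
  have len: "length \<mu> = m" using assms by (simp add: associated_iff)
  show ?thesis
  proof (cases "k \<le> l")
    case True
    then obtain d where d: "l = k + d" using le_Suc_ex by blast
    then show ?thesis unfolding tuple_matrix_def len d gram_eq
      by (intro sum.cong refl) (simp add: dirichlet_matrix_def fc)
  next
    case False
    then obtain d where d: "k = l + d" using le_Suc_ex nat_le_linear by blast
    have "tuple_matrix \<mu> k l = cnj (gram l (l + d))"
      unfolding tuple_matrix_def len d gram_eq cnj_sum
      by (intro sum.cong refl) (simp add: dirichlet_matrix_def fc)
    also have "\<dots> = gram k l" using H.cinner_herm[OF x_in x_in, of l k] d by simp
    finally show ?thesis .
  qed
qed

text \<open>If \<open>p\<close> runs through the Taylor polynomials of \<open>f\<close> then \<open>\<parallel>f\<parallel>\<^sup>2\<close> is the limit of \<open>\<parallel>p(T) e\<parallel>\<^sup>2\<close>,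
  and multiplication by \<open>z\<close> becomes the operator \<open>T\<close>. Positivity and the bound for \<open>M\<^sub>z\<close> are inherited
  from the Hilbert space.\<close>

lemma associated_allowable:
  assumes \<mu>: "associated_tuple m H T e \<mu>" shows "allowable m \<mu>"
proof -
  have len: "length \<mu> = m" and dist: "set \<mu> \<subseteq> distributions" using \<mu> by (auto simp: associated_iff)
  define p where "p a N = H.lincomb x a N" for a N
  have pc: "p a N \<in> carrier H" for a N unfolding p_def using x_in by simp
  have lim: "(\<lambda>N. complex_of_real ((hnorm H (p (tcoef f) N))\<^sup>2)) \<longlonglongrightarrow> sqnorm \<mu> f" if f: "f \<in> Da" for f
  proof -
    have "complex_of_real ((hnorm H (p (tcoef f) N))\<^sup>2) = sqsum (\<lambda>k l. tuple_matrix \<mu> k l * tcoef f k * cnj (tcoef f l)) N" for N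
    proof -
      have "complex_of_real ((hnorm H (p (tcoef f) N))\<^sup>2) = cinner H (p (tcoef f) N) (p (tcoef f) N)"
        by (rule H.cinner_self[OF pc, symmetric])
      also have "\<dots> = sqsum (\<lambda>k l. tuple_matrix \<mu> k l * tcoef f k * cnj (tcoef f l)) N"
        unfolding p_def tuple_matrix_gram[OF \<mu>] sqsum_def H.cinner_lincomb[of "\<lambda>k. x k" "\<lambda>k. x k", OF x_in x_in]
        by (simp only: mult_ac)
      finally show ?thesis .
    qed
    then show ?thesis
      using gform_tendsto[OF pgrowth_tuple_matrix[OF dist] Da_rapid[OF f] Da_rapid[OF f]]
      by (simp add: sqnorm_eq[OF dist f])
  qed
  obtain B where B: "B > 0" "\<And>v. v \<in> carrier H \<Longrightarrow> hnorm H (T v) \<le> B * hnorm H v"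
    using bounded_op_bound[OF T H.semi_inner_space_axioms] by blast
  have re: "(\<lambda>N. (hnorm H (p (tcoef f) N))\<^sup>2) \<longlonglongrightarrow> Re (sqnorm \<mu> f)" "Im (sqnorm \<mu> f) = 0" if "f \<in> Da" for f
    using tendsto_Re[OF lim[OF that]] tendsto_Im[OF lim[OF that]] by (simp_all add: LIMSEQ_const_iff del: of_real_power)
  have nn: "0 \<le> sqnorm \<mu> f" if "f \<in> Da" for f
    using re[OF that] LIMSEQ_le_const[OF re(1)[OF that], of 0] by (auto simp: less_eq_complex_def)
  have "sqnorm \<mu> (Mz f) \<le> complex_of_real (B\<^sup>2) * sqnorm \<mu> f" if f: "f \<in> Da" for f
  proof -
    note M = Da_Mz[OF f]
    have sh: "p (tcoef (Mz f)) (Suc N) = T (p (tcoef f) N)" for N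
    proof -
      have "p (tcoef (Mz f)) (Suc N) = H.lincomb (\<lambda>k. T (x k)) (tcoef f) N"
      proof (induction N)
        case 0
        show ?case using H.smult_l_null[of "x 0"] x_in[of 0] by (simp add: p_def M(2))
      next
        case (Suc N)
        then show ?case by (simp add: p_def M(2))
      qed
      then show ?thesis unfolding p_def
        by (simp add: linear_op_lincomb[OF bounded_op_linear[OF T] H.semi_inner_space_axioms H.semi_inner_space_axioms x_in])
    qed
    have "Re (sqnorm \<mu> (Mz f)) \<le> B\<^sup>2 * Re (sqnorm \<mu> f)"
    proof (rule LIMSEQ_le)
      show "(\<lambda>N. (hnorm H (p (tcoef (Mz f)) (Suc N)))\<^sup>2) \<longlonglongrightarrow> Re (sqnorm \<mu> (Mz f))"
        using re(1)[OF M(1)] by (rule LIMSEQ_Suc)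
      show "(\<lambda>N. B\<^sup>2 * (hnorm H (p (tcoef f) N))\<^sup>2) \<longlonglongrightarrow> B\<^sup>2 * Re (sqnorm \<mu> f)"
        by (intro tendsto_mult_left re(1) f)
      have "(hnorm H (p (tcoef (Mz f)) (Suc N)))\<^sup>2 \<le> B\<^sup>2 * (hnorm H (p (tcoef f) N))\<^sup>2" for N
        unfolding sh power_mult_distrib[symmetric]
        using B(2)[OF pc] T_in[OF pc] by (intro power_mono) auto
      then show "\<exists>K. \<forall>N\<ge>K. (hnorm H (p (tcoef (Mz f)) (Suc N)))\<^sup>2 \<le> B\<^sup>2 * (hnorm H (p (tcoef f) N))\<^sup>2" by blast
    qed
    then show ?thesis using re(2)[OF f] re(2)[OF M(1)] by (simp add: less_eq_complex_def del: of_real_power)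
  qed
  then show ?thesis
    unfolding allowable_def using len dist B(1) nn Da_Mz(1) by blast
qed

lemma total_x: "cyclic_vector H T e \<Longrightarrow> H.total_seq x"
  using H.cyclic_vector_iff[of T e] T_in by blast

lemma intertwining_unitary:
  assumes K: "m_isometry_vector K m S y" and x: "H.total_seq x"
    and y: "semi_inner_space.total_seq K (\<lambda>k. (S ^^ k) y)"
    and gram: "\<And>k l. gram k l = cinner K ((S ^^ k) y) ((S ^^ l) y)"
  obtains U where "unitary_map H K U" "\<forall>v\<in>carrier H. T v = adj H K U (S (U v))" "U e = y"
proof -
  interpret K: m_isometry_vector K m S y by fact
  obtain U where U: "unitary_map H K U" "\<And>k. U (x k) = (S ^^ k) y"
    using unitary_from_gram[OF H K.H x y gram] by blast
  note Ub = unitary_map_bounded[OF U(1)]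
  have "U (T v) = S (U v)" if v: "v \<in> carrier H" for v
  proof (rule bounded_op_eq_on_total[OF bounded_op_comp[OF T Ub H.semi_inner_space_axioms]
        bounded_op_comp[OF Ub K.T K.H.semi_inner_space_axioms] H.semi_inner_space_axioms K.H.inner_space_axioms x _ v])
    show "U (T (x k)) = S (U (x k))" for k
      using U(2)[of "Suc k"] U(2)[of k] by simp
  qed
  then have "\<forall>v\<in>carrier H. T v = adj H K U (S (U v))"
    using intertwine_iff[where T = T and S = S, OF U(1) H T_in K.T_in] by blast
  then show ?thesis using that[OF U(1)] U(2)[of 0] by simp
qed

end

text \<open>The converse direction: a unitary that intertwines the operators carries one orbit to the other.\<close>

lemma intertwining_gram:
  assumes "m_isometry_vector H m T e" "m_isometry_vector K m S y" and U: "unitary_map H K U"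
    and i: "\<forall>v\<in>carrier H. T v = adj H K U (S (U v))" and Ue: "U e = y"
  shows "cinner H ((T ^^ k) e) ((T ^^ l) e) = cinner K ((S ^^ k) y) ((S ^^ l) y)"
proof -
  interpret H: m_isometry_vector H m T e by fact
  interpret K: m_isometry_vector K m S y by fact
  have c: "U (T v) = S (U v)" if "v \<in> carrier H" for v
    using intertwine_iff[where T = T and S = S, OF U H.H H.T_in K.T_in] i that by blast
  have "U ((T ^^ j) e) = (S ^^ j) y" for j
    by (induction j) (auto simp: Ue c H.x_in)
  then show ?thesis using U H.x_in unfolding unitary_map_def by metis
qed

section \<open>The model theorem\<close>

theorem theorem3p1:
  fixes m :: nat
  assumes "m \<ge> 1"
  shows
    "(\<forall>\<mu>. normalized_allowable m \<mu> \<longrightarrow>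
        m_isometry (D2 \<mu>) m (M_op \<mu>) \<and>
        cyclic_vector (D2 \<mu>) (M_op \<mu>) (D2_class \<mu> (\<lambda>z. 1)) \<and>
        hnorm (D2 \<mu>) (D2_class \<mu> (\<lambda>z. 1)) = 1)
   \<and> (\<forall>(H :: 'h hilb) T e.
        separable_hilbert_space H \<and> m_isometry H m T \<and>
        cyclic_vector H T e \<and> hnorm H e = 1 \<longrightarrow>
        (\<exists>!\<mu>. associated_tuple m H T e \<mu>) \<and>
        (\<forall>\<mu>. associated_tuple m H T e \<mu> \<longrightarrow>
           normalized_allowable m \<mu> \<and>
           (\<exists>U. unitary_map H (D2 \<mu>) U \<and>
                (\<forall>x\<in>carrier H. T x = adj H (D2 \<mu>) U (M_op \<mu> (U x))) \<and>
                U e = D2_class \<mu> (\<lambda>z. 1))))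
   \<and> (\<forall>(H1 :: 'h1 hilb) T1 e1 (H2 :: 'h2 hilb) T2 e2.
        separable_hilbert_space H1 \<and> m_isometry H1 m T1 \<and> cyclic_vector H1 T1 e1 \<and>
        separable_hilbert_space H2 \<and> m_isometry H2 m T2 \<and> cyclic_vector H2 T2 e2 \<longrightarrow>
        (\<exists>!\<mu>1. associated_tuple m H1 T1 e1 \<mu>1) \<and>
        (\<exists>!\<mu>2. associated_tuple m H2 T2 e2 \<mu>2) \<and>
        (\<forall>\<mu>1 \<mu>2. associated_tuple m H1 T1 e1 \<mu>1 \<and> associated_tuple m H2 T2 e2 \<mu>2 \<longrightarrow>
           (\<mu>1 = \<mu>2 \<longleftrightarrow>
            (\<exists>U. unitary_map H1 H2 U \<and>
                 (\<forall>x\<in>carrier H1. T1 x = adj H1 H2 U (T2 (U x))) \<and>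
                 U e1 = e2))))"
proof (intro conjI)
  show "\<forall>\<mu>. normalized_allowable m \<mu> \<longrightarrow>
        m_isometry (D2 \<mu>) m (M_op \<mu>) \<and>
        cyclic_vector (D2 \<mu>) (M_op \<mu>) (D2_class \<mu> (\<lambda>z. 1)) \<and>
        hnorm (D2 \<mu>) (D2_class \<mu> (\<lambda>z. 1)) = 1"
  proof (intro allI impI)
    fix \<mu> assume \<mu>: "normalized_allowable m \<mu>"
    interpret allowable_tuple \<mu> m by unfold_locales (use \<mu> in \<open>simp add: normalized_allowable_def\<close>)
    show "m_isometry (D2 \<mu>) m (M_op \<mu>) \<and>
        cyclic_vector (D2 \<mu>) (M_op \<mu>) (D2_class \<mu> (\<lambda>z. 1)) \<and>
        hnorm (D2 \<mu>) (D2_class \<mu> (\<lambda>z. 1)) = 1"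
      using M_op_m_isometry one_cyclic one_norm[OF assms] \<mu> by (simp add: normalized_allowable_def)
  qed
next
  show "\<forall>(H :: 'h hilb) T e.
        separable_hilbert_space H \<and> m_isometry H m T \<and>
        cyclic_vector H T e \<and> hnorm H e = 1 \<longrightarrow>
        (\<exists>!\<mu>. associated_tuple m H T e \<mu>) \<and>
        (\<forall>\<mu>. associated_tuple m H T e \<mu> \<longrightarrow>
           normalized_allowable m \<mu> \<and>
           (\<exists>U. unitary_map H (D2 \<mu>) U \<and>
                (\<forall>x\<in>carrier H. T x = adj H (D2 \<mu>) U (M_op \<mu> (U x))) \<and>
                U e = D2_class \<mu> (\<lambda>z. 1)))"
  proof (intro allI impI, elim conjE, intro conjI allI impI)
    fix H :: "'h hilb" and T e
    assume iso: "m_isometry H m T" and cyc: "cyclic_vector H T e" and ne: "hnorm H e = 1"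
    interpret V: m_isometry_vector H m T e
      by unfold_locales (use iso cyc in \<open>auto simp: cyclic_vector_def\<close>)
    show "\<exists>!\<mu>. associated_tuple m H T e \<mu>" by (rule V.associated_ex1)
    fix \<mu> assume \<mu>: "associated_tuple m H T e \<mu>"
    interpret A: allowable_tuple \<mu> m by unfold_locales (rule V.associated_allowable[OF \<mu>])
    have "V.coef 0 0 = cinner H e e" by (simp add: V.coef_eq)
    also have "\<dots> = 1" using V.H.cinner_self[OF V.e] ne by simp
    finally have "fourier_coeff (\<mu> ! 0) 0 = 1"
      using \<mu> assms unfolding V.associated_iff by (metis of_nat_0 less_le_trans zero_less_one)
    then show "normalized_allowable m \<mu>" using A.allow by (simp add: normalized_allowable_def)
    have K: "m_isometry_vector (D2 \<mu>) m (M_op \<mu>) (D2_class \<mu> (\<lambda>z. 1))"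
      by unfold_locales (auto intro: A.M_op_m_isometry A.D2_class_in Da_const)
    show "\<exists>U. unitary_map H (D2 \<mu>) U \<and>
                (\<forall>x\<in>carrier H. T x = adj H (D2 \<mu>) U (M_op \<mu> (U x))) \<and>
                U e = D2_class \<mu> (\<lambda>z. 1)"
      by (rule V.intertwining_unitary[OF K V.total_x[OF cyc]])
        (auto simp: A.M_op_pow_1 A.D2_total A.D2_gram V.tuple_matrix_gram[OF \<mu>])
  qed
next
  show "\<forall>(H1 :: 'h1 hilb) T1 e1 (H2 :: 'h2 hilb) T2 e2.
        separable_hilbert_space H1 \<and> m_isometry H1 m T1 \<and> cyclic_vector H1 T1 e1 \<and>
        separable_hilbert_space H2 \<and> m_isometry H2 m T2 \<and> cyclic_vector H2 T2 e2 \<longrightarrow>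
        (\<exists>!\<mu>1. associated_tuple m H1 T1 e1 \<mu>1) \<and>
        (\<exists>!\<mu>2. associated_tuple m H2 T2 e2 \<mu>2) \<and>
        (\<forall>\<mu>1 \<mu>2. associated_tuple m H1 T1 e1 \<mu>1 \<and> associated_tuple m H2 T2 e2 \<mu>2 \<longrightarrow>
           (\<mu>1 = \<mu>2 \<longleftrightarrow>
            (\<exists>U. unitary_map H1 H2 U \<and>
                 (\<forall>x\<in>carrier H1. T1 x = adj H1 H2 U (T2 (U x))) \<and>
                 U e1 = e2)))"
  proof (intro allI impI, elim conjE, intro conjI allI impI)
    fix H1 :: "'h1 hilb" and T1 e1 and H2 :: "'h2 hilb" and T2 e2
    assume iso1: "m_isometry H1 m T1" and cyc1: "cyclic_vector H1 T1 e1"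
      and iso2: "m_isometry H2 m T2" and cyc2: "cyclic_vector H2 T2 e2"
    interpret V1: m_isometry_vector H1 m T1 e1
      by unfold_locales (use iso1 cyc1 in \<open>auto simp: cyclic_vector_def\<close>)
    interpret V2: m_isometry_vector H2 m T2 e2
      by unfold_locales (use iso2 cyc2 in \<open>auto simp: cyclic_vector_def\<close>)
    show "\<exists>!\<mu>1. associated_tuple m H1 T1 e1 \<mu>1" by (rule V1.associated_ex1)
    show "\<exists>!\<mu>2. associated_tuple m H2 T2 e2 \<mu>2" by (rule V2.associated_ex1)
    fix \<mu>1 \<mu>2
    assume "associated_tuple m H1 T1 e1 \<mu>1 \<and> associated_tuple m H2 T2 e2 \<mu>2"
    then have \<mu>1: "associated_tuple m H1 T1 e1 \<mu>1" and \<mu>2: "associated_tuple m H2 T2 e2 \<mu>2" by auto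
    show "\<mu>1 = \<mu>2 \<longleftrightarrow>
            (\<exists>U. unitary_map H1 H2 U \<and>
                 (\<forall>x\<in>carrier H1. T1 x = adj H1 H2 U (T2 (U x))) \<and>
                 U e1 = e2)"
    proof
      assume eq: "\<mu>1 = \<mu>2"
      have gram: "V1.gram k l = V2.gram k l" for k l
        using V1.tuple_matrix_gram[OF \<mu>1, of k l] V2.tuple_matrix_gram[OF \<mu>2, of k l] unfolding eq by (rule trans[OF sym])
      obtain U where "unitary_map H1 H2 U" "\<forall>x\<in>carrier H1. T1 x = adj H1 H2 U (T2 (U x))" "U e1 = e2"
        by (rule V1.intertwining_unitary[OF V2.m_isometry_vector_axioms V1.total_x[OF cyc1] V2.total_x[OF cyc2] gram])
      then show "\<exists>U. unitary_map H1 H2 U \<and>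
                 (\<forall>x\<in>carrier H1. T1 x = adj H1 H2 U (T2 (U x))) \<and> U e1 = e2" by blast
    next
      assume "\<exists>U. unitary_map H1 H2 U \<and>
                 (\<forall>x\<in>carrier H1. T1 x = adj H1 H2 U (T2 (U x))) \<and> U e1 = e2"
      then obtain U where U: "unitary_map H1 H2 U" "\<forall>x\<in>carrier H1. T1 x = adj H1 H2 U (T2 (U x))" "U e1 = e2" by blast
      have "V1.gram k l = V2.gram k l" for k l
        by (rule intertwining_gram[OF V1.m_isometry_vector_axioms V2.m_isometry_vector_axioms U])
      then have coef: "V1.coef n d = V2.coef n d" for n d
        unfolding V1.coef_eq V2.coef_eq by (simp only:)
      have "associated_tuple m H2 T2 e2 \<mu>1"
        using \<mu>1 unfolding V1.associated_iff V2.associated_iff coef .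
      then show "\<mu>1 = \<mu>2" using \<mu>2 by (rule V2.associated_unique)
    qed
  qed
qed

end
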